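(* Let $P$ and $Q$ be finite posets. Then the following conditions are equivalent: (a) $L(P,Q)^k$ is weakly polymatroidal for each positive integer $k$. (b) $L(P,Q)$ has linear quotients. (c) $L(P,Q)$ has a linear resolution. (d) $\beta_{1,|P|+i}(L(P,Q)) = 0$ for all $i \neq 1$. (e) $P$ is an antichain or $Q$ is a chain.
   Context: All posets are finite and nonempty; $\mathbb{K}$ is an arbitrary field. $\operatorname{Hom}(P,Q)$ is the set of order-preserving maps $P\to Q$. $S_{P,Q}=\mathbb{K}[x_{p,q} : p\in P, q\in Q]$, $u_\phi=\prod_{p\in P}x_{p,\phi(p)}$, $L(P,Q)=(u_\phi : \phi\in \operatorname{Hom}(P,Q))\subseteq S_{P,Q}$; it is generated in degree $|P|$. A chain is a poset in which any two elements are comparable; an antichain is one in which any two distinct elements are incomparable. $\beta_{i,j}(I)=\dim_{\mathbb K}\operatorname{Tor}_i^{S}(I,\mathbb{K})_j$ are the graded Betti numbers of an ideal $I\subseteq S$ (as a module, all variables of degree 1). For a monomial ideal $I$, $G(I)$ is its minimal set of monomial generators. Let $I$ be a monomial ideal in a polynomial ring $S$, all of whose minimal generators have the same degree $d$. $I$ has a linear resolution if $\beta_{i,j}(I)=0$ for all $i$ and all $j\ne i+d$. $I$ has linear quotients if its minimal monomial generators can be ordered $m_1,\dots,m_r$ so that each colon ideal $(m_1,\dots,m_{i-1}):m_i$, $i=2,\dots,r$, is generated by linear forms. $I$ is weakly polymatroidal if, for some ordering $x_1>\dots>x_n$ of the variables of $S$, the following holds: for any two monomials $u=x_1^{a_1}\cdots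 x_n^{a_n}$ and $v=x_1^{b_1}\cdots x_n^{b_n}$ in $G(I)$ and any $t$ with $a_1=b_1,\dots,a_{t-1}=b_{t-1}$ and $a_t>b_t$, there exists $l>t$ such that $x_l$ divides $v$ and $x_t(v/x_l)\in I$. *)

theory Defs
  imports Complex_Main "HOL-Library.Poly_Mapping"
begin

section \<open>Polynomial rings and monomial ideals\<close>

type_synonym 'x monom = "'x \<Rightarrow>\<^sub>0 nat"
type_synonym ('x, 'k) mpoly = "'x monom \<Rightarrow>\<^sub>0 'k"

definition mon :: "'x monom \<Rightarrow> ('x, 'k::comm_ring_1) mpoly" where
  "mon m = Poly_Mapping.single m 1"

definition var :: "'x \<Rightarrow> ('x, 'k::comm_ring_1) mpoly" where
  "var x = mon (Poly_Mapping.single x 1)"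

definition mdeg :: "'x monom \<Rightarrow> nat" where
  "mdeg m = (\<Sum>x\<in>Poly_Mapping.keys m. Poly_Mapping.lookup m x)"

text \<open>The zero polynomial is homogeneous of every degree.\<close>

definition homogeneous :: "nat \<Rightarrow> ('x, 'k::comm_ring_1) mpoly \<Rightarrow> bool" where
  "homogeneous d f \<longleftrightarrow> (\<forall>m\<in>Poly_Mapping.keys f. mdeg m = d)"

definition ideal_gen :: "'a::comm_ring_1 set \<Rightarrow> 'a set" where
  "ideal_gen A = module.span (*) A"

fun ideal_pow :: "'a::comm_ring_1 set \<Rightarrow> nat \<Rightarrow> 'a set" where
  "ideal_pow I 0 = UNIV"
| "ideal_pow I (Suc k) = ideal_gen {a * b |a b. a \<in> I \<and> b \<in> ideal_pow I k}"

definition colon :: "'a::comm_ring_1 set \<Rightarrow> 'a \<Rightarrow> 'a set" where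
  "colon I a = {f. f * a \<in> I}"

text \<open>
  The minimal set of monomial generators, as a set of exponent vectors.  Every monomial
  ideal has exactly one such set; the value on other ideals is irrelevant.
\<close>

definition mingens :: "('x, 'k::comm_ring_1) mpoly set \<Rightarrow> 'x monom set" where
  "mingens I = (THE M. ideal_gen (mon ` M) = I \<and> (\<forall>M'. M' \<subset> M \<longrightarrow> ideal_gen (mon ` M') \<noteq> I))"

definition linear_quotients :: "('x, 'k::comm_ring_1) mpoly set \<Rightarrow> bool" where
  "linear_quotients I \<longleftrightarrow>
    (\<exists>ms. distinct ms \<and> set ms = mingens I \<and>
      (\<forall>i. 0 < i \<and> i < length ms \<longrightarrow>
        (\<exists>A :: ('x, 'k) mpoly set. (\<forall>f\<in>A. homogeneous 1 f) \<and>
          colon (ideal_gen (mon ` set (take i ms))) (mon (ms ! i)) = ideal_gen A)))"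

text \<open>
  The list \<open>xs\<close> enumerates all the variables, in decreasing order.  The subtraction of
  exponent vectors is the exact quotient \<open>v / x\<^sub>l\<close>, since \<open>x\<^sub>l\<close> divides \<open>v\<close>.
\<close>

definition weakly_polymatroidal :: "('x, 'k::comm_ring_1) mpoly set \<Rightarrow> bool" where
  "weakly_polymatroidal I \<longleftrightarrow>
    (\<exists>xs. distinct xs \<and> set xs = UNIV \<and>
      (\<forall>u\<in>mingens I. \<forall>v\<in>mingens I. \<forall>t < length xs.
        (\<forall>s<t. Poly_Mapping.lookup u (xs ! s) = Poly_Mapping.lookup v (xs ! s)) \<and> Poly_Mapping.lookup u (xs ! t) > Poly_Mapping.lookup v (xs ! t) \<longrightarrow>
        (\<exists>l. t < l \<and> l < length xs \<and> Poly_Mapping.lookup v (xs ! l) > 0 \<and>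
          var (xs ! t) * mon (v - Poly_Mapping.single (xs ! l) 1) \<in> I)))"


section \<open>Graded Betti numbers\<close>

text \<open>
  A complex \<open>\<dots> \<rightarrow> F\<^sub>2 \<rightarrow> F\<^sub>1 \<rightarrow> F\<^sub>0\<close> of graded free modules over a polynomial ring \<open>S\<close>, with an
  augmentation \<open>F\<^sub>0 \<rightarrow> S\<close>.  The basis of \<open>F\<^sub>i\<close> is indexed by \<open>res_basis F i\<close>, the basis element
  \<open>b\<close> has degree \<open>res_shift F i b\<close>, and \<open>res_bd F i b\<close> is the image in \<open>F\<^sub>i\<close> of the basis
  element \<open>b\<close> of \<open>F\<^sub>i\<^sub>+\<^sub>1\<close>.  An element of \<open>F\<^sub>i\<close> is its finitely supported vector of coefficients.
\<close>

record (overloaded) ('x, 'k::zero) gr_res =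
  res_basis :: "nat \<Rightarrow> nat set"
  res_shift :: "nat \<Rightarrow> nat \<Rightarrow> nat"
  res_bd :: "nat \<Rightarrow> nat \<Rightarrow> (nat \<Rightarrow>\<^sub>0 ('x, 'k) mpoly)"
  res_aug :: "nat \<Rightarrow> ('x, 'k) mpoly"

definition vscale :: "'r::comm_ring_1 \<Rightarrow> (nat \<Rightarrow>\<^sub>0 'r) \<Rightarrow> (nat \<Rightarrow>\<^sub>0 'r)" where
  "vscale c v = Poly_Mapping.map ((*) c) v"

definition free_on :: "nat set \<Rightarrow> (nat \<Rightarrow>\<^sub>0 'r::comm_ring_1) set" where
  "free_on B = {v. Poly_Mapping.keys v \<subseteq> B}"

definition lin_ext :: "(nat \<Rightarrow> (nat \<Rightarrow>\<^sub>0 'r::comm_ring_1)) \<Rightarrow> (nat \<Rightarrow>\<^sub>0 'r) \<Rightarrow> (nat \<Rightarrow>\<^sub>0 'r)" where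
  "lin_ext f v = (\<Sum>b\<in>Poly_Mapping.keys v. vscale (Poly_Mapping.lookup v b) (f b))"

definition aug_ext :: "(nat \<Rightarrow> 'r::comm_ring_1) \<Rightarrow> (nat \<Rightarrow>\<^sub>0 'r) \<Rightarrow> 'r" where
  "aug_ext g v = (\<Sum>b\<in>Poly_Mapping.keys v. Poly_Mapping.lookup v b * g b)"

text \<open>
  The modules of a resolution are required to have finitely many basis elements in each degree
  rather than finite rank; this makes all graded pieces finite dimensional.  Non-negative
  shifts suffice, because an ideal lives in non-negative degrees.
\<close>

definition graded_free_resolution ::
    "('x, 'k::comm_ring_1) mpoly set \<Rightarrow> ('x, 'k) gr_res \<Rightarrow> bool" where
  "graded_free_resolution I F \<longleftrightarrow>
    (\<forall>i j. finite {b \<in> res_basis F i. res_shift F i b = j}) \<and>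
    (\<forall>b\<in>res_basis F 0. homogeneous (res_shift F 0 b) (res_aug F b)) \<and>
    (\<forall>i. \<forall>b\<in>res_basis F (Suc i). res_bd F i b \<in> free_on (res_basis F i) \<and>
      (\<forall>c\<in>Poly_Mapping.keys (res_bd F i b). \<forall>m\<in>Poly_Mapping.keys (Poly_Mapping.lookup (res_bd F i b) c).
        mdeg m + res_shift F i c = res_shift F (Suc i) b)) \<and>
    aug_ext (res_aug F) ` free_on (res_basis F 0) = I \<and>
    {v \<in> free_on (res_basis F 0). aug_ext (res_aug F) v = 0} =
      lin_ext (res_bd F 0) ` free_on (res_basis F 1) \<and>
    (\<forall>i. {v \<in> free_on (res_basis F (Suc i)). lin_ext (res_bd F i) v = 0} =
      lin_ext (res_bd F (Suc i)) ` free_on (res_basis F (Suc (Suc i))))"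

text \<open>
  Here \<open>K = S / (all variables)\<close>, so that \<open>F\<^sub>i \<otimes> K\<close> is the \<open>K\<close>-vector space on the basis of
  \<open>F\<^sub>i\<close>, and the matrix of the differential of \<open>F \<otimes> K\<close> consists of the constant coefficients of
  the matrix entries of the differential of \<open>F\<close>.
\<close>

definition tensor_piece :: "('x, 'k::field) gr_res \<Rightarrow> nat \<Rightarrow> int \<Rightarrow> (nat \<Rightarrow>\<^sub>0 'k) set" where
  "tensor_piece F i j = free_on {b \<in> res_basis F i. int (res_shift F i b) = j}"

definition tensor_bd :: "('x, 'k::field) gr_res \<Rightarrow> nat \<Rightarrow> (nat \<Rightarrow>\<^sub>0 'k) \<Rightarrow> (nat \<Rightarrow>\<^sub>0 'k)" where
  "tensor_bd F i = lin_ext (\<lambda>b. Poly_Mapping.map (\<lambda>f. Poly_Mapping.lookup f 0) (res_bd F i b))"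

definition tensor_cycles :: "('x, 'k::field) gr_res \<Rightarrow> nat \<Rightarrow> int \<Rightarrow> (nat \<Rightarrow>\<^sub>0 'k) set" where
  "tensor_cycles F i j = {v \<in> tensor_piece F i j. \<forall>i'. i = Suc i' \<longrightarrow> tensor_bd F i' v = 0}"

definition tensor_boundaries :: "('x, 'k::field) gr_res \<Rightarrow> nat \<Rightarrow> int \<Rightarrow> (nat \<Rightarrow>\<^sub>0 'k) set" where
  "tensor_boundaries F i j = tensor_bd F i ` tensor_piece F (Suc i) j"

text \<open>
  The dimension of the degree \<open>j\<close> part of \<open>Tor\<^sub>i(I, K)\<close>, which is the quotient of the cycles by
  the boundaries in \<open>F \<otimes> K\<close> for a graded free resolution \<open>F\<close> of \<open>I\<close>; it does not depend on the
  choice of \<open>F\<close>.  Both dimensions are finite, and the boundaries are contained in the cycles,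
  so the subtraction is not truncated.
\<close>

definition betti :: "('x, 'k::field) mpoly set \<Rightarrow> nat \<Rightarrow> int \<Rightarrow> nat" where
  "betti I i j =
    (let F = (SOME F. graded_free_resolution I F)
     in vector_space.dim vscale (tensor_cycles F i j)
        - vector_space.dim vscale (tensor_boundaries F i j))"

definition linear_resolution :: "('x, 'k::field) mpoly set \<Rightarrow> bool" where
  "linear_resolution I \<longleftrightarrow>
    (\<exists>d. (\<forall>m\<in>mingens I. mdeg m = d) \<and>
      (\<forall>i j. j \<noteq> int i + int d \<longrightarrow> betti I i j = 0))"


section \<open>The ideal of a pair of posets\<close>

definition hom_monomial ::
    "('p::{finite,order} \<Rightarrow> 'q::{finite,order}) \<Rightarrow> ('p \<times> 'q, 'k::field) mpoly" where
  "hom_monomial \<phi> = (\<Prod>p\<in>UNIV. var (p, \<phi> p))"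

definition hom_ideal :: "('p::{finite,order} \<times> 'q::{finite,order}, 'k::field) mpoly set" where
  "hom_ideal = ideal_gen (hom_monomial ` {\<phi>. mono \<phi>})"

end

theory Submission
  imports Defs "HOL-Library.Countable" "HOL-Library.List_Lexorder"
begin

text \<open>
  If \<open>P\<close> is an antichain or \<open>Q\<close> is a chain, then membership of an exponent vector in \<open>G(L\<^sup>k)\<close> is
  described by row sums and by monotonicity of partial row sums, and the exchange property can be
  checked directly.  Ordering the generators lexicographically turns the exchange property into
  linear quotients.

  Betti numbers are compared with Koszul homology: a zigzag through an arbitrary graded free
  resolution shows that \<open>Tor\<^sub>i(I, K)\<^sub>j\<close> vanishes if \<open>H\<^sub>i(x; I)\<^sub>j\<close> does, and conversely for \<open>i = 1\<close>.
  Linear quotients filter \<open>I\<close> by ideals whose successive quotients are polynomial rings modulo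
  variables; in each multidegree the Koszul complex of such a quotient is either a cone or lives in
  the linear strand.  If \<open>P\<close> has comparable elements and \<open>Q\<close> incomparable elements, two
  homomorphisms that differ exactly on a connected component of \<open>P\<close> of size at least two have a
  syzygy that is not generated by linear ones.
\<close>

text \<open>\<open>betti\<close> is read off a resolution picked by \<open>SOME\<close>. Hence
  existence has to be proved, and every vanishing claim must hold for an arbitrary, possibly
  non-minimal resolution. Koszul homology of the ideal mentions no resolution, so all the
  combinatorics happens there, and only vanishing, not an isomorphism, is carried across. The way
  back from Tor is taken for \<open>i = 1\<close> because condition (d) speaks of nothing else and
  the five conditions are proved in a cycle. Monomial ideals split the Koszul complex by
  multidegree. One homotopy \<open>khom\<close> therefore serves all acyclicity proofs:
  \<open>\<sigma>\<close> picks the cone variable in each multidegree, and \<open>None\<close> marks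
  those where no variable is available. In (e) implies (a), both alternatives are merged by a
  numbering \<open>r\<close> of Q for which the order-preserving maps are exactly those along which
  \<open>r\<close> does not decrease. The variables must be ordered so that rows of smaller elements
  of P come first: an exchange inside the row of p raises partial sums of that row, and the bound
  required from the rows of smaller elements is known because u and v already agree there.\<close>

abbreviation lookup where "lookup \<equiv> Poly_Mapping.lookup"
abbreviation single where "single \<equiv> Poly_Mapping.single"
abbreviation keys where "keys \<equiv> Poly_Mapping.keys"

section \<open>Monomials\<close>

lemma sum_single_keys: "(\<Sum>k\<in>keys f. single k (lookup f k)) = f"
  by (rule poly_mapping_eqI)
    (simp add: lookup_sum lookup_single when_def in_keys_iff)

lemma mdeg_UNIV: "mdeg m = (\<Sum>x\<in>UNIV. lookup m x)" for m :: "'x::finite monom"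
  unfolding mdeg_def by (rule sum.mono_neutral_left) (auto simp: in_keys_iff)

lemma mdeg_add [simp]: "mdeg (m + n) = mdeg m + mdeg n" for m :: "'x::finite monom"
  by (simp add: mdeg_UNIV lookup_add sum.distrib)

lemma mdeg_single [simp]: "mdeg (single x n) = n"
  by (cases "n = 0") (simp_all add: mdeg_def)

lemma mdeg_0 [simp]: "mdeg 0 = 0"
  by (simp add: mdeg_def)

lemma mdeg_eq_0_iff [simp]: "mdeg m = 0 \<longleftrightarrow> m = 0"
  by (auto simp: mdeg_def in_keys_iff intro: poly_mapping_eqI)

lemma mdeg_sum: "mdeg (sum f A) = (\<Sum>a\<in>A. mdeg (f a))" for f :: "'a \<Rightarrow> 'x::finite monom"
  by (induction A rule: infinite_finite_induct) auto

lemma finite_mdeg: "finite {m :: 'x::finite monom. mdeg m = j}"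
proof -
  have "finite {f :: 'x \<Rightarrow> nat. \<forall>x. f x \<in> {..j}}"
    using finite_set_of_finite_funs[of "UNIV :: 'x set" "{..j}" 0] by simp
  moreover have "lookup ` {m :: 'x monom. mdeg m = j} \<subseteq> {f. \<forall>x. f x \<in> {..j}}"
    by (auto simp: mdeg_UNIV intro: member_le_sum)
  ultimately have "finite (lookup ` {m :: 'x monom. mdeg m = j})"
    by (rule finite_subset[rotated])
  moreover have "inj_on lookup {m :: 'x monom. mdeg m = j}"
    by (intro inj_onI) simp
  ultimately show ?thesis
    by (rule finite_imageD)
qed

section \<open>Divisibility of exponent vectors\<close>

definition mdvd :: "'x monom \<Rightarrow> 'x monom \<Rightarrow> bool" (infix "mdvd" 50) where
  "m mdvd n \<longleftrightarrow> (\<forall>x. lookup m x \<le> lookup n x)"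

text \<open>Subtraction of exponents is truncated at zero, so divisibility is what makes
  \<open>n - m\<close> an exact quotient.\<close>

lemma mdvd_diff_add: "m mdvd n \<Longrightarrow> m + (n - m) = n"
  by (auto simp: mdvd_def lookup_add lookup_minus intro!: poly_mapping_eqI)

lemma mdvd_diff_add': "m mdvd n \<Longrightarrow> (n - m) + m = n"
  using mdvd_diff_add[of m n] by (simp add: add.commute)

lemma mdvd_add [simp]: "m mdvd m + n" "m mdvd n + m"
  by (auto simp: mdvd_def lookup_add)

lemma mdvd_addI: "l mdvd m \<Longrightarrow> l mdvd m + n" "l mdvd m \<Longrightarrow> l mdvd n + m"
  by (auto simp: mdvd_def lookup_add trans_le_add1 trans_le_add2)

lemma mdvd_refl [simp]: "m mdvd m"
  by (simp add: mdvd_def)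

lemma mdvd_trans: "l mdvd m \<Longrightarrow> m mdvd n \<Longrightarrow> l mdvd n"
  by (meson mdvd_def le_trans)

lemma mdvd_antisym: "m mdvd n \<Longrightarrow> n mdvd m \<Longrightarrow> m = n"
  by (meson mdvd_def le_antisym poly_mapping_eqI)

lemma mdvd_mdeg_eq: "m mdvd n \<Longrightarrow> mdeg m = mdeg n \<Longrightarrow> m = n" for m n :: "'x::finite monom"
  by (metis add_cancel_right_right mdeg_add mdeg_eq_0_iff mdvd_diff_add)

lemma single_mdvd_iff: "single x (Suc 0) mdvd n \<longleftrightarrow> lookup n x > 0"
  by (auto simp: mdvd_def lookup_single when_def)

section \<open>Monomials as polynomials, and coefficients of products\<close>

lemma mon_mult: "mon m * mon n = (mon (m + n) :: ('x, 'k::comm_ring_1) mpoly)"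
  by (simp add: mon_def mult_single)

lemma mon_prod: "(\<Prod>a\<in>A. mon (f a)) = (mon (\<Sum>a\<in>A. f a) :: ('x, 'k::comm_ring_1) mpoly)"
  by (induction A rule: infinite_finite_induct) (simp_all add: mon_mult, simp_all add: mon_def)

lemma keys_mon [simp]: "keys (mon m :: ('x, 'k::comm_ring_1) mpoly) = {m}"
  by (simp add: mon_def)

lemma lookup_mon: "lookup (mon m :: ('x, 'k::comm_ring_1) mpoly) n = (if n = m then 1 else 0)"
  by (simp add: mon_def lookup_single when_def eq_commute)

lemma lookup_single_mult:
  "lookup (single m c * f) n = (if m mdvd n then c * lookup f (n - m) else 0)"
  for f :: "('x, 'k::comm_ring_1) mpoly"
proof -
  have "single m c * f = single m c * (\<Sum>k\<in>keys f. single k (lookup f k))"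
    by (simp add: sum_single_keys)
  also have "\<dots> = (\<Sum>k\<in>keys f. single (m + k) (c * lookup f k))"
    by (simp add: sum_distrib_left mult_single)
  finally have eq: "lookup (single m c * f) n = (\<Sum>k\<in>keys f. (c * lookup f k when m + k = n))"
    by (simp add: lookup_sum lookup_single)
  show ?thesis
  proof (cases "m mdvd n")
    case True
    then have "m + k = n \<longleftrightarrow> k = n - m" for k
      using mdvd_diff_add[OF True] by (metis add_left_cancel)
    then show ?thesis using True by (simp add: eq when_def in_keys_iff)
  next
    case False
    then have "m + k \<noteq> n" for k by auto
    then show ?thesis using False by (simp add: eq)
  qed
qed

lemma lookup_var_mult:
  "lookup (var x * f) n = (if lookup n x > 0 then lookup f (n - single x 1) else 0)"
  for f :: "('x, 'k::comm_ring_1) mpoly"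
  by (simp add: var_def mon_def lookup_single_mult single_mdvd_iff)

text \<open>The constant coefficient is the ring homomorphism from S to K that kills the variables;
  this is what makes reduction modulo the variables commute with the differentials later.\<close>

lemma lookup_mult_0: "lookup (f * g) 0 = lookup f 0 * lookup g 0"
  for f g :: "('x, 'k::comm_ring_1) mpoly"
proof -
  have "lookup (f * g) 0 = (\<Sum>k\<in>keys f. lookup (single k (lookup f k) * g) 0)"
    by (subst sum_single_keys[of f, symmetric]) (simp add: sum_distrib_right lookup_sum)
  also have "\<dots> = (\<Sum>k\<in>keys f. if k = 0 then lookup f 0 * lookup g 0 else 0)"
  proof (intro sum.cong refl)
    fix k :: "'x monom"
    have "k mdvd 0 \<longleftrightarrow> k = 0" by (auto simp: mdvd_def intro: poly_mapping_eqI)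
    then show "lookup (single k (lookup f k) * g) 0 = (if k = 0 then lookup f 0 * lookup g 0 else 0)"
      by (simp add: lookup_single_mult)
  qed
  finally show ?thesis by (simp add: in_keys_iff)
qed

section \<open>Monomial ideals\<close>

lemma module_times: "module ((*) :: 'a::comm_ring_1 \<Rightarrow> 'a \<Rightarrow> 'a)"
  by unfold_locales (simp_all add: algebra_simps)

lemma ideal_gen_superset: "A \<subseteq> ideal_gen A"
  by (simp add: ideal_gen_def module.span_superset[OF module_times])

lemma ideal_gen_0: "0 \<in> ideal_gen A"
  and ideal_gen_add: "f \<in> ideal_gen A \<Longrightarrow> g \<in> ideal_gen A \<Longrightarrow> f + g \<in> ideal_gen A"
  and ideal_gen_diff: "f \<in> ideal_gen A \<Longrightarrow> g \<in> ideal_gen A \<Longrightarrow> f - g \<in> ideal_gen A"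
  and ideal_gen_mult: "f \<in> ideal_gen A \<Longrightarrow> c * f \<in> ideal_gen A"
  and ideal_gen_sum: "(\<And>i. i \<in> B \<Longrightarrow> h i \<in> ideal_gen A) \<Longrightarrow> sum h B \<in> ideal_gen A"
  unfolding ideal_gen_def
  by (simp_all add: module.span_zero[OF module_times] module.span_add[OF module_times] module.span_diff[OF module_times]
      module.span_scale[OF module_times] module.span_sum[OF module_times])

lemma ideal_gen_minimal: "A \<subseteq> ideal_gen B \<Longrightarrow> ideal_gen A \<subseteq> ideal_gen B"
  unfolding ideal_gen_def
  by (intro module.span_minimal[OF module_times] module.subspace_span[OF module_times])

text \<open>The support of a product lies in the sum of the supports, so the right-hand side is an
  ideal. From here on, membership in a monomial ideal is a question about the exponents in the
  support alone.\<close>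

lemma ideal_gen_mon:
  "ideal_gen (mon ` M) = {f :: ('x, 'k::comm_ring_1) mpoly. \<forall>k\<in>keys f. \<exists>m\<in>M. m mdvd k}"
    (is "_ = ?R")
proof
  have "module.subspace (*) ?R"
  proof (rule module.subspaceI[OF module_times])
    fix f g :: "('x, 'k) mpoly" assume "f \<in> ?R" "g \<in> ?R"
    then show "f + g \<in> ?R" using keys_add[of f g] by blast
  next
    fix c f :: "('x, 'k) mpoly" assume f: "f \<in> ?R"
    show "c * f \<in> ?R"
    proof safe
      fix k assume "k \<in> keys (c * f)"
      then obtain a b where "k = a + b" "b \<in> keys f" using keys_mult[of c f] by blast
      then show "\<exists>m\<in>M. m mdvd k" using f by (auto intro: mdvd_addI)
    qed
  qed auto
  moreover have "mon ` M \<subseteq> ?R" by force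
  ultimately show "ideal_gen (mon ` M) \<subseteq> ?R"
    unfolding ideal_gen_def by (intro module.span_minimal[OF module_times])
next
  show "?R \<subseteq> ideal_gen (mon ` M)"
  proof
    fix f assume f: "f \<in> ?R"
    have "(\<Sum>k\<in>keys f. single k (lookup f k)) \<in> ideal_gen (mon ` M)"
    proof (rule ideal_gen_sum)
      fix k assume "k \<in> keys f"
      then obtain m where m: "m \<in> M" "m mdvd k" using f by blast
      have "single k (lookup f k) = single (k - m) (lookup f k) * mon m"
        by (simp add: mon_def mult_single mdvd_diff_add' m)
      moreover have "(mon m :: ('x, 'k) mpoly) \<in> ideal_gen (mon ` M)" using m(1) ideal_gen_superset by blast
      ultimately show "single k (lookup f k) \<in> ideal_gen (mon ` M)"
        by (simp add: ideal_gen_mult)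
    qed
    then show "f \<in> ideal_gen (mon ` M)" by (simp add: sum_single_keys)
  qed
qed

lemma mon_in_ideal_gen:
  "(mon k :: ('x, 'k::comm_ring_1) mpoly) \<in> ideal_gen (mon ` M) \<longleftrightarrow> (\<exists>m\<in>M. m mdvd k)"
  by (simp add: ideal_gen_mon)

text \<open>Justifies the \<open>THE\<close>. If an irredundant N generates the same ideal, each m
  in M is divisible by some n in N, which is divisible by some m' in M. The antichain condition
  gives m' = m, hence n = m, so M is contained in N, and irredundance of N gives equality.\<close>

lemma mingens_ideal_gen:
  assumes anti: "\<And>m n. m \<in> M \<Longrightarrow> n \<in> M \<Longrightarrow> m mdvd n \<Longrightarrow> m = n"
  shows "mingens (ideal_gen (mon ` M) :: ('x, 'k::comm_ring_1) mpoly set) = M"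
  unfolding mingens_def
proof (rule the_equality)
  let ?I = "\<lambda>M. ideal_gen (mon ` M) :: ('x, 'k) mpoly set"
  have min: "?I M' \<noteq> ?I M" if sub: "M' \<subset> M" for M'
  proof
    assume eq: "?I M' = ?I M"
    obtain m where m: "m \<in> M" "m \<notin> M'" using psubset_imp_ex_mem[OF sub] by blast
    then have "(mon m :: ('x, 'k) mpoly) \<in> ?I M"
      by (intro subsetD[OF ideal_gen_superset] imageI)
    then obtain n where "n \<in> M'" "n mdvd m" unfolding eq[symmetric] mon_in_ideal_gen by blast
    then show False using anti[of n m] m sub by blast
  qed
  show "?I M = ?I M \<and> (\<forall>M'. M' \<subset> M \<longrightarrow> ?I M' \<noteq> ?I M)"
    by (intro conjI refl allI impI min)
  fix N assume N: "?I N = ?I M \<and> (\<forall>M'. M' \<subset> N \<longrightarrow> ?I M' \<noteq> ?I M)"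
  have "M \<subseteq> N"
  proof
    fix m assume m: "m \<in> M"
    then have "(mon m :: ('x, 'k) mpoly) \<in> ?I M"
      by (intro subsetD[OF ideal_gen_superset] imageI)
    then have "(mon m :: ('x, 'k) mpoly) \<in> ?I N" using N by simp
    then obtain n where n: "n \<in> N" "n mdvd m" unfolding mon_in_ideal_gen by blast
    then have "(mon n :: ('x, 'k) mpoly) \<in> ?I N"
      by (intro subsetD[OF ideal_gen_superset] imageI)
    then have "(mon n :: ('x, 'k) mpoly) \<in> ?I M" using N by simp
    then obtain m' where m': "m' \<in> M" "m' mdvd n" unfolding mon_in_ideal_gen by blast
    with n(2) m have "m' = m" by (meson anti mdvd_trans)
    with n m' have "m = n" by (meson mdvd_antisym)
    with n(1) show "m \<in> N" by simp
  qed
  with N show "N = M" by (metis psubsetI)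
qed

lemma mingens_ideal_gen_mdeg:
  fixes M :: "'x::finite monom set"
  assumes "\<And>m. m \<in> M \<Longrightarrow> mdeg m = d"
  shows "mingens (ideal_gen (mon ` M) :: ('x, 'k::comm_ring_1) mpoly set) = M"
  using assms by (intro mingens_ideal_gen) (metis mdvd_mdeg_eq)

lemma ideal_gen_mult_mon:
  "ideal_gen {a * b |a b. a \<in> ideal_gen (mon ` M) \<and> b \<in> ideal_gen (mon ` N)}
    = (ideal_gen (mon ` {m + n |m n. m \<in> M \<and> n \<in> N}) :: ('x, 'k::comm_ring_1) mpoly set)"
  (is "ideal_gen ?A = ideal_gen (mon ` ?B)")
proof
  show "ideal_gen ?A \<subseteq> ideal_gen (mon ` ?B)"
  proof (rule ideal_gen_minimal, safe)
    fix a b :: "('x, 'k) mpoly"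
    assume a: "a \<in> ideal_gen (mon ` M)" and b: "b \<in> ideal_gen (mon ` N)"
    show "a * b \<in> ideal_gen (mon ` ?B)"
      unfolding ideal_gen_mon
    proof safe
      fix k assume "k \<in> keys (a * b)"
      then obtain i j where k: "k = i + j" "i \<in> keys a" "j \<in> keys b" using keys_mult[of a b] by blast
      then obtain m n where "m \<in> M" "n \<in> N" "m mdvd i" "n mdvd j"
        using a b unfolding ideal_gen_mon by blast
      then show "\<exists>l\<in>?B. l mdvd k"
        unfolding k(1) by (intro bexI[of _ "m + n"]) (auto simp: mdvd_def lookup_add add_mono)
    qed
  qed
  show "ideal_gen (mon ` ?B) \<subseteq> ideal_gen ?A"
  proof (rule ideal_gen_minimal, safe)
    fix m n assume "m \<in> M" "n \<in> N"
    then have "(mon m :: ('x, 'k) mpoly) \<in> ideal_gen (mon ` M)"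
      "(mon n :: ('x, 'k) mpoly) \<in> ideal_gen (mon ` N)"
      using ideal_gen_superset by blast+
    then have "(mon m * mon n :: ('x, 'k) mpoly) \<in> ?A" by blast
    then show "(mon (m + n) :: ('x, 'k) mpoly) \<in> ideal_gen ?A"
      unfolding mon_mult by (meson ideal_gen_superset subsetD)
  qed
qed

lemma UNIV_eq_ideal_gen_mon: "(UNIV :: ('x, 'k::comm_ring_1) mpoly set) = ideal_gen (mon ` {0})"
  unfolding ideal_gen_mon by (auto simp: mdvd_def)

text \<open>Multiplication by a monomial shifts the support injectively, so nothing cancels and the
  colon ideal is again tested on exponents.\<close>

lemma colon_ideal_gen_mon:
  "f \<in> colon (ideal_gen (mon ` M)) (mon n :: ('x, 'k::comm_ring_1) mpoly)
    \<longleftrightarrow> (\<forall>k\<in>keys f. \<exists>m\<in>M. m mdvd k + n)"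
proof -
  have *: "lookup (f * mon n) k = (if n mdvd k then lookup f (k - n) else 0)" for k
    by (simp add: mult.commute[of f] mon_def lookup_single_mult)
  have "keys (f * mon n) = (\<lambda>k. k + n) ` keys f"
  proof safe
    fix k assume "k \<in> keys (f * mon n)"
    then have "n mdvd k" "k - n \<in> keys f" by (auto simp: in_keys_iff * split: if_splits)
    then show "k \<in> (\<lambda>k. k + n) ` keys f" using mdvd_diff_add' by (metis imageI)
  qed (simp add: in_keys_iff *)
  then show ?thesis unfolding colon_def ideal_gen_mon by simp
qed

section \<open>The Koszul complex\<close>

text \<open>The sign of moving x past the smaller elements of B in an exterior product. The
  variables carry no order of their own, so the injection \<open>to_nat\<close> supplies
  one.\<close>

definition ksgn :: "'x::finite \<Rightarrow> 'x set \<Rightarrow> 'r::comm_ring_1" where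
  "ksgn x B = (- 1) ^ card {y \<in> B. to_nat y < to_nat x}"

lemma ksgn_square [simp]: "ksgn x B * ksgn x B = 1"
  by (simp add: ksgn_def flip: power_mult_distrib)

lemma ksgn_square_left [simp]: "ksgn x B * (ksgn x B * r) = r"
  by (simp flip: mult.assoc)

lemma ksgn_insert:
  assumes "y \<notin> B"
  shows "ksgn x (insert y B) = (if to_nat y < to_nat x then - ksgn x B else (ksgn x B :: 'r::comm_ring_1))"
proof (cases "to_nat y < to_nat x")
  case True
  then have "{z \<in> insert y B. to_nat z < to_nat x} = insert y {z \<in> B. to_nat z < to_nat x}" by auto
  then show ?thesis using True assms by (simp add: ksgn_def)
next
  case False
  then have "{z \<in> insert y B. to_nat z < to_nat x} = {z \<in> B. to_nat z < to_nat x}" by auto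
  then show ?thesis using False by (simp add: ksgn_def)
qed

text \<open>Of the two variables exactly one is the smaller, so inserting both changes exactly one
  of the two signs. The first form makes the Koszul differential square to zero; the second cancels
  the mixed terms of the homotopy.\<close>

lemma ksgn_swap:
  assumes "x \<noteq> y" "x \<notin> B" "y \<notin> B"
  shows "ksgn y B * ksgn x (insert y B) = - (ksgn x B * ksgn y (insert x B) :: 'r::comm_ring_1)"
    and "ksgn y (insert x B) * ksgn x (insert y B) = - (ksgn x B * ksgn y B :: 'r)"
proof -
  have "to_nat x < to_nat y \<or> to_nat y < to_nat x"
    using assms(1) by (metis linorder_neqE_nat to_nat_split)
  then show "ksgn y B * ksgn x (insert y B) = - (ksgn x B * ksgn y (insert x B) :: 'r)"
    and "ksgn y (insert x B) * ksgn x (insert y B) = - (ksgn x B * ksgn y B :: 'r)"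
    using assms by (auto simp: ksgn_insert)
qed

lemma lookup_ksgn_mult: "lookup (ksgn x B * f) n = ksgn x B * lookup f n"
  for f :: "('x::finite, 'k::comm_ring_1) mpoly"
  by (cases "even (card {y \<in> B. to_nat y < to_nat x})") (simp_all add: ksgn_def)

text \<open>An element of \<open>S \<otimes> \<And>\<^sup>q K\<^sup>n\<close> is given by its coefficients at the sets of \<open>q\<close> variables.\<close>

definition kos :: "('x::finite set \<Rightarrow> ('x, 'k::comm_ring_1) mpoly) \<Rightarrow> 'x set \<Rightarrow> ('x, 'k) mpoly" where
  "kos c B = (\<Sum>x\<in>-B. ksgn x B * (var x * c (insert x B)))"

text \<open>Each exterior generator counts with degree one, so \<open>kos\<close> preserves the
  total degree \<open>j\<close> while lowering \<open>q\<close>.\<close>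

definition kchain :: "nat \<Rightarrow> nat \<Rightarrow> ('x::finite set \<Rightarrow> ('x, 'k::comm_ring_1) mpoly) \<Rightarrow> bool" where
  "kchain q j c \<longleftrightarrow> (\<forall>A. card A \<noteq> q \<longrightarrow> c A = 0) \<and> (\<forall>A. \<forall>n\<in>keys (c A). mdeg n + card A = j)"

lemma kos_0 [simp]: "kos (\<lambda>_. 0) = (\<lambda>_. 0)"
  by (simp add: kos_def fun_eq_iff)

lemma kos_add: "kos (\<lambda>A. c A + e A) B = kos c B + kos e B"
  by (simp add: kos_def distrib_left sum.distrib)

lemma kos_diff: "kos (\<lambda>A. c A - e A) B = kos c B - kos e B"
  by (simp add: kos_def right_diff_distrib sum_subtractf)

lemma kos_in_ideal_gen: "(\<And>A. c A \<in> ideal_gen G) \<Longrightarrow> kos c B \<in> ideal_gen G"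
  unfolding kos_def by (intro ideal_gen_sum ideal_gen_mult)

lemma lookup_kos:
  "lookup (kos c B) n =
    (\<Sum>x\<in>-B. if lookup n x > 0 then ksgn x B * lookup (c (insert x B)) (n - single x 1) else 0)"
  unfolding kos_def lookup_sum lookup_ksgn_mult lookup_var_mult
  by (intro sum.cong refl) simp

text \<open>Ordered pairs of inserted variables are split by which one is smaller; swapping the pair
  is a bijection between the two halves that reverses the sign.\<close>

lemma kos_kos: "kos (kos c) B = 0"
proof -
  define t where "t = (\<lambda>(y, x). ksgn y B * (var y * (ksgn x (insert y B) * (var x * c (insert x (insert y B))))))"
  let ?T1 = "{(y, x). y \<notin> B \<and> x \<notin> B \<and> to_nat y < to_nat x}"
  let ?T2 = "{(y, x). y \<notin> B \<and> x \<notin> B \<and> to_nat x < to_nat y}"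
  have "(SIGMA y:-B. - insert y B) = ?T1 \<union> ?T2"
    by auto (metis linorder_neqE_nat to_nat_split)
  then have "kos (kos c) B = sum t (?T1 \<union> ?T2)"
    by (simp add: kos_def sum_distrib_left sum.Sigma t_def)
  also have "\<dots> = sum t ?T1 + sum t ?T2"
    by (rule sum.union_disjoint) auto
  also have "sum t ?T2 = (\<Sum>z\<in>?T1. t (prod.swap z))"
    by (rule sum.reindex_bij_witness[of _ prod.swap prod.swap]) auto
  also have "\<dots> = (\<Sum>z\<in>?T1. - t z)"
  proof (intro sum.cong refl)
    fix z assume "z \<in> ?T1"
    then obtain y x where z: "z = (y, x)" "y \<notin> B" "x \<notin> B" "x \<noteq> y" by auto
    let ?m = "var x * (var y * c (insert x (insert y B)))"
    have "t (prod.swap z) = (ksgn x B * ksgn y (insert x B)) * ?m"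
      unfolding z(1) t_def swap_simp prod.case insert_commute[of y x B] by (simp only: ac_simps)
    also have "\<dots> = - ((ksgn y B * ksgn x (insert y B)) * ?m)"
      using z by (subst ksgn_swap(1)) simp_all
    also have "\<dots> = - t z"
      unfolding z(1) t_def prod.case by (simp only: ac_simps)
    finally show "t (prod.swap z) = - t z" .
  qed
  finally show ?thesis by (simp add: sum_negf)
qed

text \<open>The multidegree of the exterior basis element at A. A monomial n at A thus has
  multidegree \<open>n + sqfree A\<close>, which \<open>kos\<close> preserves.\<close>

definition sqfree :: "'x set \<Rightarrow> 'x monom" where
  "sqfree A = (\<Sum>x\<in>A. single x 1)"

lemma lookup_sqfree: "lookup (sqfree A) x = (if x \<in> A then 1 else 0)" for A :: "'x::finite set"
  by (simp add: sqfree_def lookup_sum lookup_single when_def)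

lemma mdeg_sqfree [simp]: "mdeg (sqfree A) = card A" for A :: "'x::finite set"
  by (simp add: sqfree_def mdeg_sum)

text \<open>
  In a fixed multidegree \<open>a\<close> the Koszul complex is the chain complex of a simplex, and coning
  with the variable \<open>\<sigma> a\<close> contracts it.
\<close>

definition khom :: "('x monom \<Rightarrow> 'x option) \<Rightarrow> ('x::finite set \<Rightarrow> ('x, 'k::comm_ring_1) mpoly)
    \<Rightarrow> 'x set \<Rightarrow> ('x, 'k) mpoly" where
  "khom \<sigma> c A = Abs_poly_mapping (\<lambda>n. case \<sigma> (n + sqfree A) of None \<Rightarrow> 0
    | Some x \<Rightarrow> if x \<in> A then ksgn x (A - {x}) * lookup (c (A - {x})) (n + single x 1) else 0)"

lemma lookup_khom:
  "lookup (khom \<sigma> c A) n = (case \<sigma> (n + sqfree A) of None \<Rightarrow> 0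
    | Some x \<Rightarrow> if x \<in> A then ksgn x (A - {x}) * lookup (c (A - {x})) (n + single x 1) else 0)"
proof -
  let ?f = "\<lambda>n. case \<sigma> (n + sqfree A) of None \<Rightarrow> 0
    | Some x \<Rightarrow> if x \<in> A then ksgn x (A - {x}) * lookup (c (A - {x})) (n + single x 1) else 0"
  have "{n. ?f n \<noteq> 0} \<subseteq> (\<Union>x. (\<lambda>k. k - single x 1) ` keys (c (A - {x})))"
  proof
    fix n assume "n \<in> {n. ?f n \<noteq> 0}"
    then obtain x where "n + single x 1 \<in> keys (c (A - {x}))"
      by (auto simp: in_keys_iff split: option.splits if_splits dest!: mult_not_zero)
    then show "n \<in> (\<Union>x. (\<lambda>k. k - single x 1) ` keys (c (A - {x})))"
      by (intro UN_I[of x] rev_image_eqI) auto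
  qed
  then have "finite {n. ?f n \<noteq> 0}" by (rule finite_subset) auto
  then show ?thesis unfolding khom_def by simp
qed

text \<open>The identity of a contracting homotopy. Since \<open>\<sigma>\<close> depends on the
  multidegree only, both summands use the same variable x. If x is outside B, only the term y = x of
  the first summand survives. If x is in B, the term y = x of the second summand gives
  \<open>c B\<close>, because its sign occurs twice, and all other terms cancel between the two
  summands by \<open>ksgn_swap\<close>.\<close>

lemma kos_khom:
  assumes \<sigma>: "\<And>a x. \<sigma> a = Some x \<Longrightarrow> lookup a x > 0"
  shows "lookup (kos (khom \<sigma> c) B) n + lookup (khom \<sigma> (kos c) B) n =
    (if \<sigma> (n + sqfree B) = None then 0 else lookup (c B) n)"
proof -
  define a where "a = n + sqfree B"
  have shift: "n - single y 1 + sqfree (insert y B) = a" if "y \<notin> B" "lookup n y > 0" for y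
    using that by (auto simp: a_def lookup_add lookup_minus lookup_sqfree lookup_single when_def
        intro!: poly_mapping_eqI)
  have "lookup (kos (khom \<sigma> c) B) n = (\<Sum>y\<in>-B. if lookup n y > 0
      then ksgn y B * lookup (khom \<sigma> c (insert y B)) (n - single y 1) else 0)"
    by (rule lookup_kos)
  also have "\<dots> = (\<Sum>y\<in>-B. if lookup n y > 0 then ksgn y B * (case \<sigma> a of None \<Rightarrow> 0
      | Some x \<Rightarrow> if x \<in> insert y B then ksgn x (insert y B - {x}) *
        lookup (c (insert y B - {x})) (n - single y 1 + single x 1) else 0) else 0)"
    by (intro sum.cong refl if_cong) (simp only: lookup_khom shift Compl_iff not_False_eq_True)
  finally have L1: "lookup (kos (khom \<sigma> c) B) n = \<dots>" .
  have L2: "lookup (khom \<sigma> (kos c) B) n = (case \<sigma> a of None \<Rightarrow> 0 | Some x \<Rightarrow>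
      if x \<in> B then ksgn x (B - {x}) * lookup (kos c (B - {x})) (n + single x 1) else 0)"
    by (simp only: lookup_khom a_def)
  show ?thesis
  proof (cases "\<sigma> a")
    case None
    then show ?thesis unfolding a_def[symmetric] L1 L2 None option.case by (simp cong: if_cong)
  next
    case (Some x)
    note L1 = L1[unfolded Some option.case] and L2 = L2[unfolded Some option.case]
    \<comment> \<open>The cone variable divides the multidegree, so it divides the coefficient
      monomial or is an exterior generator; these are the two cases.\<close>
    have pos: "lookup n x > 0 \<or> x \<in> B"
      using \<sigma>[OF Some] by (auto simp: a_def lookup_add lookup_sqfree split: if_splits)
    show ?thesis
    proof (cases "x \<in> B")
      case False
      with pos have "single x 1 mdvd n" by (simp add: single_mdvd_iff)
      then have "n - single x 1 + single x 1 = n" by (rule mdvd_diff_add')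
      moreover have "insert x B - {x} = B" using False by auto
      moreover have "lookup (kos (khom \<sigma> c) B) n = (\<Sum>y\<in>-B. if y = x then
          ksgn x B * (ksgn x (insert x B - {x}) * lookup (c (insert x B - {x})) (n - single x 1 + single x 1)) else 0)"
        unfolding L1 using False Some pos by (intro sum.cong refl) auto
      ultimately show ?thesis unfolding a_def[symmetric] using L2 Some False by simp
    next
      case True
      define B0 where "B0 = B - {x}"
      have B: "B = insert x B0" "x \<notin> B0" using True by (auto simp: B0_def)
      have L1': "lookup (kos (khom \<sigma> c) B) n = (\<Sum>y\<in>-B. if lookup n y > 0 then
          ksgn y B * (ksgn x (insert y B - {x}) *
            lookup (c (insert y B - {x})) (n - single y 1 + single x 1)) else 0)"
        unfolding L1 using True by (intro sum.cong refl) auto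
      have "lookup (khom \<sigma> (kos c) B) n = ksgn x B0 * lookup (kos c B0) (n + single x 1)"
        using L2 Some True by (simp add: B0_def)
      also have "\<dots> = ksgn x B0 * (\<Sum>y\<in>insert x (-B). if lookup (n + single x 1) y > 0 then
          ksgn y B0 * lookup (c (insert y B0)) (n + single x 1 - single y 1) else 0)"
        unfolding lookup_kos using B by (intro arg_cong2[of _ _ _ _ "(*)"] refl sum.cong) auto
      also have "\<dots> = lookup (c B) n + (\<Sum>y\<in>-B. ksgn x B0 * (if lookup (n + single x 1) y > 0 then
          ksgn y B0 * lookup (c (insert y B0)) (n + single x 1 - single y 1) else 0))"
        using True B by (subst sum.insert) (simp_all add: lookup_add distrib_left sum_distrib_left)
      finally have "lookup (kos (khom \<sigma> c) B) n + lookup (khom \<sigma> (kos c) B) n = lookup (c B) n +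
        (\<Sum>y\<in>-B. (if lookup n y > 0 then ksgn y B * (ksgn x (insert y B - {x}) *
          lookup (c (insert y B - {x})) (n - single y 1 + single x 1)) else 0) +
        ksgn x B0 * (if lookup (n + single x 1) y > 0 then
          ksgn y B0 * lookup (c (insert y B0)) (n + single x 1 - single y 1) else 0))"
        unfolding L1' sum.distrib by (simp only: add.left_commute)
      also have "(\<Sum>y\<in>-B. (if lookup n y > 0 then ksgn y B * (ksgn x (insert y B - {x}) *
          lookup (c (insert y B - {x})) (n - single y 1 + single x 1)) else 0) +
        ksgn x B0 * (if lookup (n + single x 1) y > 0 then
          ksgn y B0 * lookup (c (insert y B0)) (n + single x 1 - single y 1) else 0)) = 0"
      proof (rule sum.neutral, rule ballI)
        fix y assume "y \<in> -B"
        then have y: "y \<notin> B0" "y \<noteq> x" using B by auto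
        have 1: "insert y B - {x} = insert y B0" using B y by auto
        have 2: "lookup (n + single x 1) y = lookup n y" using y by (simp add: lookup_add lookup_single)
        have 3: "n - single y 1 + single x 1 = n + single x 1 - single y 1"
          using y by (auto intro!: poly_mapping_eqI simp: lookup_add lookup_minus lookup_single when_def)
        show "(if lookup n y > 0 then ksgn y B * (ksgn x (insert y B - {x}) *
          lookup (c (insert y B - {x})) (n - single y 1 + single x 1)) else 0) +
        ksgn x B0 * (if lookup (n + single x 1) y > 0 then
          ksgn y B0 * lookup (c (insert y B0)) (n + single x 1 - single y 1) else 0) = 0"
        proof (cases "lookup n y > 0")
          case True
          let ?l = "lookup (c (insert y B0)) (n + single x 1 - single y 1)"
          have "ksgn y B * (ksgn x (insert y B0) * ?l) + ksgn x B0 * (ksgn y B0 * ?l) =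
            (ksgn y B * ksgn x (insert y B0) + ksgn x B0 * ksgn y B0) * ?l"
            by (simp only: distrib_right mult.assoc)
          also have "ksgn y B * ksgn x (insert y B0) = (- (ksgn x B0 * ksgn y B0) :: 'b)"
            unfolding B(1) using y B(2) by (intro ksgn_swap(2)) auto
          finally show ?thesis unfolding 1 2 3 using True by (simp only: if_True) simp
        qed (unfold 1 2 3, simp)
      qed
      finally show ?thesis unfolding a_def[symmetric] using Some by simp
    qed
  qed
qed

lemma kchain_khom:
  assumes c: "kchain q j c" and \<sigma>: "\<And>a x. \<sigma> a = Some x \<Longrightarrow> lookup a x > 0"
  shows "kchain (Suc q) j (khom \<sigma> c)"
proof -
  have "card A = Suc q \<and> mdeg n + card A = j" if nz: "lookup (khom \<sigma> c A) n \<noteq> 0" for A n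
  proof -
    obtain x where x: "x \<in> A" "n + single x 1 \<in> keys (c (A - {x}))"
      using nz by (auto simp: lookup_khom in_keys_iff split: option.splits if_splits dest!: mult_not_zero)
    then have "card (A - {x}) = q" "mdeg (n + single x 1) + card (A - {x}) = j"
      using c unfolding kchain_def by (metis empty_iff keys_zero, blast)
    moreover have "card A = Suc (card (A - {x}))"
      using x(1) by (metis card.remove finite)
    ultimately show ?thesis by simp
  qed
  then show ?thesis unfolding kchain_def
    by (metis in_keys_iff lookup_zero poly_mapping_eqI)
qed

lemma kchain_kos:
  assumes e: "kchain (Suc q) j e"
  shows "kchain q j (kos e)"
proof -
  have "card A = q \<and> mdeg n + card A = j" if nz: "lookup (kos e A) n \<noteq> 0" for A n
  proof -
    obtain x where x: "x \<notin> A" "lookup n x > 0" "n - single x 1 \<in> keys (e (insert x A))"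
      using nz unfolding lookup_kos by (auto simp: in_keys_iff elim!: sum.not_neutral_contains_not_neutral split: if_splits dest!: mult_not_zero)
    then have "card (insert x A) = Suc q" "mdeg (n - single x 1) + card (insert x A) = j"
      using e unfolding kchain_def by (metis empty_iff keys_zero, blast)
    moreover have "mdeg n = mdeg (n - single x 1) + 1"
      using x(2) by (metis One_nat_def mdeg_add mdeg_single mdvd_diff_add' single_mdvd_iff)
    ultimately show ?thesis using x(1) by simp
  qed
  then show ?thesis unfolding kchain_def
    by (metis in_keys_iff lookup_zero poly_mapping_eqI)
qed

lemma kchain_diff: "kchain q j c \<Longrightarrow> kchain q j e \<Longrightarrow> kchain q j (\<lambda>A. c A - e A)"
  unfolding kchain_def using keys_diff by fastforce

text \<open>Any variable that divides the multidegree contracts it. Only multidegree 0 has none; it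
  occurs only for the constant coefficient at the empty set, which \<open>q0\<close>
  excludes.\<close>

lemma kos_exact:
  assumes c: "kchain q j c" and cyc: "\<And>B. kos c B = 0" and q0: "q = 0 \<Longrightarrow> lookup (c {}) 0 = 0"
  shows "\<exists>e. kchain (Suc q) j e \<and> kos e = c"
proof -
  define \<sigma> :: "'a monom \<Rightarrow> 'a option" where
    "\<sigma> a = (if a = 0 then None else Some (SOME x. lookup a x > 0))" for a
  have \<sigma>: "lookup a x > 0" if "\<sigma> a = Some x" for a x
  proof -
    have "\<exists>x. lookup a x > 0"
      using that unfolding \<sigma>_def by (metis gr0I lookup_zero option.distinct(1) poly_mapping_eqI)
    then have "lookup a (SOME x. lookup a x > 0) > 0" by (rule someI_ex)
    then show ?thesis using that by (simp add: \<sigma>_def split: if_splits)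
  qed
  have "kos (khom \<sigma> c) B = c B" for B
  proof (rule poly_mapping_eqI)
    fix n
    have "kos c = (\<lambda>_. 0)" using cyc by (rule ext)
    then have "khom \<sigma> (kos c) B = khom \<sigma> (\<lambda>_. 0) B" by (simp add: khom_def)
    then have "lookup (khom \<sigma> (kos c) B) n = 0" by (simp add: lookup_khom split: option.splits)
    then have *: "lookup (kos (khom \<sigma> c) B) n = (if n + sqfree B = 0 then 0 else lookup (c B) n)"
      using kos_khom[of \<sigma> c B n, OF \<sigma>] by (simp add: \<sigma>_def)
    have "lookup (c B) n = 0" if "n + sqfree B = 0"
    proof -
      have "mdeg (n + sqfree B) = 0" using that by simp
      then have "n = 0" "B = {}" by auto
      then show ?thesis using q0 c unfolding kchain_def by (cases "q = 0") auto
    qed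
    with * show "lookup (kos (khom \<sigma> c) B) n = lookup (c B) n" by simp
  qed
  then show ?thesis using kchain_khom[OF c \<sigma>] by blast
qed

section \<open>Linear quotients\<close>

lemma mdeg_eq_1_E:
  fixes k :: "'x::finite monom"
  assumes "mdeg k = 1"
  obtains x where "k = single x 1"
proof -
  have "k \<noteq> 0" using assms by auto
  then obtain x where "lookup k x > 0" by (metis gr0I lookup_zero poly_mapping_eqI)
  then have "single x 1 mdvd k" by (simp add: single_mdvd_iff)
  then have "single x 1 = k" using assms by (intro mdvd_mdeg_eq) simp_all
  then show ?thesis using that by blast
qed

text \<open>The colon ideal is tested on supports, so it contains every monomial of each of its
  linear generators, and these monomials are variables. For i = 0 there are no earlier generators
  and V is empty.\<close>

lemma linear_quotients_variables:
  fixes M :: "'x::finite monom set"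
  assumes lq: "linear_quotients (ideal_gen (mon ` M) :: ('x, 'k::comm_ring_1) mpoly set)"
    and deg: "\<And>m. m \<in> M \<Longrightarrow> mdeg m = d"
  obtains ms where "set ms = M"
    "\<And>i. i < length ms \<Longrightarrow> \<exists>V. \<forall>n. (\<exists>l\<in>set (take i ms). l mdvd n + ms ! i) \<longleftrightarrow> (\<exists>x\<in>V. lookup n x > 0)"
proof -
  let ?I = "\<lambda>N. ideal_gen (mon ` N) :: ('x, 'k) mpoly set"
  obtain ms where ms: "set ms = M"
    and lin: "\<And>i. 0 < i \<Longrightarrow> i < length ms \<Longrightarrow> \<exists>A :: ('x, 'k) mpoly set. (\<forall>f\<in>A. homogeneous 1 f) \<and>
          colon (?I (set (take i ms))) (mon (ms ! i)) = ideal_gen A"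
    using lq mingens_ideal_gen_mdeg[of M d, where 'k = 'k, OF deg] unfolding linear_quotients_def by metis
  have "\<exists>V. \<forall>n. (\<exists>l\<in>set (take i ms). l mdvd n + ms ! i) \<longleftrightarrow> (\<exists>x\<in>V. lookup n x > 0)"
    if i: "i < length ms" for i
  proof (cases "i = 0")
    case True
    then show ?thesis by (intro exI[of _ "{}"]) simp
  next
    case False
    then obtain A :: "('x, 'k) mpoly set" where A: "\<And>f. f \<in> A \<Longrightarrow> homogeneous 1 f"
      "colon (?I (set (take i ms))) (mon (ms ! i)) = ideal_gen A"
      using lin[OF _ i] by fast
    let ?N = "{n. \<exists>l\<in>set (take i ms). l mdvd n + ms ! i}"
    define V where "V = {x. single x 1 \<in> ?N}"
    have mem: "f \<in> ideal_gen A \<longleftrightarrow> keys f \<subseteq> ?N" for f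
      unfolding A(2)[symmetric] colon_ideal_gen_mon by blast
    have "A \<subseteq> ?I ((\<lambda>x. single x 1) ` V)"
    proof
      fix f assume f: "f \<in> A"
      then have "keys f \<subseteq> ?N" using ideal_gen_superset mem by blast
      moreover have "\<exists>x. k = single x 1" if "k \<in> keys f" for k
        using A(1)[OF f] that unfolding homogeneous_def by (metis mdeg_eq_1_E)
      ultimately have "\<exists>m\<in>(\<lambda>x. single x 1) ` V. m mdvd k" if "k \<in> keys f" for k
        using that unfolding V_def by (metis (mono_tags, lifting) imageI mdvd_refl mem_Collect_eq subsetD)
      then show "f \<in> ?I ((\<lambda>x. single x 1) ` V)" unfolding ideal_gen_mon by blast
    qed
    then have "ideal_gen A \<subseteq> ?I ((\<lambda>x. single x 1) ` V)" by (rule ideal_gen_minimal)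
    then have 1: "\<exists>x\<in>V. lookup n x > 0" if "n \<in> ?N" for n
      using that mem[of "mon n"] mon_in_ideal_gen[of n "(\<lambda>x. single x 1) ` V", where 'k = 'k]
      by (auto simp: single_mdvd_iff)
    have 2: "n \<in> ?N" if x: "x \<in> V" "lookup n x > 0" for n x
    proof -
      obtain l where l: "l \<in> set (take i ms)" "l mdvd single x 1 + ms ! i"
        using x(1) unfolding V_def by blast
      have "single x 1 mdvd n" using x(2) by (simp add: single_mdvd_iff)
      then have "single x 1 + ms ! i mdvd n + ms ! i"
        by (auto simp: mdvd_def lookup_add)
      then show ?thesis using l mdvd_trans by blast
    qed
    show ?thesis using 1 2 by (intro exI[of _ V]) blast
  qed
  with ms that show thesis by blast
qed

text \<open>
  \<open>I / J\<close>, for \<open>J = (M)\<close> and \<open>I = (M, m)\<close>, is the quotient of the polynomial ring by the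
  variables in \<open>V\<close>, so a variable outside \<open>V\<close> contracts its Koszul complex.
\<close>

lemma kos_boundary_mod:
  fixes c :: "'x::finite set \<Rightarrow> ('x, 'k::comm_ring_1) mpoly"
  assumes colon: "\<And>n. (\<exists>l\<in>M. l mdvd n + m) \<longleftrightarrow> (\<exists>x\<in>V. lookup n x > 0)"
    and c: "kchain q j c" and cI: "\<And>A. c A \<in> ideal_gen (mon ` insert m M)"
    and cyc: "\<And>B. kos c B = 0" and j: "j \<noteq> q + mdeg m"
  shows "\<exists>e. kchain (Suc q) j e \<and> (\<forall>A. e A \<in> ideal_gen (mon ` insert m M)) \<and>
    (\<forall>B. c B - kos e B \<in> ideal_gen (mon ` M))"
proof -
  let ?J = "\<lambda>n. \<exists>l\<in>M. l mdvd n"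
  \<comment> \<open>The representative of c modulo \<open>(M)\<close> with no terms in
    \<open>(M)\<close>; its remaining terms are multiples of m.\<close>
  define c' where "c' A = (\<Sum>k\<in>{k\<in>keys (c A). \<not> ?J k}. single k (lookup (c A) k))" for A
  have c': "lookup (c' A) n = (if ?J n then 0 else lookup (c A) n)" for A n
    by (auto simp: c'_def lookup_sum lookup_single when_def in_keys_iff)
  \<comment> \<open>The cone moves one x from the coefficient into the exterior part, so the strict
    inequality keeps the coefficient divisible by m; x outside V ensures that multiplying by x does
    not push a multiple of m into \<open>(M)\<close>.\<close>
  define \<sigma> where "\<sigma> a = (if \<exists>x. x \<notin> V \<and> lookup a x > lookup m x
    then Some (SOME x. x \<notin> V \<and> lookup a x > lookup m x) else None)" for a
  have \<sigma>: "x \<notin> V \<and> lookup a x > lookup m x" if "\<sigma> a = Some x" for a x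
    using that someI_ex[of "\<lambda>x. x \<notin> V \<and> lookup a x > lookup m x"] by (auto simp: \<sigma>_def split: if_splits)
  have \<sigma>': "lookup a x > 0" if "\<sigma> a = Some x" for a x
    using \<sigma>[OF that] by linarith
  define e where "e = khom \<sigma> c'"
  have chain_c': "kchain q j c'"
    using c unfolding kchain_def by (auto simp: c' in_keys_iff intro!: poly_mapping_eqI split: if_splits)
  have e: "kchain (Suc q) j e"
    unfolding e_def by (rule kchain_khom[OF chain_c' \<sigma>'])
  have eI: "e A \<in> ideal_gen (mon ` insert m M)" for A
    unfolding ideal_gen_mon
  proof safe
    fix n assume "n \<in> keys (e A)"
    then obtain x where x: "\<sigma> (n + sqfree A) = Some x" "x \<in> A"
      "lookup (c' (A - {x})) (n + single x 1) \<noteq> 0"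
      by (auto simp: e_def lookup_khom in_keys_iff split: option.splits if_splits dest!: mult_not_zero)
    then have "\<not> ?J (n + single x 1)" "n + single x 1 \<in> keys (c (A - {x}))"
      by (auto simp: c' in_keys_iff split: if_splits)
    then have m: "m mdvd n + single x 1"
      using cI[of "A - {x}"] unfolding ideal_gen_mon by blast
    have "lookup m y \<le> lookup n y" for y
    proof (cases "y = x")
      case True
      then show ?thesis using \<sigma>[OF x(1)] x(2) by (simp add: lookup_add lookup_sqfree)
    next
      case False
      then show ?thesis using m unfolding mdvd_def by (metis add.right_neutral lookup_add lookup_single_not_eq)
    qed
    then show "\<exists>l\<in>insert m M. l mdvd n" by (auto simp: mdvd_def)
  qed
  have "c B - kos e B \<in> ideal_gen (mon ` M)" for B
    unfolding ideal_gen_mon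
  proof safe
    fix n assume nz: "n \<in> keys (c B - kos e B)"
    show "?J n"
    proof (rule ccontr)
      assume nJ: "\<not> ?J n"
      have "c B - kos e B \<in> ideal_gen (mon ` insert m M)"
        by (intro ideal_gen_diff cI kos_in_ideal_gen eI)
      then have mn: "m mdvd n" using nz nJ unfolding ideal_gen_mon by blast
      define n' where "n' = n - m"
      have n: "n = n' + m" using mdvd_diff_add'[OF mn] by (simp add: n'_def)
      have n'V: "lookup n' x = 0" if "x \<in> V" for x
        using nJ colon[of n'] that unfolding n by (metis gr0I)
      have kos_c': "kos c' A \<in> ideal_gen (mon ` M)" for A
      proof -
        have "kos (\<lambda>A. c A - c' A) A \<in> ideal_gen (mon ` M)"
          by (rule kos_in_ideal_gen) (auto simp: ideal_gen_mon in_keys_iff lookup_minus c' split: if_splits)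
        then have "0 - kos (\<lambda>A. c A - c' A) A \<in> ideal_gen (mon ` M)"
          by (intro ideal_gen_diff ideal_gen_0)
        then show ?thesis by (simp add: kos_diff cyc)
      qed
      \<comment> \<open>\<open>kos c'\<close> has terms in \<open>(M)\<close> only. A nonzero value
        would make n times the cone variable lie in \<open>(M)\<close>; as n itself does not, that
        variable would belong to V.\<close>
      have "lookup (khom \<sigma> (kos c') B) n = 0"
      proof (rule ccontr)
        assume "lookup (khom \<sigma> (kos c') B) n \<noteq> 0"
        then obtain x where x: "\<sigma> (n + sqfree B) = Some x"
          "n + single x 1 \<in> keys (kos c' (B - {x}))"
          by (auto simp: lookup_khom in_keys_iff split: option.splits if_splits dest!: mult_not_zero)
        then have "?J (n + single x 1)" using kos_c' unfolding ideal_gen_mon by blast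
        then have "?J ((n' + single x 1) + m)" by (simp add: n ac_simps)
        then obtain y where "y \<in> V" "lookup (n' + single x 1) y > 0" using colon by blast
        then show False using n'V \<sigma>[OF x(1)] by (auto simp: lookup_add lookup_single when_def split: if_splits)
      qed
      then have k: "lookup (kos e B) n = (if \<sigma> (n + sqfree B) = None then 0 else lookup (c B) n)"
        using kos_khom[of \<sigma> c' B n, OF \<sigma>'] nJ by (simp add: e_def c')
      with nz have "\<sigma> (n + sqfree B) = None" and nc: "n \<in> keys (c B)"
        by (auto simp: in_keys_iff lookup_minus split: if_splits)
      \<comment> \<open>With no cone variable, the cofactor n' of m involves no variable outside V,
        and none inside V since n is not in \<open>(M)\<close>. So the term is m itself, and its
        degree is the excluded value \<open>q + mdeg m\<close>.\<close>
      then have "lookup n' x = 0" if "x \<notin> V" for x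
        using that by (auto simp: \<sigma>_def n lookup_add not_less split: if_splits)
      with n'V have "n' = 0" by (metis lookup_zero poly_mapping_eqI)
      then have "n = m" by (simp add: n)
      moreover have "card B = q" "mdeg n + card B = j"
        using nc c unfolding kchain_def by (metis empty_iff keys_zero, blast)
      ultimately show False using j by simp
    qed
  qed
  with e eI show ?thesis by blast
qed

text \<open>Induction on the number of generators, in place of long exact sequences. A cycle in the
  ideal of the first i + 1 generators becomes, after subtracting a boundary \<open>kos e\<close>, a
  cycle in the ideal of the first i; if that equals \<open>kos f\<close>, then e + f fills the
  original one.\<close>

lemma kos_linear_quotients:
  fixes c :: "'x::finite set \<Rightarrow> ('x, 'k::comm_ring_1) mpoly"
  assumes V: "\<And>i. i < length ms \<Longrightarrow> \<exists>V. \<forall>n. (\<exists>l\<in>set (take i ms). l mdvd n + ms ! i) \<longleftrightarrow> (\<exists>x\<in>V. lookup n x > 0)"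
    and deg: "\<And>m. m \<in> set ms \<Longrightarrow> mdeg m = d"
    and c: "kchain q j c" and cI: "\<And>A. c A \<in> ideal_gen (mon ` set ms)"
    and cyc: "\<And>B. kos c B = 0" and j: "j \<noteq> q + d"
  shows "\<exists>f. (\<forall>A. f A \<in> ideal_gen (mon ` set ms)) \<and> kos f = c"
proof -
  let ?I = "\<lambda>i. ideal_gen (mon ` set (take i ms)) :: ('x, 'k) mpoly set"
  have "\<exists>f. (\<forall>A. f A \<in> ?I i) \<and> kos f = c"
    if "i \<le> length ms" "kchain q j c" "\<And>A. c A \<in> ?I i" "\<And>B. kos c B = 0" for i c
    using that
  proof (induction i arbitrary: c)
    case 0
    then have "keys (c A) = {}" for A
      unfolding ideal_gen_mon by auto
    then have "c = (\<lambda>_. 0)" by (simp add: fun_eq_iff)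
    then show ?case by (intro exI[of _ "\<lambda>_. 0"]) (simp add: ideal_gen_0)
  next
    case (Suc i)
    then have i: "i < length ms" by simp
    have set: "set (take (Suc i) ms) = insert (ms ! i) (set (take i ms))"
      using i by (simp add: take_Suc_conv_app_nth)
    obtain V where "\<And>n. (\<exists>l\<in>set (take i ms). l mdvd n + ms ! i) \<longleftrightarrow> (\<exists>x\<in>V. lookup n x > 0)"
      using V[OF i] by blast
    moreover have "j \<noteq> q + mdeg (ms ! i)" using deg i j by simp
    ultimately obtain e where e: "kchain (Suc q) j e" "\<And>A. e A \<in> ?I (Suc i)"
      "\<And>B. c B - kos e B \<in> ?I i"
      using kos_boundary_mod[OF _ Suc.prems(2), of "set (take i ms)" "ms ! i" V] Suc.prems(3,4)
      unfolding set by blast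
    have "kos (\<lambda>B. c B - kos e B) B = 0" for B
      using Suc.prems(4) kos_kos[of e] by (simp add: kos_diff)
    then obtain f where f: "\<And>A. f A \<in> ?I i" "kos f = (\<lambda>B. c B - kos e B)"
      using Suc.IH[of "\<lambda>B. c B - kos e B"] i e(3) kchain_diff[OF Suc.prems(2) kchain_kos[OF e(1)]] by auto
    have "f A \<in> ?I (Suc i)" for A
      using f(1)[of A] unfolding ideal_gen_mon set by blast
    moreover have "kos (\<lambda>A. e A + f A) = c"
      by (rule ext) (simp add: kos_add f(2))
    ultimately show ?case using ideal_gen_add e(2) by (intro exI[of _ "\<lambda>A. e A + f A"]) blast
  qed
  from this[of "length ms" c] show ?thesis using c cI cyc by simp
qed

text \<open>The generators are taken in lexicographically decreasing order.\<close>

lemma weakly_polymatroidal_imp_linear_quotients: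
  fixes M :: "'x::finite monom set"
  assumes wp: "weakly_polymatroidal (ideal_gen (mon ` M) :: ('x, 'k::comm_ring_1) mpoly set)"
    and deg: "\<And>m. m \<in> M \<Longrightarrow> mdeg m = d"
  shows "linear_quotients (ideal_gen (mon ` M) :: ('x, 'k) mpoly set)"
proof -
  let ?I = "\<lambda>N. ideal_gen (mon ` N) :: ('x, 'k) mpoly set"
  have gens: "mingens (?I M) = M" by (rule mingens_ideal_gen_mdeg[OF deg])
  obtain xs :: "'x list" where xs: "set xs = UNIV"
    and exchange: "\<And>u v t. u \<in> M \<Longrightarrow> v \<in> M \<Longrightarrow> t < length xs \<Longrightarrow>
      \<forall>s<t. lookup u (xs ! s) = lookup v (xs ! s) \<Longrightarrow> lookup u (xs ! t) > lookup v (xs ! t) \<Longrightarrow>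
      \<exists>l. t < l \<and> l < length xs \<and> lookup v (xs ! l) > 0 \<and>
        var (xs ! t) * mon (v - single (xs ! l) 1) \<in> ?I M" and dist: "distinct xs"
    using wp unfolding weakly_polymatroidal_def gens by blast
  define key where "key u = map (lookup u) xs" for u :: "'x monom"
  have "finite M" using deg by (intro finite_subset[OF _ finite_mdeg[of d]]) blast
  have inj: "inj_on key M"
    unfolding key_def inj_on_def using xs by (auto intro: poly_mapping_eqI)
  \<comment> \<open>All keys have the length of \<open>xs\<close>, so the proper-prefix case of the
    lexicographic order does not arise.\<close>
  have key_less: "key v < key u \<longleftrightarrow> (\<exists>t<length xs. (\<forall>s<t. lookup u (xs ! s) = lookup v (xs ! s)) \<and>
      lookup v (xs ! t) < lookup u (xs ! t))" for u v
  proof -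
    have "take t (key v) = take t (key u) \<longleftrightarrow> (\<forall>s<t. lookup u (xs ! s) = lookup v (xs ! s))"
      if "t < length xs" for t
      using that by (auto simp: key_def list_eq_iff_nth_eq)
    then show ?thesis
      unfolding list_less_def lexord_take_index_conv by (auto simp: key_def)
  qed
  define ms where "ms = rev (map (inv_into M key) (sorted_list_of_set (key ` M)))"
  have key_ms: "map key ms = rev (sorted_list_of_set (key ` M))"
    unfolding ms_def rev_map[symmetric] map_map
    by (intro arg_cong[of _ _ rev] map_idI) (use \<open>finite M\<close> in \<open>simp add: f_inv_into_f\<close>)
  have set_ms: "set ms = M"
    unfolding ms_def using \<open>finite M\<close> inj by (simp add: image_image inv_into_f_f)
  have dist_ms: "distinct (map key ms)"
    unfolding key_ms by simp
  have sorted: "sorted_wrt (>) (map key ms)"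
    unfolding key_ms sorted_wrt_rev by simp
  have order: "w \<in> set (take i ms)" if "w \<in> M" "i < length ms" "key (ms ! i) < key w" for w i
  proof -
    obtain k where k: "k < length ms" "ms ! k = w" using \<open>w \<in> M\<close> set_ms by (metis in_set_conv_nth)
    have "k < i"
    proof (rule ccontr)
      assume "\<not> k < i"
      then have "k = i \<or> key (ms ! i) > key (ms ! k)"
        using sorted_wrt_nth_less[OF sorted, of i k] k that(2) by force
      then show False using that(3) k by auto
    qed
    then show ?thesis using k that(2) by (metis in_set_conv_nth length_take min_less_iff_conj nth_take)
  qed
  have order': "key (ms ! i) < key u" if u: "u \<in> set (take i ms)" "i < length ms" for u i
  proof -
    obtain k where "k < i" "ms ! k = u" using u by (auto simp: in_set_conv_nth)
    then show ?thesis using sorted_wrt_nth_less[OF sorted, of k i] u(2) by simp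
  qed
  have "\<exists>A :: ('x, 'k) mpoly set. (\<forall>f\<in>A. homogeneous 1 f) \<and>
      colon (?I (set (take i ms))) (mon (ms ! i)) = ideal_gen A" if i: "i < length ms" for i
  proof -
    define m where "m = ms ! i"
    have m: "m \<in> M" using i set_ms nth_mem m_def by blast
    let ?N = "{n. \<exists>l\<in>set (take i ms). l mdvd n + m}"
    let ?X = "{single x 1 |x. single x 1 \<in> ?N}"
    \<comment> \<open>Let t be the first position where the earlier u exceeds m. The exchange yields
      w, which is m with one \<open>xs ! l\<close> replaced by \<open>xs ! t\<close>. As t < l, w is
      lexicographically larger than m, hence earlier in the list, and it divides
      \<open>xs ! t\<close> times m. So this variable lies in the colon ideal, and it divides n
      because u divides n + m with a larger exponent at t than m.\<close>
    have lin: "\<exists>x\<in>?X. x mdvd n" if n: "n \<in> ?N" for n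
    proof -
      obtain u where u: "u \<in> set (take i ms)" "u mdvd n + m" using n by blast
      then have uM: "u \<in> M" using set_ms by (meson in_set_takeD)
      obtain t where t: "t < length xs" "\<forall>s<t. lookup u (xs ! s) = lookup m (xs ! s)"
        "lookup m (xs ! t) < lookup u (xs ! t)"
        using order'[OF u(1) i] unfolding key_less m_def by blast
      obtain l where l: "t < l" "l < length xs" "lookup m (xs ! l) > 0"
        and wI: "var (xs ! t) * mon (m - single (xs ! l) 1) \<in> ?I M"
        using exchange[OF uM m t] by blast
      define w where "w = single (xs ! t) 1 + (m - single (xs ! l) 1)"
      have "mon w \<in> ?I M" using wI by (simp add: w_def var_def mon_mult)
      then obtain g where g: "g \<in> M" "g mdvd w" unfolding mon_in_ideal_gen by blast
      have sub: "(m - single (xs ! l) 1) + single (xs ! l) 1 = m"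
        using l(3) by (intro mdvd_diff_add') (simp add: single_mdvd_iff)
      then have "mdeg (m - single (xs ! l) 1) + 1 = mdeg m"
        by (metis mdeg_add mdeg_single)
      then have "mdeg w = d" using deg[OF m] by (simp add: w_def)
      with g have "w \<in> M" using mdvd_mdeg_eq[of g w] deg by auto
      moreover have "key m < key w"
        unfolding key_less
      proof (intro exI[of _ t] conjI allI impI)
        fix s assume "s < t"
        then have "xs ! s \<noteq> xs ! t" "xs ! s \<noteq> xs ! l"
          using l(1,2) dist by (simp_all add: nth_eq_iff_index_eq)
        then show "lookup w (xs ! s) = lookup m (xs ! s)"
          by (simp add: w_def lookup_add lookup_minus lookup_single)
      next
        have "xs ! t \<noteq> xs ! l" using l(1,2) dist by (simp add: nth_eq_iff_index_eq)
        then show "lookup m (xs ! t) < lookup w (xs ! t)"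
          by (simp add: w_def lookup_add lookup_minus lookup_single)
      qed (use t in simp)
      ultimately have "w \<in> set (take i ms)" using order i by (simp add: m_def)
      moreover have "w mdvd single (xs ! t) 1 + m"
        by (auto simp: w_def mdvd_def lookup_add lookup_minus)
      ultimately have "single (xs ! t) 1 \<in> ?N" by blast
      moreover have "single (xs ! t) 1 mdvd n"
        using t(3) u(2) unfolding mdvd_def[of u] One_nat_def single_mdvd_iff
        by (metis add_0 gr0I leD lookup_add)
      ultimately show ?thesis by blast
    qed
    have up: "k \<in> ?N" if x: "x \<in> ?X" "x mdvd k" for x k
    proof -
      obtain l where "l \<in> set (take i ms)" "l mdvd x + m" using x(1) by blast
      moreover have "x + m mdvd k + m" using x(2) by (simp add: mdvd_def lookup_add)
      ultimately show ?thesis using mdvd_trans by blast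
    qed
    have "colon (?I (set (take i ms))) (mon (ms ! i)) = ?I ?X"
    proof (rule set_eqI)
      fix f :: "('x, 'k) mpoly"
      have "f \<in> colon (?I (set (take i ms))) (mon (ms ! i)) \<longleftrightarrow> keys f \<subseteq> ?N"
        unfolding colon_ideal_gen_mon m_def by blast
      also have "\<dots> \<longleftrightarrow> f \<in> ?I ?X"
        unfolding ideal_gen_mon using lin up by blast
      finally show "f \<in> colon (?I (set (take i ms))) (mon (ms ! i)) \<longleftrightarrow> f \<in> ?I ?X" .
    qed
    moreover have "\<forall>f\<in>mon ` ?X. homogeneous 1 (f :: ('x, 'k) mpoly)"
      by (auto simp: homogeneous_def)
    ultimately show ?thesis by blast
  qed
  then show ?thesis
    unfolding linear_quotients_def gens using set_ms dist_ms distinct_map by blast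
qed

section \<open>Free modules\<close>

lemma lookup_vscale [simp]: "lookup (vscale c v) b = c * lookup v b"
  by (simp add: vscale_def Poly_Mapping.map.rep_eq when_def)

interpretation vmodule: module "vscale :: 'r::comm_ring_1 \<Rightarrow> _"
  by unfold_locales (rule poly_mapping_eqI, simp add: lookup_add algebra_simps)+

lemma vscale_single: "vscale c (single b r) = single b (c * r)"
  by (intro poly_mapping_eqI) (simp add: lookup_single when_def)

lemma keys_vscale: "keys (vscale c v) \<subseteq> keys v"
  by (auto simp: in_keys_iff)

lemma free_on_0 [simp]: "0 \<in> free_on B"
  and free_on_add: "v \<in> free_on B \<Longrightarrow> w \<in> free_on B \<Longrightarrow> v + w \<in> free_on B"
  and free_on_vscale: "v \<in> free_on B \<Longrightarrow> vscale c v \<in> free_on B"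
  using keys_add[of v w] keys_vscale[of c v] by (auto simp: free_on_def)

lemma free_on_diff: "v \<in> free_on B \<Longrightarrow> w \<in> free_on B \<Longrightarrow> v - w \<in> free_on B"
  by (auto simp: free_on_def in_keys_iff lookup_minus) (metis (mono_tags, lifting) diff_zero in_keys_iff subsetD)

lemma free_on_sum: "(\<And>i. i \<in> A \<Longrightarrow> f i \<in> free_on B) \<Longrightarrow> sum f A \<in> free_on B"
  by (induction A rule: infinite_finite_induct) (auto intro: free_on_add)

lemma free_on_single: "b \<in> B \<Longrightarrow> single b r \<in> free_on B"
  by (simp add: free_on_def)

lemma lin_ext_superset:
  assumes "finite B" "keys v \<subseteq> B"
  shows "lin_ext f v = (\<Sum>b\<in>B. vscale (lookup v b) (f b))"
  unfolding lin_ext_def by (intro sum.mono_neutral_left assms) (auto simp: in_keys_iff)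

lemma lin_ext_add: "lin_ext f (v + w) = lin_ext f v + lin_ext f w"
proof -
  let ?B = "keys v \<union> keys w"
  have "lin_ext f u = (\<Sum>b\<in>?B. vscale (lookup u b) (f b))" if "keys u \<subseteq> ?B" for u
    using that by (intro lin_ext_superset) auto
  then show ?thesis
    using keys_add[of v w] by (simp add: lookup_add vmodule.scale_left_distrib sum.distrib)
qed

lemma lin_ext_vscale: "lin_ext f (vscale c v) = vscale c (lin_ext f v)"
proof -
  have "lin_ext f (vscale c v) = (\<Sum>b\<in>keys v. vscale (lookup (vscale c v) b) (f b))"
    by (intro lin_ext_superset keys_vscale) auto
  also have "\<dots> = vscale c (lin_ext f v)"
    by (simp add: lin_ext_def vmodule.scale_sum_right)
  finally show ?thesis .
qed

lemma lin_ext_0 [simp]: "lin_ext f 0 = 0"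
  by (simp add: lin_ext_def)

lemma lin_ext_diff: "lin_ext f (v - w) = lin_ext f v - lin_ext f w"
  using lin_ext_add[of f "v - w" w] by simp

lemma lin_ext_sum: "lin_ext f (sum g A) = (\<Sum>a\<in>A. lin_ext f (g a))"
  by (induction A rule: infinite_finite_induct) (auto simp: lin_ext_add)

lemma lin_ext_single: "lin_ext f (single b r) = vscale r (f b)"
  by (cases "r = 0") (auto simp: lin_ext_def)

lemma lookup_lin_ext: "lookup (lin_ext f v) c = (\<Sum>b\<in>keys v. lookup v b * lookup (f b) c)"
  by (simp add: lin_ext_def lookup_sum)

lemma lin_ext_free_on: "v \<in> free_on B \<Longrightarrow> (\<And>b. b \<in> B \<Longrightarrow> f b \<in> free_on C) \<Longrightarrow> lin_ext f v \<in> free_on C"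
  unfolding lin_ext_def by (intro free_on_sum free_on_vscale) (auto simp: free_on_def)

subsection \<open>Homogeneous vectors\<close>

text \<open>\<open>k\<close> is the degree of the exterior part to which the vector is attached:
  \<open>vchain\<close> sets it to \<open>card A\<close>, and \<open>k = 0\<close> is plain
  homogeneity.\<close>

definition vhom :: "(nat \<Rightarrow> nat) \<Rightarrow> nat \<Rightarrow> nat \<Rightarrow> (nat \<Rightarrow>\<^sub>0 ('x, 'k::comm_ring_1) mpoly) \<Rightarrow> bool" where
  "vhom s k j v \<longleftrightarrow> (\<forall>b m. lookup (lookup v b) m \<noteq> 0 \<longrightarrow> mdeg m + s b + k = j)"

lemma vhom_0 [simp]: "vhom s k j 0"
  by (simp add: vhom_def)

lemma vhom_diff: "vhom s k j v \<Longrightarrow> vhom s k j w \<Longrightarrow> vhom s k j (v - w)"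
  by (auto simp: vhom_def lookup_minus) (metis diff_zero)

lemma vhom_lin_ext:
  fixes f :: "nat \<Rightarrow> (nat \<Rightarrow>\<^sub>0 ('x::finite, 'k::comm_ring_1) mpoly)"
  assumes v: "vhom s' k j v" and f: "\<And>b. b \<in> keys v \<Longrightarrow> vhom s 0 (s' b) (f b)"
  shows "vhom s k j (lin_ext f v)"
  unfolding vhom_def
proof (intro allI impI)
  fix c m assume "lookup (lookup (lin_ext f v) c) m \<noteq> 0"
  then have "(\<Sum>b\<in>keys v. lookup (lookup v b * lookup (f b) c) m) \<noteq> 0"
    by (simp only: lookup_lin_ext lookup_sum not_False_eq_True)
  then obtain b where b: "b \<in> keys v" "m \<in> keys (lookup v b * lookup (f b) c)"
    by (elim sum.not_neutral_contains_not_neutral) (simp add: in_keys_iff)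
  then obtain m1 m2 where m: "m = m1 + m2" "m1 \<in> keys (lookup v b)" "m2 \<in> keys (lookup (f b) c)"
    using keys_mult[of "lookup v b" "lookup (f b) c"] by blast
  have "mdeg m1 + s' b + k = j" using v m(2) by (simp add: vhom_def in_keys_iff)
  moreover have "mdeg m2 + s c + 0 = s' b" using f[OF b(1)] m(3) by (simp add: vhom_def in_keys_iff)
  ultimately show "mdeg m + s c + k = j" using m(1) by simp
qed

definition vcomp :: "(nat \<Rightarrow> nat) \<Rightarrow> nat \<Rightarrow> (nat \<Rightarrow>\<^sub>0 ('x, 'k::comm_ring_1) mpoly)
    \<Rightarrow> (nat \<Rightarrow>\<^sub>0 ('x, 'k) mpoly)" where
  "vcomp s j v = (\<Sum>b\<in>keys v. single b
    (\<Sum>m\<in>{m \<in> keys (lookup v b). mdeg m + s b = j}. single m (lookup (lookup v b) m)))"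

lemma lookup_vcomp:
  "lookup (lookup (vcomp s j v) b) m = (if mdeg m + s b = j then lookup (lookup v b) m else 0)"
proof -
  have "lookup (vcomp s j v) b =
    (\<Sum>m\<in>{m \<in> keys (lookup v b). mdeg m + s b = j}. single m (lookup (lookup v b) m))"
    by (auto simp: vcomp_def lookup_sum lookup_single when_def in_keys_iff)
  then show ?thesis
    by (auto simp: lookup_sum lookup_single when_def in_keys_iff)
qed

lemma vhom_vcomp: "vhom s 0 j (vcomp s j v)"
  by (auto simp: vhom_def lookup_vcomp)

lemma vec_eqI: "(\<And>b m. lookup (lookup v b) m = lookup (lookup w b) m) \<Longrightarrow> v = w"
  by (intro poly_mapping_eqI)

lemma vcomp_free_on: "v \<in> free_on B \<Longrightarrow> vcomp s j v \<in> free_on B"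
proof -
  have "lookup (vcomp s j v) b = 0" if "lookup v b = 0" for b
    using that by (intro poly_mapping_eqI) (simp add: lookup_vcomp)
  then show "v \<in> free_on B \<Longrightarrow> vcomp s j v \<in> free_on B"
    unfolding free_on_def by (auto simp: in_keys_iff) (metis in_keys_iff subsetD)
qed

lemma vcomp_vhom: "vhom s 0 i v \<Longrightarrow> vcomp s j v = (if i = j then v else 0)"
  by (intro vec_eqI) (auto simp: lookup_vcomp vhom_def)

lemma vcomp_sum: "vcomp s j (sum f A) = (\<Sum>a\<in>A. vcomp s j (f a))"
  by (intro vec_eqI) (simp add: lookup_vcomp lookup_sum)

lemma sum_vcomp: "\<exists>J. finite J \<and> v = (\<Sum>j\<in>J. vcomp s j v)"
proof (intro exI conjI)
  let ?J = "\<Union>b\<in>keys v. (\<lambda>m. mdeg m + s b) ` keys (lookup v b)"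
  show fin: "finite ?J" by simp
  show "v = (\<Sum>j\<in>?J. vcomp s j v)"
  proof (rule vec_eqI)
    fix b m
    have "lookup (lookup (\<Sum>j\<in>?J. vcomp s j v) b) m =
      (\<Sum>j\<in>?J. if mdeg m + s b = j then lookup (lookup v b) m else 0)"
      by (simp add: lookup_sum lookup_vcomp)
    also have "\<dots> = (if mdeg m + s b \<in> ?J then lookup (lookup v b) m else 0)"
      by (rule sum.delta'[OF fin])
    also have "\<dots> = lookup (lookup v b) m"
    proof (cases "lookup (lookup v b) m = 0")
      case False
      then have "m \<in> keys (lookup v b)" "b \<in> keys v" by (auto simp: in_keys_iff)
      then show ?thesis by auto
    qed simp
    finally show "lookup (lookup v b) m = lookup (lookup (\<Sum>j\<in>?J. vcomp s j v) b) m" by simp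
  qed
qed

text \<open>Preimages supplied by exactness may be inhomogeneous; this allows replacing them by
  their component in the right degree.\<close>

lemma vcomp_lin_ext:
  fixes f :: "nat \<Rightarrow> (nat \<Rightarrow>\<^sub>0 ('x::finite, 'k::comm_ring_1) mpoly)"
  assumes v: "v \<in> free_on B" and f: "\<And>b. b \<in> B \<Longrightarrow> vhom s 0 (s' b) (f b)"
  shows "vcomp s j (lin_ext f v) = lin_ext f (vcomp s' j v)"
proof -
  obtain J where J: "finite J" "v = (\<Sum>i\<in>J. vcomp s' i v)" using sum_vcomp by blast
  have hom: "vhom s 0 i (lin_ext f (vcomp s' i v))" for i
    using vcomp_free_on[OF v, of s' i] f
    by (intro vhom_lin_ext[OF vhom_vcomp]) (auto simp: free_on_def)
  have "vcomp s j (lin_ext f v) = (\<Sum>i\<in>J. vcomp s j (lin_ext f (vcomp s' i v)))"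
    by (subst J(2)) (simp add: lin_ext_sum vcomp_sum)
  also have "\<dots> = (\<Sum>i\<in>J. if i = j then lin_ext f (vcomp s' j v) else 0)"
    by (intro sum.cong refl) (auto simp: vcomp_vhom[OF hom])
  also have "\<dots> = lin_ext f (\<Sum>i\<in>J. if i = j then vcomp s' j v else 0)"
    using J(1) by simp
  also have "(\<Sum>i\<in>J. if i = j then vcomp s' j v else 0) = vcomp s' j (\<Sum>i\<in>J. vcomp s' i v)"
    unfolding vcomp_sum by (intro sum.cong refl) (auto simp: vcomp_vhom[OF vhom_vcomp])
  also have "\<dots> = vcomp s' j v" using J(2) by simp
  finally show ?thesis .
qed

subsection \<open>The Koszul complex of a free module\<close>

definition kosv :: "('x::finite set \<Rightarrow> (nat \<Rightarrow>\<^sub>0 ('x, 'k::comm_ring_1) mpoly))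
    \<Rightarrow> 'x set \<Rightarrow> (nat \<Rightarrow>\<^sub>0 ('x, 'k) mpoly)" where
  "kosv c B = (\<Sum>x\<in>-B. vscale (ksgn x B * var x) (c (insert x B)))"

definition vchain :: "(nat \<Rightarrow> nat) \<Rightarrow> nat \<Rightarrow> nat \<Rightarrow>
    ('x::finite set \<Rightarrow> (nat \<Rightarrow>\<^sub>0 ('x, 'k::comm_ring_1) mpoly)) \<Rightarrow> bool" where
  "vchain s q j c \<longleftrightarrow> (\<forall>A. card A \<noteq> q \<longrightarrow> c A = 0) \<and> (\<forall>A. vhom s (card A) j (c A))"

lemma lookup_kosv: "lookup (kosv c B) b = kos (\<lambda>A. lookup (c A) b) B"
  by (simp add: kosv_def kos_def lookup_sum mult.assoc)

lemma kosv_kosv: "kosv (kosv c) B = 0"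
proof (rule poly_mapping_eqI)
  fix b
  have "lookup (kosv (kosv c) B) b = kos (kos (\<lambda>A. lookup (c A) b)) B"
    by (simp add: lookup_kosv cong: arg_cong2[of _ _ _ _ kos])
  then show "lookup (kosv (kosv c) B) b = lookup 0 b" by (simp add: kos_kos)
qed

lemma kosv_diff: "kosv (\<lambda>A. c A - e A) B = kosv c B - kosv e B"
  by (intro poly_mapping_eqI) (simp add: lookup_kosv lookup_minus kos_diff)

lemma kosv_free_on: "(\<And>A. c A \<in> free_on C) \<Longrightarrow> kosv c B \<in> free_on C"
  unfolding kosv_def by (intro free_on_sum free_on_vscale)

lemma lin_ext_kosv: "lin_ext f (kosv c B) = kosv (\<lambda>A. lin_ext f (c A)) B"
  by (simp add: kosv_def lin_ext_sum lin_ext_vscale)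

lemma vchain_kchain: "vchain s q j c \<Longrightarrow> kchain q (j - s b) (\<lambda>A. lookup (c A) b)"
  unfolding vchain_def kchain_def vhom_def in_keys_iff by fastforce

lemma vchain_kosv:
  fixes c :: "'x::finite set \<Rightarrow> (nat \<Rightarrow>\<^sub>0 ('x, 'k::comm_ring_1) mpoly)"
  assumes c: "vchain s (Suc q) j c"
  shows "vchain s q j (kosv c)"
proof -
  have k: "kchain q (j - s b) (\<lambda>A. lookup (kosv c A) b)" for b
    unfolding lookup_kosv by (rule kchain_kos[OF vchain_kchain[OF c]])
  \<comment> \<open>The degree \<open>j - s b\<close> is truncated, so basis elements of degree
    above j need separate treatment; no homogeneous chain involves them.\<close>
  have 0: "lookup (kosv c A) b = 0" if "s b > j" for A b
  proof -
    have "lookup (c A) b = 0" for A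
      using c that unfolding vchain_def vhom_def by (intro poly_mapping_eqI) (force simp: not_less)
    then show ?thesis by (simp add: lookup_kosv)
  qed
  show ?thesis
    unfolding vchain_def vhom_def
  proof (intro conjI allI impI)
    fix A :: "'x set" assume "card A \<noteq> q"
    then show "kosv c A = 0" using k unfolding kchain_def by (intro poly_mapping_eqI) simp
  next
    fix A :: "'x set" and b m assume nz: "lookup (lookup (kosv c A) b) m \<noteq> 0"
    then have "s b \<le> j" using 0[of b A] by (metis lookup_zero not_le)
    moreover have "mdeg m + card A = j - s b"
      using k[of b] nz unfolding kchain_def by (simp add: in_keys_iff)
    ultimately show "mdeg m + s b + card A = j" by simp
  qed
qed

lemma vchain_diff: "vchain s q j c \<Longrightarrow> vchain s q j e \<Longrightarrow> vchain s q j (\<lambda>A. c A - e A)"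
  by (auto simp: vchain_def intro: vhom_diff)

lemma kosv_exact:
  fixes c :: "'x::finite set \<Rightarrow> (nat \<Rightarrow>\<^sub>0 ('x, 'k::comm_ring_1) mpoly)"
  assumes c: "vchain s q j c" "\<And>A. c A \<in> free_on C" and cyc: "\<And>B. kosv c B = 0"
    and q0: "\<And>b. q = 0 \<Longrightarrow> lookup (lookup (c {}) b) 0 = 0"
  shows "\<exists>e. vchain s (Suc q) j e \<and> (\<forall>A. e A \<in> free_on C) \<and> kosv e = c"
proof -
  have "\<exists>e. kchain (Suc q) (j - s b) e \<and> kos e = (\<lambda>A. lookup (c A) b)" for b
  proof (rule kos_exact[OF vchain_kchain[OF c(1)]])
    fix B show "kos (\<lambda>A. lookup (c A) b) B = 0"
      using cyc[of B] by (simp flip: lookup_kosv)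
  qed (rule q0)
  then obtain e where e: "\<And>b. kchain (Suc q) (j - s b) (e b)" "\<And>b. kos (e b) = (\<lambda>A. lookup (c A) b)"
    by metis
  \<comment> \<open>The fillings are found one coordinate at a time; cutting them to the finitely
    many coordinates that occur in c keeps the vectors finitely supported.\<close>
  let ?K = "\<Union>A. keys (c A)"
  define e' where "e' A = (\<Sum>b\<in>?K. single b (e b A))" for A
  have e': "lookup (e' A) b = (if b \<in> ?K then e b A else 0)" for A b
    unfolding e'_def by (simp add: lookup_sum lookup_single when_def)
  have le: "s b \<le> j" if b: "b \<in> ?K" for b
  proof -
    obtain A where "lookup (c A) b \<noteq> 0" using b by (auto simp: in_keys_iff)
    then obtain m where "lookup (lookup (c A) b) m \<noteq> 0" by (metis lookup_zero poly_mapping_eqI)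
    then show ?thesis using c(1) unfolding vchain_def vhom_def by force
  qed
  have "vchain s (Suc q) j e'"
    unfolding vchain_def vhom_def
  proof (intro conjI allI impI)
    fix A :: "'x set" assume "card A \<noteq> Suc q"
    then show "e' A = 0" using e(1) unfolding kchain_def by (intro poly_mapping_eqI) (simp add: e')
  next
    fix A :: "'x set" and b m assume nz: "lookup (lookup (e' A) b) m \<noteq> 0"
    then have b: "b \<in> ?K" by (metis e' lookup_zero)
    then have "m \<in> keys (e b A)" using nz by (simp add: e' in_keys_iff)
    then have "mdeg m + card A = j - s b" using e(1)[of b] unfolding kchain_def by blast
    then show "mdeg m + s b + card A = j" using le[OF b] by simp
  qed
  moreover have "e' A \<in> free_on C" for A
    using c(2) by (force simp: free_on_def in_keys_iff[of _ "e' A"] e' split: if_splits)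
  moreover have "kosv e' B = c B" for B
  proof (rule poly_mapping_eqI)
    fix b
    show "lookup (kosv e' B) b = lookup (c B) b"
    proof (cases "b \<in> ?K")
      case True
      then have "(\<lambda>A. lookup (e' A) b) = e b" by (simp add: e' fun_eq_iff)
      then show ?thesis by (simp add: lookup_kosv e(2))
    next
      case False
      then have "(\<lambda>A. lookup (e' A) b) = (\<lambda>_. 0)" by (simp add: e' fun_eq_iff)
      then show ?thesis using False by (simp add: lookup_kosv in_keys_iff)
    qed
  qed
  ultimately show ?thesis by blast
qed

section \<open>Existence of graded free resolutions\<close>

text \<open>Degreewise finiteness of the ambient basis is included so that it is passed on through
  the recursive construction of a resolution; closure under \<open>vcomp\<close> is
  gradedness.\<close>

definition graded_submodule ::
    "nat set \<Rightarrow> (nat \<Rightarrow> nat) \<Rightarrow> (nat \<Rightarrow>\<^sub>0 ('x, 'k::comm_ring_1) mpoly) set \<Rightarrow> bool" where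
  "graded_submodule B s Z \<longleftrightarrow> (\<forall>j. finite {b \<in> B. s b = j}) \<and> Z \<subseteq> free_on B \<and> 0 \<in> Z \<and>
    (\<forall>v\<in>Z. \<forall>w\<in>Z. v + w \<in> Z) \<and> (\<forall>c. \<forall>v\<in>Z. vscale c v \<in> Z) \<and> (\<forall>j. \<forall>v\<in>Z. vcomp s j v \<in> Z)"

lemma sum_in_lin_ext_image:
  assumes "\<And>i. i \<in> A \<Longrightarrow> f i \<in> lin_ext D ` free_on B"
  shows "sum f A \<in> lin_ext D ` free_on B"
  using assms
proof (induction A rule: infinite_finite_induct)
  case (insert i A)
  then have "f i \<in> lin_ext D ` free_on B" "sum f A \<in> lin_ext D ` free_on B" by simp_all
  then obtain v w where "f i = lin_ext D v" "sum f A = lin_ext D w" "v \<in> free_on B" "w \<in> free_on B"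
    by (elim imageE)
  then show ?case
    using insert by (intro image_eqI[of _ _ "v + w"]) (simp_all add: lin_ext_add free_on_add)
qed (auto intro!: image_eqI[of _ _ 0])

lemma vector_space_vscale_single:
  "vector_space (\<lambda>c :: 'k::field. vscale (single 0 c :: ('x, 'k) mpoly))"
  by unfold_locales
    (simp_all add: vmodule.scale_right_distrib vmodule.scale_left_distrib single_add mult_single)

text \<open>In degree j the free module is spanned over K by finitely many products of a monomial
  and a basis element, so its subspace of homogeneous elements of Z has a finite basis. Scalars act
  through constant polynomials.\<close>

lemma finite_homogeneous_basis:
  fixes Z :: "(nat \<Rightarrow>\<^sub>0 ('x::finite, 'k::field) mpoly) set"
  assumes Z: "graded_submodule B s Z"
  shows "\<exists>T. finite T \<and> T \<subseteq> {v \<in> Z. vhom s 0 j v} \<and>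
    (\<forall>v\<in>Z. vhom s 0 j v \<longrightarrow> (\<exists>a. v = (\<Sum>t\<in>T. vscale (a t) t)))"
proof -
  interpret K: vector_space "\<lambda>c :: 'k. vscale (single 0 c :: ('x, 'k) mpoly)"
    by (rule vector_space_vscale_single)
  define U where "U = (\<lambda>(b, m). single b (single m (1::'k)) :: nat \<Rightarrow>\<^sub>0 ('x, 'k) mpoly) `
    (SIGMA b:{b \<in> B. s b \<le> j}. {m. mdeg m = j - s b})"
  have "{b \<in> B. s b \<le> j} = (\<Union>i\<le>j. {b \<in> B. s b = i})" by auto
  then have "finite {b \<in> B. s b \<le> j}" using Z unfolding graded_submodule_def by auto
  then have "finite U" unfolding U_def by (intro finite_imageI finite_SigmaI finite_mdeg)
  have WU: "{v \<in> Z. vhom s 0 j v} \<subseteq> K.span U"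
  proof clarify
    fix v assume v: "v \<in> Z" "vhom s 0 j v"
    then have "keys v \<subseteq> B" using Z unfolding graded_submodule_def free_on_def by blast
    have scale: "vscale (single 0 (c::'k)) (single b (single m 1)) = single b (single m c)" for c b m
      by (simp add: vscale_single mult_single)
    have "v = (\<Sum>b\<in>keys v. single b (\<Sum>m\<in>keys (lookup v b). single m (lookup (lookup v b) m)))"
      by (simp add: sum_single_keys)
    also have "\<dots> = (\<Sum>b\<in>keys v. \<Sum>m\<in>keys (lookup v b).
        vscale (single 0 (lookup (lookup v b) m)) (single b (single m 1)))"
      unfolding scale
      by (intro sum.cong refl poly_mapping_eqI) (simp add: lookup_sum lookup_single when_def)
    also have "\<dots> \<in> K.span U"
    proof (intro K.span_sum K.span_scale K.span_base)
      fix b m assume bm: "b \<in> keys v" "m \<in> keys (lookup v b)"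
      then have "mdeg m + s b = j" using v(2) by (simp add: vhom_def in_keys_iff)
      then show "single b (single m 1) \<in> U"
        using bm \<open>keys v \<subseteq> B\<close> unfolding U_def by (intro image_eqI[of _ _ "(b, m)"]) auto
    qed
    finally show "v \<in> K.span U" .
  qed
  obtain T where T: "T \<subseteq> {v \<in> Z. vhom s 0 j v}" "K.independent T" "{v \<in> Z. vhom s 0 j v} \<subseteq> K.span T"
    "card T = K.dim {v \<in> Z. vhom s 0 j v}"
    by (rule K.basis_exists)
  have "finite T"
    using K.independent_span_bound[OF \<open>finite U\<close> T(2)] T(1) WU by blast
  moreover have "\<exists>a. v = (\<Sum>t\<in>T. vscale (a t) t)" if "v \<in> Z" "vhom s 0 j v" for v
  proof -
    have "v \<in> K.span T" using T(3) that by blast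
    then obtain u where "v = (\<Sum>t\<in>T. vscale (single 0 (u t)) t)"
      unfolding K.span_finite[OF \<open>finite T\<close>] by blast
    then show ?thesis by (intro exI[of _ "\<lambda>t. single 0 (u t)"])
  qed
  ultimately show ?thesis using T(1) by blast
qed

text \<open>A K-basis of every graded piece of Z generates Z. The generators may be infinite in
  number, but there are finitely many in each degree.\<close>

lemma homogeneous_generators:
  fixes Z :: "(nat \<Rightarrow>\<^sub>0 ('x::finite, 'k::field) mpoly) set"
  assumes Z: "graded_submodule B s Z"
  shows "\<exists>B' s' D. (\<forall>j. finite {b \<in> B'. s' b = j}) \<and> (\<forall>b\<in>B'. D b \<in> Z \<and> vhom s 0 (s' b) (D b)) \<and>
    lin_ext D ` free_on B' = Z"
proof -
  have "\<exists>T. \<forall>j. finite (T j) \<and> T j \<subseteq> {v \<in> Z. vhom s 0 j v} \<and>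
    (\<forall>v\<in>Z. vhom s 0 j v \<longrightarrow> (\<exists>a. v = (\<Sum>t\<in>T j. vscale (a t) t)))"
    by (intro choice allI finite_homogeneous_basis[OF Z])
  then obtain T where "\<forall>j. finite (T j) \<and> T j \<subseteq> {v \<in> Z. vhom s 0 j v} \<and>
    (\<forall>v\<in>Z. vhom s 0 j v \<longrightarrow> (\<exists>a. v = (\<Sum>t\<in>T j. vscale (a t) t)))" ..
  then have T: "finite (T j)" "T j \<subseteq> {v \<in> Z. vhom s 0 j v}"
    "v \<in> Z \<Longrightarrow> vhom s 0 j v \<Longrightarrow> \<exists>a. v = (\<Sum>t\<in>T j. vscale (a t) t)" for j v
    by simp_all
  have "\<exists>n f. T j = f ` {i::nat. i < n}" for j
    using finite_imp_nat_seg_image_inj_on[OF T(1)] by blast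
  then obtain N g where g: "\<And>j. T j = g j ` {i::nat. i < N j}" by metis
  \<comment> \<open>Basis indices must be natural numbers, so a generator is coded by its degree and
    its position within that degree.\<close>
  define B' where "B' = prod_encode ` (SIGMA j:UNIV. {i. i < N j})"
  define s' where "s' n = fst (prod_decode n)" for n
  define D where "D n = (case prod_decode n of (j, i) \<Rightarrow> g j i)" for n
  have "finite {b \<in> B'. s' b = j}" for j
  proof (rule finite_subset)
    show "{b \<in> B'. s' b = j} \<subseteq> prod_encode ` ({j} \<times> {i. i < N j})"
      by (auto simp: B'_def s'_def)
  qed simp
  moreover have D: "D b \<in> Z \<and> vhom s 0 (s' b) (D b)" if "b \<in> B'" for b
  proof -
    obtain j i where b: "b = prod_encode (j, i)" "i < N j" using \<open>b \<in> B'\<close> by (auto simp: B'_def)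
    then have "g j i \<in> T j" using g by auto
    then show ?thesis using T(2) by (auto simp: b(1) D_def s'_def)
  qed
  moreover have "lin_ext D ` free_on B' = Z"
  proof
    show "lin_ext D ` free_on B' \<subseteq> Z"
    proof clarify
      fix v :: "nat \<Rightarrow>\<^sub>0 ('x, 'k) mpoly" assume v: "v \<in> free_on B'"
      have sumZ: "sum f A \<in> Z" if "\<And>b. b \<in> A \<Longrightarrow> f b \<in> Z" for f :: "nat \<Rightarrow> _" and A
        using that Z by (induction A rule: infinite_finite_induct) (auto simp: graded_submodule_def)
      have "vscale (lookup v b) (D b) \<in> Z" if "b \<in> keys v" for b
      proof -
        have "b \<in> B'" using v that by (auto simp: free_on_def)
        then show ?thesis using D Z by (simp add: graded_submodule_def)
      qed
      then show "lin_ext D v \<in> Z" unfolding lin_ext_def by (rule sumZ)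
    qed
    show "Z \<subseteq> lin_ext D ` free_on B'"
    proof
      fix v assume v: "v \<in> Z"
      obtain J where J: "finite J" "v = (\<Sum>j\<in>J. vcomp s j v)" using sum_vcomp by blast
      have "vcomp s j v \<in> lin_ext D ` free_on B'" for j
      proof -
        have "vcomp s j v \<in> Z" using v Z by (simp add: graded_submodule_def)
        then obtain a where "vcomp s j v = (\<Sum>t\<in>T j. vscale (a t) t)"
          using T(3) vhom_vcomp by blast
        moreover have "vscale (a t) t \<in> lin_ext D ` free_on B'" if t: "t \<in> T j" for t
        proof -
          obtain i where i: "i < N j" "t = g j i" using t g by auto
          have "vscale (a t) t = lin_ext D (single (prod_encode (j, i)) (a t))"
            by (simp add: lin_ext_single D_def i(2))
          moreover have "single (prod_encode (j, i)) (a t) \<in> free_on B'"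
            using i by (intro free_on_single) (auto simp: B'_def)
          ultimately show ?thesis by blast
        qed
        ultimately show ?thesis by (simp only: sum_in_lin_ext_image)
      qed
      then have "(\<Sum>j\<in>J. vcomp s j v) \<in> lin_ext D ` free_on B'"
        by (intro sum_in_lin_ext_image)
      then show "v \<in> lin_ext D ` free_on B'" by (simp only: flip: J(2))
    qed
  qed
  ultimately show ?thesis by blast
qed

lemma graded_submodule_ker:
  fixes D :: "nat \<Rightarrow> (nat \<Rightarrow>\<^sub>0 ('x::finite, 'k::comm_ring_1) mpoly)"
  assumes "\<And>j. finite {b \<in> B. s' b = j}" and D: "\<And>b. b \<in> B \<Longrightarrow> vhom s 0 (s' b) (D b)"
  shows "graded_submodule B s' {v \<in> free_on B. lin_ext D v = 0}"
  unfolding graded_submodule_def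
proof (intro conjI ballI allI)
  fix j v assume v: "v \<in> {v \<in> free_on B. lin_ext D v = 0}"
  then have "lin_ext D (vcomp s' j v) = vcomp s j 0"
    by (subst vcomp_lin_ext[where s = s and B = B and f = D, symmetric]) (auto simp: D)
  also have "vcomp s j 0 = 0" by (intro vec_eqI) (simp add: lookup_vcomp)
  finally show "vcomp s' j v \<in> {v \<in> free_on B. lin_ext D v = 0}"
    using v vcomp_free_on by blast
qed (use assms in \<open>auto intro: free_on_add free_on_vscale simp: lin_ext_add lin_ext_vscale\<close>)

lemma graded_submodule_monomial_ideal:
  "graded_submodule {0} (\<lambda>_. 0) {v \<in> free_on {0}. lookup v 0 \<in>
    (ideal_gen (mon ` M) :: ('x, 'k::comm_ring_1) mpoly set)}"
  unfolding graded_submodule_def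
proof (intro conjI ballI allI)
  fix j v assume v: "v \<in> {v \<in> free_on {0}. lookup v 0 \<in> (ideal_gen (mon ` M) :: ('x, 'k) mpoly set)}"
  then have "lookup (vcomp (\<lambda>_. 0) j v) 0 \<in> ideal_gen (mon ` M)"
    unfolding ideal_gen_mon by (auto simp: in_keys_iff lookup_vcomp split: if_splits)
  then show "vcomp (\<lambda>_. 0) j v \<in> {v \<in> free_on {0}. lookup v 0 \<in> ideal_gen (mon ` M)}"
    using v vcomp_free_on by blast
qed (auto simp: lookup_add intro: free_on_add free_on_vscale ideal_gen_0 ideal_gen_add ideal_gen_mult)

lemma lookup_lin_ext_aug: "lookup (lin_ext D v) 0 = aug_ext (\<lambda>b. lookup (D b) 0) v"
  by (simp add: aug_ext_def lookup_lin_ext)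

text \<open>Dependent choice on states \<open>(B, s, Z, D)\<close>: Z is the graded submodule of the
  free module on B to be covered next, and D is the map from that module which covered the previous
  one. The initial state is S itself with Z the ideal, and its D is a dummy.\<close>

lemma graded_free_resolution_exists:
  "\<exists>F. graded_free_resolution (ideal_gen (mon ` M) :: ('x::finite, 'k::field) mpoly set) F"
proof -
  let ?I = "ideal_gen (mon ` M) :: ('x, 'k) mpoly set"
  define Z0 where "Z0 = {v \<in> free_on {0::nat}. lookup v 0 \<in> ?I}"
  define P where "P n = (\<lambda>(B, s, Z, D :: nat \<Rightarrow> (nat \<Rightarrow>\<^sub>0 ('x, 'k) mpoly)). graded_submodule B s Z \<and>
      (n = 0 \<longrightarrow> B = {0::nat} \<and> s = (\<lambda>_. 0) \<and> Z = Z0))"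
    for n :: nat
  define Q where "Q n = (\<lambda>(B :: nat set, s, Z :: (nat \<Rightarrow>\<^sub>0 ('x, 'k) mpoly) set, D0 :: nat \<Rightarrow> (nat \<Rightarrow>\<^sub>0 ('x, 'k) mpoly)) (B', s', Z', D :: nat \<Rightarrow> (nat \<Rightarrow>\<^sub>0 ('x, 'k) mpoly)).
      (\<forall>b\<in>B'. D b \<in> Z \<and> vhom s 0 (s' b) (D b)) \<and>
      lin_ext D ` free_on B' = Z \<and> Z' = {v \<in> free_on B'. lin_ext D v = 0})"
    for n :: nat
  have "\<exists>f. \<forall>n. P n (f n) \<and> Q n (f n) (f (Suc n))"
  proof (rule dependent_nat_choice)
    show "\<exists>x. P 0 x"
      unfolding P_def using graded_submodule_monomial_ideal[of M, where 'k = 'k]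
      by (intro exI[of _ "({0}, \<lambda>_. 0, Z0, \<lambda>_. 0)"]) (simp add: Z0_def)
    fix x n assume Px: "P n x"
    obtain B s Z D0 where x: "x = (B, s, Z, D0)" by (metis prod_cases4)
    have Z: "graded_submodule B s Z" using Px unfolding P_def x by simp
    obtain B' s' D where D: "\<And>j. finite {b \<in> B'. s' b = j}" "\<And>b. b \<in> B' \<Longrightarrow> D b \<in> Z \<and> vhom s 0 (s' b) (D b)"
      "lin_ext D ` free_on B' = Z"
      using homogeneous_generators[OF Z] by blast
    have "graded_submodule B' s' {v \<in> free_on B'. lin_ext D v = 0}"
      using D by (intro graded_submodule_ker[where s = s]) auto
    then show "\<exists>y. P (Suc n) y \<and> Q n x y"
      using D by (intro exI[of _ "(B', s', {v \<in> free_on B'. lin_ext D v = 0}, D)"])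
        (simp add: P_def Q_def x)
  qed
  then obtain f where f: "\<And>n. P n (f n)" "\<And>n. Q n (f n) (f (Suc n))" by blast
  define B where "B n = fst (f n)" for n
  define s where "s n = fst (snd (f n))" for n
  define Z where "Z n = fst (snd (snd (f n)))" for n
  define D where "D n = snd (snd (snd (f n)))" for n
  have fn: "f n = (B n, s n, Z n, D n)" for n by (simp add: B_def s_def Z_def D_def)
  have P: "graded_submodule (B n) (s n) (Z n)" for n
    using f(1)[of n] unfolding fn P_def by simp
  have P0: "B 0 = {0}" "s 0 = (\<lambda>_. 0)" "Z 0 = Z0"
    using f(1)[of 0] unfolding fn P_def by simp_all
  have Q: "b \<in> B (Suc n) \<Longrightarrow> D (Suc n) b \<in> Z n \<and> vhom (s n) 0 (s (Suc n) b) (D (Suc n) b)"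
    "lin_ext (D (Suc n)) ` free_on (B (Suc n)) = Z n"
    "Z (Suc n) = {v \<in> free_on (B (Suc n)). lin_ext (D (Suc n)) v = 0}" for n b
    using f(2)[of n] unfolding fn Q_def by auto
  have ZB: "Z n \<subseteq> free_on (B n)" "finite {b \<in> B n. s n b = j}" for n j
    using P[of n] unfolding graded_submodule_def by auto
  \<comment> \<open>State 0 is the target of the augmentation, so the resolution starts at state 1,
    and \<open>D (Suc 0)\<close> becomes the augmentation.\<close>
  let ?F = "\<lparr>res_basis = \<lambda>i. B (Suc i), res_shift = \<lambda>i. s (Suc i),
    res_bd = \<lambda>i. D (Suc (Suc i)), res_aug = \<lambda>b. lookup (D (Suc 0) b) 0\<rparr>"
  have img0: "aug_ext (\<lambda>b. lookup (D (Suc 0) b) 0) ` free_on (B (Suc 0)) = ?I"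
  proof -
    have "aug_ext (\<lambda>b. lookup (D (Suc 0) b) 0) ` free_on (B (Suc 0)) = (\<lambda>v. lookup v 0) ` Z 0"
      unfolding Q(2)[symmetric] image_image lookup_lin_ext_aug ..
    also have "\<dots> = ?I"
    proof
      show "?I \<subseteq> (\<lambda>v. lookup v 0) ` Z 0"
      proof
        fix g assume "g \<in> ?I"
        then have "single 0 g \<in> Z 0" by (simp add: P0 Z0_def free_on_single)
        then show "g \<in> (\<lambda>v. lookup v 0) ` Z 0" by force
      qed
    qed (auto simp: P0 Z0_def)
    finally show ?thesis .
  qed
  have ker0: "aug_ext (\<lambda>b. lookup (D (Suc 0) b) 0) v = 0 \<longleftrightarrow> lin_ext (D (Suc 0)) v = 0"
    if v: "v \<in> free_on (B (Suc 0))" for v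
  proof -
    have "lin_ext (D (Suc 0)) v \<in> Z0" using Q(2)[of 0] P0 v by blast
    then have sub: "keys (lin_ext (D (Suc 0)) v) \<subseteq> {0}" by (simp add: Z0_def free_on_def)
    have "lin_ext (D (Suc 0)) v = 0" if 0: "lookup (lin_ext (D (Suc 0)) v) 0 = 0"
    proof (rule poly_mapping_eqI)
      fix c show "lookup (lin_ext (D (Suc 0)) v) c = lookup 0 c"
        using sub 0 by (cases "c = 0") (auto simp: in_keys_iff)
    qed
    then show ?thesis by (auto simp flip: lookup_lin_ext_aug)
  qed
  have "graded_free_resolution ?I ?F"
    unfolding graded_free_resolution_def
  proof (intro conjI allI ballI)
    fix b assume "b \<in> res_basis ?F 0"
    then show "homogeneous (res_shift ?F 0 b) (res_aug ?F b)"
      using Q(1)[of b 0] P0 by (simp add: homogeneous_def vhom_def in_keys_iff)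
  next
    fix i b assume b: "b \<in> res_basis ?F (Suc i)"
    then show "res_bd ?F i b \<in> free_on (res_basis ?F i)"
      using Q(1)[of b "Suc i"] ZB by auto
    fix c m assume "c \<in> keys (res_bd ?F i b)" "m \<in> keys (lookup (res_bd ?F i b) c)"
    then show "mdeg m + res_shift ?F i c = res_shift ?F (Suc i) b"
      using b Q(1)[of b "Suc i"] by (simp add: vhom_def in_keys_iff)
  next
    show "aug_ext (res_aug ?F) ` free_on (res_basis ?F 0) = ?I" using img0 by simp
    show "{v \<in> free_on (res_basis ?F 0). aug_ext (res_aug ?F) v = 0} =
      lin_ext (res_bd ?F 0) ` free_on (res_basis ?F 1)"
      using ker0 Q(2)[of "Suc 0"] Q(3)[of 0] by (simp cong: conj_cong)
    fix i
    show "{v \<in> free_on (res_basis ?F (Suc i)). lin_ext (res_bd ?F i) v = 0} =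
      lin_ext (res_bd ?F (Suc i)) ` free_on (res_basis ?F (Suc (Suc i)))"
      using Q(2)[of "Suc (Suc i)"] Q(3)[of "Suc i"] by simp
  qed (use ZB(2) in simp)
  then show ?thesis by blast
qed

section \<open>Koszul homology and graded Betti numbers\<close>

lemma single_eq_0_iff: "single k v = 0 \<longleftrightarrow> v = 0"
  by (metis lookup_single_eq lookup_zero single_zero)

lemma free_on_lookup: "v \<in> free_on B \<Longrightarrow> b \<notin> B \<Longrightarrow> lookup v b = 0"
  by (auto simp: free_on_def in_keys_iff)

section \<open>Reduction of free modules modulo the variables\<close>

definition const_part :: "(nat \<Rightarrow>\<^sub>0 ('x, 'k::comm_ring_1) mpoly) \<Rightarrow> (nat \<Rightarrow>\<^sub>0 'k)" where
  "const_part v = Poly_Mapping.map (\<lambda>f. lookup f 0) v"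

definition const_vec :: "(nat \<Rightarrow>\<^sub>0 'k::comm_ring_1) \<Rightarrow> (nat \<Rightarrow>\<^sub>0 ('x, 'k) mpoly)" where
  "const_vec z = Poly_Mapping.map (single 0) z"

lemma lookup_const_part [simp]: "lookup (const_part v) b = lookup (lookup v b) 0"
  by (simp add: const_part_def Poly_Mapping.map.rep_eq when_def)

lemma lookup_const_vec [simp]: "lookup (const_vec z) b = single 0 (lookup z b)"
  by (simp add: const_vec_def Poly_Mapping.map.rep_eq when_def)

lemma const_part_const_vec [simp]: "const_part (const_vec z) = z"
  by (intro poly_mapping_eqI) simp

lemma const_part_0 [simp]: "const_part 0 = 0"
  by (intro poly_mapping_eqI) simp

lemma const_part_diff: "const_part (v - w) = const_part v - const_part w"
  by (intro poly_mapping_eqI) (simp add: lookup_minus)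

lemma const_part_free_on: "v \<in> free_on B \<Longrightarrow> const_part v \<in> free_on B"
  unfolding free_on_def by (auto simp: in_keys_iff) (metis in_keys_iff lookup_zero subsetD)

lemma const_vec_free_on: "z \<in> free_on B \<Longrightarrow> const_vec z \<in> free_on B"
  unfolding free_on_def by (auto simp: in_keys_iff) (metis in_keys_iff single_zero subsetD)

lemma vhom_const_vec: "z \<in> free_on {b \<in> B. s b = j} \<Longrightarrow> vhom s 0 j (const_vec z)"
  by (auto simp: vhom_def free_on_def in_keys_iff lookup_single when_def split: if_splits)

lemma const_part_vcomp: "lookup (const_part (vcomp s j v)) b = (if s b = j then lookup (const_part v) b else 0)"
  by (simp add: lookup_vcomp)

lemma const_part_vhom: "vhom s 0 j v \<Longrightarrow> v \<in> free_on B \<Longrightarrow> const_part v \<in> free_on {b \<in> B. s b = j}"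
  unfolding free_on_def vhom_def
proof safe
  fix b assume "keys v \<subseteq> B" and b: "b \<in> keys (const_part v)"
  then show "b \<in> B" using const_part_free_on[of v B] by (auto simp: free_on_def)
  assume "\<forall>b m. lookup (lookup v b) m \<noteq> 0 \<longrightarrow> mdeg m + s b + 0 = j"
  then have "lookup (lookup v b) 0 \<noteq> 0 \<longrightarrow> mdeg (0 :: 'a monom) + s b + 0 = j" by blast
  then show "s b = j" using b by (simp add: in_keys_iff)
qed

lemma const_part_lin_ext: "const_part (lin_ext f v) = lin_ext (\<lambda>b. const_part (f b)) (const_part v)"
proof -
  have "keys (const_part v) \<subseteq> keys v" by (auto simp: in_keys_iff)
  then have "lin_ext (\<lambda>b. const_part (f b)) (const_part v) =
      (\<Sum>b\<in>keys v. vscale (lookup (const_part v) b) (const_part (f b)))"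
    by (intro lin_ext_superset) auto
  then show ?thesis
    by (intro poly_mapping_eqI) (simp add: lookup_sum lookup_lin_ext lookup_mult_0)
qed

lemma const_part_kosv [simp]: "const_part (kosv c B) = 0"
  by (intro poly_mapping_eqI) (simp add: lookup_kosv lookup_kos)

lemma tensor_bd_const_part: "tensor_bd F i (const_part v) = const_part (lin_ext (res_bd F i) v)"
  unfolding tensor_bd_def const_part_def[symmetric] const_part_lin_ext ..

text \<open>Exactness of the Koszul complex at q = 0: a vector without constant terms is a
  combination of variables, with homogeneous coefficients \<open>w\<close>.\<close>

lemma const_part_eq_0_imp_kosv:
  fixes v :: "nat \<Rightarrow>\<^sub>0 ('x::finite, 'k::comm_ring_1) mpoly"
  assumes v: "vhom s 0 j v" "v \<in> free_on C" "const_part v = 0"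
  shows "\<exists>w. vchain s (Suc 0) j w \<and> (\<forall>A. w A \<in> free_on C) \<and> kosv w = (\<lambda>A. if A = {} then v else 0)"
proof (rule kosv_exact)
  let ?c = "\<lambda>A :: 'x set. if A = {} then v else 0"
  show "vchain s 0 j ?c" using v(1) by (simp add: vchain_def)
  show "kosv ?c B = 0" for B by (simp add: kosv_def)
  show "?c A \<in> free_on C" for A using v(2) by simp
  show "lookup (lookup (?c {}) b) 0 = 0" for b
    using v(3) lookup_const_part[of v b] by simp
qed

text \<open>Vanishing of Koszul homology \<open>H_q(x; I)\<close> in degree j, for a homogeneous
  ideal. The filling \<open>f\<close> may have components of other degrees, so none have to be
  stripped off when one is constructed.\<close>

definition kos_acyclic :: "('x::finite, 'k::comm_ring_1) mpoly set \<Rightarrow> nat \<Rightarrow> nat \<Rightarrow> bool" where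
  "kos_acyclic I q j \<longleftrightarrow> (\<forall>c. kchain q j c \<and> (\<forall>A. c A \<in> I) \<and> (\<forall>B. kos c B = 0) \<longrightarrow>
    (\<exists>f. (\<forall>A. f A \<in> I) \<and> kos f = c))"

text \<open>
  The resolution is augmented by the polynomial ring itself, as the free module with basis \<open>{0}\<close>
  at index \<open>0\<close>, so all indices are shifted by one.
\<close>

locale resolution =
  fixes I :: "('x::finite, 'k::field) mpoly set" and F :: "('x, 'k) gr_res"
  assumes res: "graded_free_resolution I F"
begin

definition "G i = (case i of 0 \<Rightarrow> {0} | Suc i \<Rightarrow> res_basis F i)"
definition "s i = (case i of 0 \<Rightarrow> \<lambda>_. 0 | Suc i \<Rightarrow> res_shift F i)"
definition "D i = lin_ext (case i of 0 \<Rightarrow> (\<lambda>b. single 0 (res_aug F b)) | Suc i \<Rightarrow> res_bd F i)"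
text \<open>The syzygy modules: \<open>Z 0\<close> is a copy of the ideal, and by exactness
  \<open>Z (Suc i)\<close> is the kernel of \<open>D i\<close>.\<close>

definition "Z i = D i ` free_on (G (Suc i))"

lemma G_0: "G 0 = {0}" and G_Suc: "G (Suc i) = res_basis F i"
  and s_0: "s 0 = (\<lambda>_. 0)" and s_Suc: "s (Suc i) = res_shift F i"
  and D_0: "D 0 = lin_ext (\<lambda>b. single 0 (res_aug F b))" and D_Suc: "D (Suc i) = lin_ext (res_bd F i)"
  by (simp_all add: G_def s_def D_def)

lemma D_0_eq: "D 0 v = single 0 (aug_ext (res_aug F) v)"
  by (intro poly_mapping_eqI) (simp add: D_0 lookup_lin_ext lookup_single aug_ext_def when_def)

lemma res_aug_homogeneous: "b \<in> res_basis F 0 \<Longrightarrow> homogeneous (res_shift F 0 b) (res_aug F b)"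
  and res_bd_free_on: "b \<in> res_basis F (Suc i) \<Longrightarrow> res_bd F i b \<in> free_on (res_basis F i)"
  and res_bd_homogeneous: "b \<in> res_basis F (Suc i) \<Longrightarrow> c \<in> keys (res_bd F i b) \<Longrightarrow>
    m \<in> keys (lookup (res_bd F i b) c) \<Longrightarrow> mdeg m + res_shift F i c = res_shift F (Suc i) b"
  and aug_image: "aug_ext (res_aug F) ` free_on (res_basis F 0) = I"
  and aug_ker: "{v \<in> free_on (res_basis F 0). aug_ext (res_aug F) v = 0} =
    lin_ext (res_bd F 0) ` free_on (res_basis F 1)"
  and bd_ker: "{v \<in> free_on (res_basis F (Suc i)). lin_ext (res_bd F i) v = 0} =
    lin_ext (res_bd F (Suc i)) ` free_on (res_basis F (Suc (Suc i)))"
  using res unfolding graded_free_resolution_def by simp_all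

lemma bd_vhom:
  "b \<in> G (Suc 0) \<Longrightarrow> vhom (s 0) 0 (s (Suc 0) b) (single 0 (res_aug F b))"
  "b \<in> G (Suc (Suc i)) \<Longrightarrow> vhom (s (Suc i)) 0 (s (Suc (Suc i)) b) (res_bd F i b)"
  "b \<in> G (Suc (Suc i)) \<Longrightarrow> res_bd F i b \<in> free_on (G (Suc i))"
proof -
  show "b \<in> G (Suc 0) \<Longrightarrow> vhom (s 0) 0 (s (Suc 0) b) (single 0 (res_aug F b))"
    using res_aug_homogeneous[of b] unfolding G_Suc s_0 s_Suc
    by (auto simp: vhom_def homogeneous_def in_keys_iff lookup_single when_def split: if_splits)
  show "b \<in> G (Suc (Suc i)) \<Longrightarrow> vhom (s (Suc i)) 0 (s (Suc (Suc i)) b) (res_bd F i b)"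
    unfolding G_Suc s_Suc vhom_def
  proof (intro allI impI)
    fix c m assume b: "b \<in> res_basis F (Suc i)" and nz: "lookup (lookup (res_bd F i b) c) m \<noteq> 0"
    then have "lookup (res_bd F i b) c \<noteq> 0" by auto
    then show "mdeg m + res_shift F i c + 0 = res_shift F (Suc i) b"
      using res_bd_homogeneous[OF b, of c m] nz by (simp add: in_keys_iff)
  qed
  show "b \<in> G (Suc (Suc i)) \<Longrightarrow> res_bd F i b \<in> free_on (G (Suc i))"
    using res_bd_free_on unfolding G_Suc .
qed

lemma D_diff: "D i (v - w) = D i v - D i w"
  and D_kosv: "D i (kosv c B) = kosv (\<lambda>A. D i (c A)) B"
  by (simp_all add: D_def lin_ext_diff lin_ext_kosv)

lemma D_free_on: "v \<in> free_on (G (Suc i)) \<Longrightarrow> D i v \<in> free_on (G i)"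
  by (cases i) (auto simp: D_0 D_Suc G_0 bd_vhom(3) intro: lin_ext_free_on free_on_single)

lemma D_vhom: "v \<in> free_on (G (Suc i)) \<Longrightarrow> vhom (s (Suc i)) k j v \<Longrightarrow> vhom (s i) k j (D i v)"
  by (cases i) (auto simp: D_0 D_Suc free_on_def intro!: vhom_lin_ext bd_vhom(1,2))

lemma D_vcomp: "v \<in> free_on (G (Suc i)) \<Longrightarrow> vcomp (s i) j (D i v) = D i (vcomp (s (Suc i)) j v)"
  by (cases i) (auto simp: D_0 D_Suc intro!: vcomp_lin_ext bd_vhom(1,2))

lemma D_vchain:
  "(\<And>A. c A \<in> free_on (G (Suc i))) \<Longrightarrow> vchain (s (Suc i)) q j c \<Longrightarrow> vchain (s i) q j (\<lambda>A. D i (c A))"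
  unfolding vchain_def using D_vhom by (auto simp: D_def)

lemma ker_D: "{v \<in> free_on (G (Suc i)). D i v = 0} = Z (Suc i)"
proof (cases i)
  case 0
  then show ?thesis using aug_ker by (simp add: Z_def D_0_eq D_Suc G_Suc single_eq_0_iff)
next
  case (Suc i)
  then show ?thesis using bd_ker by (simp add: Z_def D_Suc G_Suc)
qed

lemma zero_in_Z: "0 \<in> Z i"
  unfolding Z_def by (intro image_eqI[of _ _ 0]) (simp_all add: D_def)

lemma Z_free_on: "Z i \<subseteq> free_on (G i)"
  using D_free_on by (auto simp: Z_def)

lemma D_Z: "v \<in> Z (Suc i) \<Longrightarrow> D i v = 0"
  using ker_D by blast

lemma Z_0: "v \<in> Z 0 \<longleftrightarrow> v \<in> free_on {0} \<and> lookup v 0 \<in> I"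
proof -
  have I: "aug_ext (res_aug F) ` free_on (G (Suc 0)) = I"
    using aug_image by (simp add: G_Suc)
  have "v = single 0 (lookup v 0)" if "v \<in> free_on {0}"
    using free_on_lookup[OF that] by (intro poly_mapping_eqI) (simp add: lookup_single when_def)
  then show ?thesis
    unfolding Z_def D_0_eq I[symmetric] by (auto intro: free_on_single)
qed

lemma single_in_Z_0: "single 0 f \<in> Z 0 \<longleftrightarrow> f \<in> I"
  by (simp add: Z_0 free_on_single)

text \<open>
  A step of the zigzag through the resolution, \<open>bd_lift_Suc\<close>, trades one homological degree of
  the Koszul complex for one of the resolution.
\<close>

definition bd_lift :: "nat \<Rightarrow> nat \<Rightarrow> nat \<Rightarrow> bool" where
  "bd_lift i q j \<longleftrightarrow> (\<forall>e. vchain (s i) (Suc q) j e \<and> (\<forall>A. e A \<in> free_on (G i)) \<and> (\<forall>A. kosv e A \<in> Z i)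
    \<longrightarrow> (\<exists>f. (\<forall>A. f A \<in> Z i) \<and> kosv f = kosv e))"

text \<open>\<open>bd_lift i q j\<close> says that a cycle over \<open>Z i\<close> which bounds over
  the ambient free module already bounds over \<open>Z i\<close>. Applying \<open>D i\<close> to
  \<open>e\<close> gives a cycle, which bounds a chain \<open>e'\<close> one Koszul degree higher.
  The hypothesis replaces \<open>e'\<close> by a chain over \<open>Z i\<close>, which pulls back to
  \<open>g\<close>, and subtracting \<open>kosv g\<close> from \<open>e\<close> does not change
  \<open>kosv e\<close>.\<close>

lemma bd_lift_Suc:
  assumes "bd_lift i (Suc q) j"
  shows "bd_lift (Suc i) q j"
  unfolding bd_lift_def
proof (intro allI impI, elim conjE)
  fix e :: "'x set \<Rightarrow> _"
  assume e: "vchain (s (Suc i)) (Suc q) j e" "\<forall>A. e A \<in> free_on (G (Suc i))" "\<forall>A. kosv e A \<in> Z (Suc i)"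
  let ?c = "\<lambda>A. D i (e A)"
  have cyc: "kosv ?c B = 0" for B
    unfolding D_kosv[symmetric] using e(3) by (intro D_Z) blast
  obtain e' where e': "vchain (s i) (Suc (Suc q)) j e'" "\<forall>A. e' A \<in> free_on (G i)" "kosv e' = ?c"
    using kosv_exact[OF D_vchain[OF _ e(1)], of "G i"] cyc e(2) D_free_on by auto
  have "kosv e' A \<in> Z i" for A using e(2) by (auto simp: e'(3) Z_def)
  then obtain f where f: "\<forall>A. f A \<in> Z i" "kosv f = ?c"
    using assms e' unfolding bd_lift_def by metis
  have "\<exists>g. \<forall>A. g A \<in> free_on (G (Suc i)) \<and> f A = D i (g A)"
    using f(1) unfolding Z_def by (intro choice) blast
  then obtain g where g: "\<And>A. g A \<in> free_on (G (Suc i))" "\<And>A. f A = D i (g A)" by blast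
  have "e A - kosv g A \<in> Z (Suc i)" for A
  proof -
    have "D i (kosv g A) = kosv f A" unfolding D_kosv g(2)[symmetric] ..
    then have "D i (e A - kosv g A) = 0" by (simp add: D_diff f(2))
    moreover have "e A - kosv g A \<in> free_on (G (Suc i))"
      using e(2) g(1) by (intro free_on_diff kosv_free_on) auto
    ultimately show ?thesis unfolding ker_D[symmetric] by simp
  qed
  moreover have "kosv (\<lambda>A. e A - kosv g A) = kosv e"
    by (rule ext) (simp add: kosv_diff kosv_kosv)
  ultimately show "\<exists>f. (\<forall>A. f A \<in> Z (Suc i)) \<and> kosv f = kosv e"
    by (intro exI[of _ "\<lambda>A. e A - kosv g A"]) simp
qed

lemma bd_lift_0:
  assumes "kos_acyclic I q j"
  shows "bd_lift 0 q j"
  unfolding bd_lift_def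
proof (intro allI impI, elim conjE)
  fix e :: "'x set \<Rightarrow> _"
  assume e: "vchain (s 0) (Suc q) j e" "\<forall>A. e A \<in> free_on (G 0)" "\<forall>A. kosv e A \<in> Z 0"
  define c where "c A = lookup (kosv e A) 0" for A
  have c: "c = kos (\<lambda>A. lookup (e A) 0)" by (simp add: c_def fun_eq_iff lookup_kosv)
  have "kchain q j c"
    using kchain_kos[OF vchain_kchain[OF e(1), of 0]] by (simp add: c s_0)
  moreover have "c A \<in> I" for A using e(3) Z_0 by (simp add: c_def)
  moreover have "kos c B = 0" for B unfolding c by (rule kos_kos)
  ultimately obtain f where f: "\<And>A. f A \<in> I" "kos f = c"
    using assms unfolding kos_acyclic_def by metis
  have "kosv (\<lambda>A. single 0 (f A)) B = kosv e B" for B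
  proof (rule poly_mapping_eqI)
    fix b
    show "lookup (kosv (\<lambda>A. single 0 (f A)) B) b = lookup (kosv e B) b"
    proof (cases "b = 0")
      case True
      then show ?thesis using f(2) by (simp add: lookup_kosv[of "\<lambda>A. single 0 (f A)"] c_def fun_eq_iff)
    next
      case False
      then have "lookup (kosv e B) b = 0"
        using e(3) free_on_lookup[of "kosv e B" "{0}" b] unfolding Z_0 by simp
      then show ?thesis using False by (simp add: lookup_kosv[of "\<lambda>A. single 0 (f A)"] lookup_single)
    qed
  qed
  then show "\<exists>f. (\<forall>A. f A \<in> Z 0) \<and> kosv f = kosv e"
    using f(1) single_in_Z_0 by (intro exI[of _ "\<lambda>A. single 0 (f A)"]) auto
qed

lemma bd_lift_kos_acyclic:
  assumes "kos_acyclic I (i + q) j"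
  shows "bd_lift i q j"
  using assms
proof (induction i arbitrary: q)
  case 0
  then show ?case by (simp add: bd_lift_0)
next
  case (Suc i)
  then show ?case using Suc.IH[of "Suc q"] by (simp add: bd_lift_Suc)
qed

section \<open>Comparison of Koszul homology with Tor\<close>

lemma tensor_piece_nat: "tensor_piece F i (int j) = free_on {b \<in> G (Suc i). s (Suc i) b = j}"
  by (simp add: tensor_piece_def G_Suc s_Suc)

lemma tensor_piece_neg: "j < 0 \<Longrightarrow> tensor_piece F i j = {0}"
  by (auto simp: tensor_piece_def free_on_def)

lemma free_on_mono: "B \<subseteq> C \<Longrightarrow> free_on B \<subseteq> free_on C"
  by (auto simp: free_on_def)

lemma tensor_bd_eq: "tensor_bd F i (const_part v) = const_part (D (Suc i) v)"
  by (simp add: tensor_bd_const_part D_Suc)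

lemma tensor_bd_eq': "tensor_bd F i z = const_part (D (Suc i) (const_vec z))"
  by (simp flip: tensor_bd_eq)

lemma tensor_bd_0: "tensor_bd F i 0 = 0"
  by (simp add: tensor_bd_def)

text \<open>Lift the cycle to a vector z of constants. Once \<open>D i z\<close> is a combination of
  variables with coefficients in \<open>Z i\<close>, pulling these back corrects z, without changing
  it modulo the variables, to an element of the kernel, which is the image of the next
  module.\<close>

lemma tensor_cycles_subset_boundaries:
  assumes acyc: "kos_acyclic I i j"
  shows "tensor_cycles F i (int j) \<subseteq> tensor_boundaries F i (int j)"
proof
  fix z0 assume z0: "z0 \<in> tensor_cycles F i (int j)"
  define z :: "nat \<Rightarrow>\<^sub>0 ('x, 'k) mpoly" where "z = const_vec z0"
  have piece: "z0 \<in> free_on {b \<in> G (Suc i). s (Suc i) b = j}"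
    using z0 by (simp add: tensor_cycles_def tensor_piece_nat)
  then have "z0 \<in> free_on (G (Suc i))" using free_on_mono by (metis (no_types, lifting) mem_Collect_eq subsetD subsetI)
  then have z: "z \<in> free_on (G (Suc i))" unfolding z_def by (rule const_vec_free_on)
  have zh: "vhom (s (Suc i)) 0 j z" unfolding z_def by (rule vhom_const_vec[OF piece])
  define y where "y = D i z"
  have yZ: "y \<in> Z i" unfolding y_def Z_def using z by blast
  have yh: "vhom (s i) 0 j y" unfolding y_def by (rule D_vhom[OF z zh])
  \<comment> \<open>The point is that the coefficients can be taken in \<open>Z i\<close>, not just
    in the free module. For i = 0 this is acyclicity for a chain concentrated at the empty set; for
    i > 0 the image has no constant terms and \<open>bd_lift i 0 j\<close> applies.\<close>
  have "\<exists>f. (\<forall>A. f A \<in> Z i) \<and> kosv f {} = y"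
  proof (cases i)
    case 0
    define c where "c A = (if A = {} then lookup y 0 else 0)" for A :: "'x set"
    have y0: "y \<in> free_on {0}" "lookup y 0 \<in> I" using yZ unfolding 0 Z_0 by auto
    have "0 \<in> I" using single_in_Z_0[of 0] zero_in_Z[of 0] by simp
    then have "c A \<in> I" for A using y0 by (simp add: c_def)
    moreover have "kchain 0 j c"
      using yh unfolding 0 s_0 by (auto simp: kchain_def c_def vhom_def in_keys_iff)
    moreover have "kos c B = 0" for B by (simp add: kos_def c_def)
    ultimately obtain f where f: "\<And>A. f A \<in> I" "kos f = c"
      using acyc unfolding 0 kos_acyclic_def by metis
    have "kosv (\<lambda>A. single 0 (f A)) {} = y"
    proof (rule poly_mapping_eqI)
      fix b show "lookup (kosv (\<lambda>A. single 0 (f A)) {}) b = lookup y b"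
        using f(2) y0(1) by (cases "b = 0") (auto simp: lookup_kosv c_def lookup_single free_on_def in_keys_iff)
    qed
    then show ?thesis
      unfolding 0 using f(1) by (intro exI[of _ "\<lambda>A. single 0 (f A)"]) (simp add: single_in_Z_0)
  next
    case (Suc i')
    have "tensor_bd F i' z0 = 0" using z0 by (simp add: tensor_cycles_def Suc)
    then have "const_part y = 0" unfolding y_def z_def by (simp add: tensor_bd_eq' Suc)
    moreover have "y \<in> free_on (G i)" using yZ Z_free_on by blast
    ultimately obtain w where w: "vchain (s i) (Suc 0) j w" "\<forall>A. w A \<in> free_on (G i)"
      "kosv w = (\<lambda>A. if A = {} then y else 0)"
      using const_part_eq_0_imp_kosv[OF yh] by blast
    have "\<forall>A. kosv w A \<in> Z i" using yZ zero_in_Z by (simp add: w(3))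
    moreover have "bd_lift i 0 j" using acyc by (intro bd_lift_kos_acyclic) simp
    ultimately obtain f where "\<forall>A. f A \<in> Z i" "kosv f = kosv w"
      using w unfolding bd_lift_def by blast
    then show ?thesis by (metis w(3))
  qed
  then obtain f where f: "\<forall>A. f A \<in> Z i" "kosv f {} = y" by blast
  have "\<exists>g. \<forall>A. g A \<in> free_on (G (Suc i)) \<and> f A = D i (g A)"
    using f(1) unfolding Z_def by (intro choice) blast
  then obtain g where g: "\<And>A. g A \<in> free_on (G (Suc i))" "\<And>A. f A = D i (g A)" by blast
  have "D i (kosv g {}) = kosv f {}" unfolding D_kosv g(2)[symmetric] ..
  then have "D i (z - kosv g {}) = 0" by (simp add: D_diff f(2) y_def)
  moreover have "z - kosv g {} \<in> free_on (G (Suc i))"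
    using z g(1) by (intro free_on_diff kosv_free_on)
  ultimately have "z - kosv g {} \<in> Z (Suc i)" unfolding ker_D[symmetric] by simp
  then obtain u where u: "u \<in> free_on (G (Suc (Suc i)))" "z - kosv g {} = D (Suc i) u"
    unfolding Z_def by blast
  \<comment> \<open>The preimage u may be inhomogeneous; its degree j component suffices because z0
    lives in degree j.\<close>
  define u' where "u' = vcomp (s (Suc (Suc i))) j u"
  have u': "u' \<in> free_on (G (Suc (Suc i)))" "vhom (s (Suc (Suc i))) 0 j u'"
    unfolding u'_def using u(1) by (auto intro: vcomp_free_on vhom_vcomp)
  have "tensor_bd F i (const_part u') = const_part (vcomp (s (Suc i)) j (D (Suc i) u))"
    unfolding tensor_bd_eq u'_def D_vcomp[OF u(1)] ..
  also have "\<dots> = z0"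
  proof (rule poly_mapping_eqI)
    fix b
    have "lookup (const_part (D (Suc i) u)) b = lookup z0 b"
      unfolding u(2)[symmetric] const_part_diff by (simp only: const_part_kosv z_def const_part_const_vec) simp
    moreover have "lookup z0 b = 0" if "s (Suc i) b \<noteq> j"
      using piece that by (auto simp: free_on_def in_keys_iff)
    ultimately show "lookup (const_part (vcomp (s (Suc i)) j (D (Suc i) u))) b = lookup z0 b"
      unfolding const_part_vcomp by simp
  qed
  finally show "z0 \<in> tensor_boundaries F i (int j)"
    unfolding tensor_boundaries_def tensor_piece_nat
    using const_part_vhom[OF u'(2,1)] by blast
qed

lemma tensor_boundaries_subset_cycles: "tensor_boundaries F i j \<subseteq> tensor_cycles F i j"
proof (cases "j < 0")
  case True
  then show ?thesis
    by (auto simp: tensor_boundaries_def tensor_cycles_def tensor_piece_neg tensor_bd_0)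
next
  case False
  then obtain n where n: "j = int n" by (metis nat_0_le not_less)
  show ?thesis
    unfolding tensor_boundaries_def n
  proof (rule image_subsetI)
    fix z assume z: "z \<in> tensor_piece F (Suc i) (int n)"
    let ?z = "const_vec z :: nat \<Rightarrow>\<^sub>0 ('x, 'k) mpoly"
    have piece: "z \<in> free_on {b \<in> G (Suc (Suc i)). s (Suc (Suc i)) b = n}"
      using z by (simp add: tensor_piece_nat)
    then have "z \<in> free_on (G (Suc (Suc i)))" by (auto simp: free_on_def)
    then have zf: "?z \<in> free_on (G (Suc (Suc i)))" by (rule const_vec_free_on)
    have "const_part (D (Suc i) ?z) \<in> free_on {b \<in> G (Suc i). s (Suc i) b = n}"
      by (intro const_part_vhom D_vhom D_free_on zf vhom_const_vec[OF piece])
    moreover have "tensor_bd F i' (const_part (D (Suc i) ?z)) = 0" if i: "i = Suc i'" for i'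
    proof -
      have "D (Suc i) ?z \<in> Z (Suc i)" unfolding Z_def using zf by blast
      then have "D (Suc i') (D (Suc i) ?z) = 0" using D_Z i by simp
      then show ?thesis unfolding tensor_bd_eq by simp
    qed
    ultimately show "tensor_bd F i z \<in> tensor_cycles F i (int n)"
      unfolding tensor_cycles_def tensor_piece_nat tensor_bd_eq'[of i z] by simp
  qed
qed

text \<open>The zigzag in the opposite direction. A Koszul 1-cycle over the ideal lifts to a chain e
  over the free module of generators, its boundary y is a syzygy, and a preimage z of y reduces to a
  Tor cycle. As that cycle bounds, z can be made a combination of variables, and this corrects e to
  a genuine Koszul cycle, hence a boundary.\<close>

lemma kos_acyclic_of_tor_1:
  assumes tor: "tensor_cycles F 1 (int j) \<subseteq> tensor_boundaries F 1 (int j)"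
  shows "kos_acyclic I 1 j"
  unfolding kos_acyclic_def
proof (intro allI impI, elim conjE)
  fix c :: "'x set \<Rightarrow> ('x, 'k) mpoly"
  assume c: "kchain 1 j c" "\<forall>A. c A \<in> I" "\<forall>B. kos c B = 0"
  have "\<exists>e. \<forall>A. e A \<in> free_on (G (Suc 0)) \<and> D 0 (e A) = single 0 (c A)"
  proof (intro choice allI)
    fix A
    have "single 0 (c A) \<in> Z 0" using c(2) single_in_Z_0 by blast
    then show "\<exists>v. v \<in> free_on (G (Suc 0)) \<and> D 0 v = single 0 (c A)"
      unfolding Z_def by (metis imageE)
  qed
  then obtain e' where e': "\<And>A. e' A \<in> free_on (G (Suc 0))" "\<And>A. D 0 (e' A) = single 0 (c A)" by blast
  \<comment> \<open>Cutting to degree \<open>j - card A\<close> makes the lift homogeneous; the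
    value 0 where c vanishes keeps it supported on one-element sets.\<close>
  define e where "e A = (if c A = 0 then 0 else vcomp (s (Suc 0)) (j - card A) (e' A))" for A
  have De: "D 0 (e A) = single 0 (c A)" for A
  proof (cases "c A = 0")
    case True
    then show ?thesis by (simp add: e_def D_def)
  next
    case False
    have "mdeg m = j - card A" if "lookup (c A) m \<noteq> 0" for m
      using c(1) that unfolding kchain_def by (metis add_implies_diff in_keys_iff)
    then have "vhom (s 0) 0 (j - card A) (single 0 (c A))"
      by (auto simp: vhom_def s_0 lookup_single when_def split: if_splits)
    then have "vcomp (s 0) (j - card A) (single 0 (c A)) = single 0 (c A)" by (simp add: vcomp_vhom)
    then show ?thesis using False by (simp add: e_def e'(2) flip: D_vcomp[OF e'(1)])
  qed
  have ef: "e A \<in> free_on (G (Suc 0))" for A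
    using e'(1) by (simp add: e_def vcomp_free_on)
  have ech: "vchain (s (Suc 0)) (Suc 0) j e"
    unfolding vchain_def
  proof (intro conjI allI impI)
    fix A :: "'x set" assume "card A \<noteq> Suc 0"
    then show "e A = 0" using c(1) by (simp add: e_def kchain_def)
  next
    fix A :: "'x set"
    show "vhom (s (Suc 0)) (card A) j (e A)"
    proof (cases "c A = 0")
      case False
      then obtain m where "m \<in> keys (c A)" by (metis in_keys_iff lookup_zero poly_mapping_eqI)
      then have "card A \<le> j" using c(1) unfolding kchain_def by force
      then show ?thesis using False by (auto simp: e_def vhom_def lookup_vcomp split: if_splits)
    qed (simp add: e_def)
  qed
  define y where "y = kosv e {}"
  have yf: "y \<in> free_on (G (Suc 0))" unfolding y_def using ef by (rule kosv_free_on)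
  have yh: "vhom (s (Suc 0)) 0 j y"
    using vchain_kosv[OF ech] unfolding y_def vchain_def by (metis card.empty)
  have "D 0 y = 0"
  proof (rule poly_mapping_eqI)
    fix b :: nat
    have "kos (\<lambda>A. lookup (single 0 (c A)) b) {} = 0"
      using c(3) by (cases "b = 0") (simp_all add: lookup_single)
    then show "lookup (D 0 y) b = lookup 0 b"
      unfolding y_def D_kosv De by (simp add: lookup_kosv)
  qed
  then have "y \<in> Z (Suc 0)" using yf unfolding ker_D[symmetric] by simp
  then obtain z' where z': "z' \<in> free_on (G (Suc (Suc 0)))" "y = D (Suc 0) z'" unfolding Z_def by blast
  define z where "z = vcomp (s (Suc (Suc 0))) j z'"
  have zf: "z \<in> free_on (G (Suc (Suc 0)))" and zh: "vhom (s (Suc (Suc 0))) 0 j z"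
    unfolding z_def using z'(1) by (auto intro: vcomp_free_on vhom_vcomp)
  have Dz: "D (Suc 0) z = y"
    unfolding z_def D_vcomp[OF z'(1), symmetric] z'(2)[symmetric] using yh by (simp add: vcomp_vhom)
  have "const_part z \<in> tensor_cycles F 1 (int j)"
    unfolding tensor_cycles_def tensor_piece_nat
    using const_part_vhom[OF zh zf] by (simp add: tensor_bd_eq Dz y_def)
  then obtain y0 where y0: "y0 \<in> tensor_piece F (Suc 1) (int j)" "const_part z = tensor_bd F 1 y0"
    using tor unfolding tensor_boundaries_def by blast
  let ?y = "const_vec y0 :: nat \<Rightarrow>\<^sub>0 ('x, 'k) mpoly"
  have piece: "y0 \<in> free_on {b \<in> G (Suc (Suc (Suc 0))). s (Suc (Suc (Suc 0))) b = j}"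
    using y0(1) by (simp add: tensor_piece_nat)
  then have "y0 \<in> free_on (G (Suc (Suc (Suc 0))))" by (auto simp: free_on_def)
  then have ycf: "?y \<in> free_on (G (Suc (Suc (Suc 0))))" by (rule const_vec_free_on)
  \<comment> \<open>Subtracting a boundary leaves the image y unchanged and removes the constant
    terms of z.\<close>
  let ?t = "z - D (Suc (Suc 0)) ?y"
  have "vhom (s (Suc (Suc 0))) 0 j ?t" "?t \<in> free_on (G (Suc (Suc 0)))"
    by (intro vhom_diff free_on_diff zh zf D_vhom D_free_on ycf vhom_const_vec[OF piece])+
  moreover have "const_part ?t = 0"
    by (simp add: const_part_diff y0(2) tensor_bd_eq')
  ultimately obtain w where w: "vchain (s (Suc (Suc 0))) (Suc 0) j w"
    "\<forall>A. w A \<in> free_on (G (Suc (Suc 0)))" "kosv w = (\<lambda>A. if A = {} then ?t else 0)"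
    using const_part_eq_0_imp_kosv by blast
  have "D (Suc (Suc 0)) ?y \<in> Z (Suc (Suc 0))" unfolding Z_def using ycf by blast
  then have Dw: "D (Suc 0) (kosv w {}) = y" by (simp add: w(3) D_diff D_Z Dz)
  \<comment> \<open>The correction cancels y. It lies in the kernel of \<open>D 0\<close>, so
    \<open>e1\<close> still maps to c.\<close>
  define e1 where "e1 A = e A - D (Suc 0) (w A)" for A
  have e1ch: "vchain (s (Suc 0)) (Suc 0) j e1"
    unfolding e1_def using w by (intro vchain_diff ech D_vchain) auto
  have e1f: "e1 A \<in> free_on (G (Suc 0))" for A
    unfolding e1_def using w(2) by (intro free_on_diff ef D_free_on) auto
  have "kosv e1 B = 0" for B
  proof (cases "B = {}")
    case True
    then show ?thesis using Dw unfolding e1_def kosv_diff by (simp add: y_def D_kosv)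
  next
    case False
    then have "card B \<noteq> 0" by simp
    then show ?thesis using vchain_kosv[OF e1ch] by (simp add: vchain_def)
  qed
  then obtain g where g: "\<forall>A. g A \<in> free_on (G (Suc 0))" "kosv g = e1"
    using kosv_exact[OF e1ch e1f] by auto
  define f where "f A = lookup (D 0 (g A)) 0" for A
  have "f A \<in> I" for A
  proof -
    have "D 0 (g A) \<in> Z 0" using g(1) unfolding Z_def by blast
    then show ?thesis unfolding Z_0 f_def by blast
  qed
  moreover have "kos f A = c A" for A
  proof -
    have "D (Suc 0) (w A) \<in> Z (Suc 0)" using w(2) unfolding Z_def by blast
    then have "D 0 (e1 A) = single 0 (c A)" by (simp add: e1_def D_diff De D_Z)
    then have "lookup (kosv (\<lambda>A. D 0 (g A)) A) 0 = c A"
      by (simp flip: D_kosv add: g(2))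
    then show ?thesis by (simp add: lookup_kosv f_def[abs_def])
  qed
  ultimately show "\<exists>f. (\<forall>A. f A \<in> I) \<and> kos f = c" by (intro exI[of _ f]) auto
qed

end

text \<open>A vector of C outside B would enlarge a basis of B to an independent subset of C. The
  finite spanning set matters because \<open>dim\<close> is 0 on infinite-dimensional
  spaces.\<close>

lemma (in vector_space) subset_of_dim_le:
  assumes sub: "subspace B" "B \<subseteq> C" and U: "finite U" "C \<subseteq> span U" and dim: "dim C \<le> dim B"
  shows "C \<subseteq> B"
proof
  fix x assume x: "x \<in> C"
  obtain T where T: "T \<subseteq> B" "independent T" "B \<subseteq> span T" "card T = dim B"
    by (rule basis_exists)
  show "x \<in> B"
  proof (rule ccontr)
    assume "x \<notin> B"
    moreover have "span T \<subseteq> B" using T(1) sub(1) by (rule span_minimal)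
    ultimately have xT: "x \<notin> span T" by blast
    then have "independent (insert x T)" using T(2) by (rule independent_insertI)
    moreover have "insert x T \<subseteq> C" using x T(1) sub(2) by blast
    ultimately obtain T' where T': "insert x T \<subseteq> T'" "T' \<subseteq> C" "independent T'" "C \<subseteq> span T'"
      using maximal_independent_subset_extend by metis
    have fin: "finite T'" using independent_span_bound[OF U(1) T'(3)] T'(2) U(2) by blast
    have "finite T" using T'(1) by (intro finite_subset[OF _ fin]) simp
    moreover have "x \<notin> T" using xT span_base[of x T] by auto
    ultimately have "Suc (card T) \<le> card T'" using card_mono[OF fin T'(1)] by simp
    also have "card T' = dim C" using T'(2,4,3) by (rule basis_card_eq_dim)
    finally show False using dim T(4) by simp
  qed
qed

lemma vector_space_vscale: "vector_space (vscale :: 'k::field \<Rightarrow> _)"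
  by unfold_locales (simp_all add: vmodule.scale_right_distrib vmodule.scale_left_distrib)

text \<open>The choice of resolution is unfolded once, so the same F serves all i and j. A zero
  truncated difference only bounds the dimension of the cycles by that of the boundaries; as the
  boundaries are a subspace of the cycles and the pieces are finite-dimensional, the two
  coincide.\<close>

lemma betti_eq_0_iff:
  fixes I :: "('x::finite, 'k::field) mpoly set"
  assumes I: "I = ideal_gen (mon ` M)"
  obtains F where "graded_free_resolution I F"
    "\<And>i j. betti I i j = 0 \<longleftrightarrow> tensor_cycles F i j \<subseteq> tensor_boundaries F i j"
proof -
  define F where "F = (SOME F. graded_free_resolution I F)"
  have F: "graded_free_resolution I F"
    unfolding F_def I by (rule someI_ex[OF graded_free_resolution_exists])
  interpret resolution I F by unfold_locales (rule F)
  interpret V: vector_space "vscale :: 'k \<Rightarrow> _" by (rule vector_space_vscale)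
  have "betti I i j = 0 \<longleftrightarrow> tensor_cycles F i j \<subseteq> tensor_boundaries F i j" for i j
  proof
    assume "tensor_cycles F i j \<subseteq> tensor_boundaries F i j"
    then have "tensor_cycles F i j = tensor_boundaries F i j"
      using tensor_boundaries_subset_cycles by blast
    then show "betti I i j = 0" by (simp add: betti_def F_def Let_def)
  next
    assume "betti I i j = 0"
    then have dim: "V.dim (tensor_cycles F i j) \<le> V.dim (tensor_boundaries F i j)"
      by (simp add: betti_def F_def[symmetric] Let_def)
    let ?C = "{b \<in> res_basis F i. int (res_shift F i b) = j}"
    let ?U = "(\<lambda>b. single b (1::'k)) ` ?C"
    have "finite ?C"
    proof (rule finite_subset)
      show "?C \<subseteq> {b \<in> res_basis F i. res_shift F i b = nat j}" by auto
      show "finite {b \<in> res_basis F i. res_shift F i b = nat j}"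
        using F unfolding graded_free_resolution_def by blast
    qed
    then have U: "finite ?U" by simp
    have "tensor_cycles F i j \<subseteq> vmodule.span ?U"
    proof
      fix z assume "z \<in> tensor_cycles F i j"
      then have z: "keys z \<subseteq> ?C" by (simp add: tensor_cycles_def tensor_piece_def free_on_def)
      have "z = (\<Sum>b\<in>keys z. vscale (lookup z b) (single b 1))"
        by (simp add: vscale_single sum_single_keys)
      also have "\<dots> \<in> vmodule.span ?U"
        using z by (intro vmodule.span_sum vmodule.span_scale vmodule.span_base) blast
      finally show "z \<in> vmodule.span ?U" .
    qed
    moreover have "vmodule.subspace (tensor_boundaries F i j)"
    proof (rule vmodule.subspaceI)
      show "0 \<in> tensor_boundaries F i j"
        unfolding tensor_boundaries_def tensor_piece_def
        by (intro image_eqI[of _ _ 0]) (simp_all add: tensor_bd_def)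
      fix v w assume "v \<in> tensor_boundaries F i j" "w \<in> tensor_boundaries F i j"
      then obtain v' w' where "v = tensor_bd F i v'" "w = tensor_bd F i w'"
        "v' \<in> tensor_piece F (Suc i) j" "w' \<in> tensor_piece F (Suc i) j"
        unfolding tensor_boundaries_def by (elim imageE)
      then show "v + w \<in> tensor_boundaries F i j"
        unfolding tensor_boundaries_def tensor_piece_def
        by (intro image_eqI[of _ _ "v' + w'"]) (simp_all add: tensor_bd_def lin_ext_add free_on_add)
    next
      fix c v assume "v \<in> tensor_boundaries F i j"
      then obtain v' where "v = tensor_bd F i v'" "v' \<in> tensor_piece F (Suc i) j"
        unfolding tensor_boundaries_def by (elim imageE)
      then show "vscale c v \<in> tensor_boundaries F i j"
        unfolding tensor_boundaries_def tensor_piece_def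
        by (intro image_eqI[of _ _ "vscale c v'"]) (simp_all add: tensor_bd_def lin_ext_vscale free_on_vscale)
    qed
    ultimately show "tensor_cycles F i j \<subseteq> tensor_boundaries F i j"
      using V.subset_of_dim_le[OF _ tensor_boundaries_subset_cycles U _ dim] by blast
  qed
  with F that show thesis by blast
qed

lemma linear_quotients_imp_linear_resolution:
  fixes M :: "'x::finite monom set"
  assumes lq: "linear_quotients (ideal_gen (mon ` M) :: ('x, 'k::field) mpoly set)"
    and deg: "\<And>m. m \<in> M \<Longrightarrow> mdeg m = d"
  shows "linear_resolution (ideal_gen (mon ` M) :: ('x, 'k) mpoly set)"
proof -
  let ?I = "ideal_gen (mon ` M) :: ('x, 'k) mpoly set"
  have gens: "mingens ?I = M" by (rule mingens_ideal_gen_mdeg) (rule deg)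
  obtain ms where ms: "set ms = M"
    and V: "\<And>i. i < length ms \<Longrightarrow> \<exists>V. \<forall>n. (\<exists>l\<in>set (take i ms). l mdvd n + ms ! i) \<longleftrightarrow> (\<exists>x\<in>V. lookup n x > 0)"
    using linear_quotients_variables[OF lq deg] by blast
  have acyc: "kos_acyclic ?I q j" if j: "j \<noteq> q + d" for q j
    unfolding kos_acyclic_def
  proof (intro allI impI, elim conjE)
    fix c :: "'x set \<Rightarrow> ('x, 'k) mpoly"
    assume "kchain q j c" "\<forall>A. c A \<in> ?I" "\<forall>B. kos c B = 0"
    then show "\<exists>f. (\<forall>A. f A \<in> ?I) \<and> kos f = c"
      using kos_linear_quotients[OF V, of d q j c] deg j unfolding ms by blast
  qed
  obtain F where F: "graded_free_resolution ?I F"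
    "\<And>i j. betti ?I i j = 0 \<longleftrightarrow> tensor_cycles F i j \<subseteq> tensor_boundaries F i j"
    using betti_eq_0_iff[OF refl] by metis
  interpret resolution ?I F by unfold_locales (rule F)
  have "betti ?I i j = 0" if j: "j \<noteq> int i + int d" for i j
  proof (cases "j < 0")
    case True
    have "tensor_cycles F i j \<subseteq> tensor_boundaries F i j"
      using True by (auto simp: tensor_boundaries_def tensor_cycles_def tensor_piece_neg tensor_bd_0)
    then show ?thesis by (simp add: F(2))
  next
    case False
    then obtain n where n: "j = int n" by (metis nat_0_le not_less)
    then have "n \<noteq> i + d" using j by simp
    then show ?thesis unfolding F(2) n by (intro tensor_cycles_subset_boundaries acyc)
  qed
  then show ?thesis
    unfolding linear_resolution_def gens using deg by (intro exI[of _ d]) simp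
qed

lemma betti_1_eq_0_imp_kos_acyclic:
  fixes M :: "'x::finite monom set"
  assumes "betti (ideal_gen (mon ` M) :: ('x, 'k::field) mpoly set) 1 (int j) = 0"
  shows "kos_acyclic (ideal_gen (mon ` M) :: ('x, 'k) mpoly set) 1 j"
proof -
  let ?I = "ideal_gen (mon ` M) :: ('x, 'k) mpoly set"
  obtain F where F: "graded_free_resolution ?I F"
    "\<And>i j. betti ?I i j = 0 \<longleftrightarrow> tensor_cycles F i j \<subseteq> tensor_boundaries F i j"
    using betti_eq_0_iff[OF refl] by metis
  interpret resolution ?I F by unfold_locales (rule F)
  show ?thesis using assms unfolding F(2) by (rule kos_acyclic_of_tor_1)
qed

section \<open>Powers of the ideal of a pair of posets\<close>

fun powsum :: "'x monom set \<Rightarrow> nat \<Rightarrow> 'x monom set" where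
  "powsum H 0 = {0}"
| "powsum H (Suc k) = {m + n |m n. m \<in> H \<and> n \<in> powsum H k}"

lemma ideal_pow_mon:
  "ideal_pow (ideal_gen (mon ` H) :: ('x, 'k::comm_ring_1) mpoly set) k = ideal_gen (mon ` powsum H k)"
proof (induction k)
  case 0
  show ?case unfolding ideal_pow.simps powsum.simps by (rule UNIV_eq_ideal_gen_mon)
next
  case (Suc k)
  show ?case unfolding ideal_pow.simps Suc powsum.simps by (rule ideal_gen_mult_mon)
qed

definition hom_exp :: "('p::finite \<Rightarrow> 'q::finite) \<Rightarrow> ('p \<times> 'q) monom" where
  "hom_exp \<phi> = (\<Sum>p\<in>UNIV. single (p, \<phi> p) 1)"

lemma lookup_hom_exp: "lookup (hom_exp \<phi>) (p, q) = (if \<phi> p = q then 1 else 0)"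
proof -
  have "lookup (hom_exp \<phi>) (p, q) = (\<Sum>p'\<in>UNIV. if p' = p then (if \<phi> p = q then 1 else 0) else 0)"
    unfolding hom_exp_def lookup_sum lookup_single when_def by (intro sum.cong refl) auto
  then show ?thesis by simp
qed

lemma mdeg_hom_exp [simp]: "mdeg (hom_exp (\<phi> :: 'p::finite \<Rightarrow> 'q::finite)) = card (UNIV :: 'p set)"
  by (simp add: hom_exp_def mdeg_sum)

lemma hom_ideal_eq:
  "(hom_ideal :: ('p::{finite,order} \<times> 'q::{finite,order}, 'k::field) mpoly set) =
    ideal_gen (mon ` hom_exp ` {\<phi>. mono \<phi>})"
proof -
  have "hom_monomial \<phi> = (mon (hom_exp \<phi>) :: ('p \<times> 'q, 'k) mpoly)" for \<phi>
    unfolding hom_monomial_def hom_exp_def var_def by (rule mon_prod)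
  then show ?thesis unfolding hom_ideal_def image_image by simp
qed

text \<open>
  An exponent vector on \<open>P \<times> Q\<close> is a sum of \<open>k\<close> homomorphisms iff its rows sum to \<open>k\<close> and the
  partial sums of its rows, in the order given by \<open>r\<close>, decrease along \<open>P\<close>.
\<close>

definition row :: "('p \<times> 'q::finite) monom \<Rightarrow> 'p \<Rightarrow> nat" where
  "row v p = (\<Sum>q\<in>UNIV. lookup v (p, q))"

definition cum :: "('q::finite \<Rightarrow> nat) \<Rightarrow> ('p \<times> 'q) monom \<Rightarrow> 'p \<Rightarrow> nat \<Rightarrow> nat" where
  "cum r v p n = (\<Sum>q\<in>{q. r q \<le> n}. lookup v (p, q))"

definition admissible :: "('q::finite \<Rightarrow> nat) \<Rightarrow> nat \<Rightarrow> ('p::{finite,order} \<times> 'q) monom set" where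
  "admissible r k = {v. (\<forall>p. row v p = k) \<and> (\<forall>p p' n. p \<le> p' \<longrightarrow> cum r v p' n \<le> cum r v p n)}"

lemma row_add: "row (v + w) p = row v p + row w p"
  by (simp add: row_def lookup_add sum.distrib)

lemma cum_add: "cum r (v + w) p n = cum r v p n + cum r w p n"
  by (simp add: cum_def lookup_add sum.distrib)

lemma row_hom_exp [simp]: "row (hom_exp \<phi>) p = 1"
  by (simp add: row_def lookup_hom_exp)

lemma cum_hom_exp: "cum r (hom_exp \<phi>) p n = (if r (\<phi> p) \<le> n then 1 else 0)"
  by (simp add: cum_def lookup_hom_exp)

lemma row_single: "row (single (p', q) 1) p = (if p = p' then 1 else 0)"
  by (simp add: row_def lookup_single when_def)

lemma cum_single: "cum r (single (p', q) 1) p n = (if p = p' \<and> r q \<le> n then 1 else 0)"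
  by (auto simp: cum_def lookup_single when_def)

lemma cum_mono: "m \<le> n \<Longrightarrow> cum r v p m \<le> cum r v p n"
  unfolding cum_def by (intro sum_mono2) auto

lemma mdeg_eq_sum_row: "mdeg v = (\<Sum>p\<in>UNIV. row v p)" for v :: "('p::finite \<times> 'q::finite) monom"
  by (simp add: mdeg_UNIV row_def sum.cartesian_product)

text \<open>To peel off one homomorphism, let \<open>\<phi> p\<close> be the entry of row p that is
  least for r. It is monotone because a partial sum positive at a larger p is positive at a smaller
  one. Removing it lowers every positive partial sum by one, which keeps them decreasing along
  P.\<close>

lemma powsum_hom_exp:
  fixes r :: "'q::{finite,order} \<Rightarrow> nat"
  assumes mono: "\<And>\<phi> :: 'p::{finite,order} \<Rightarrow> 'q. mono \<phi> \<longleftrightarrow> (\<forall>p p'. p \<le> p' \<longrightarrow> r (\<phi> p) \<le> r (\<phi> p'))"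
  shows "powsum (hom_exp ` {\<phi> :: 'p \<Rightarrow> 'q. mono \<phi>}) k = admissible r k"
proof (induction k)
  case 0
  have "v = 0" if v: "\<forall>p. row v p = 0" for v :: "('p \<times> 'q) monom"
  proof -
    have "mdeg v = 0" using v by (simp add: mdeg_eq_sum_row)
    then show ?thesis by simp
  qed
  then show ?case by (auto simp: admissible_def row_def cum_def)
next
  case (Suc k)
  show ?case
  proof
    show "powsum (hom_exp ` {\<phi> :: 'p \<Rightarrow> 'q. mono \<phi>}) (Suc k) \<subseteq> admissible r (Suc k)"
    proof
      fix v assume "v \<in> powsum (hom_exp ` {\<phi> :: 'p \<Rightarrow> 'q. mono \<phi>}) (Suc k)"
      then obtain \<phi> w where v: "v = hom_exp \<phi> + w" "mono \<phi>" "w \<in> admissible r k"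
        unfolding powsum.simps Suc by blast
      have "cum r v p' n \<le> cum r v p n" if p: "p \<le> p'" for p p' n
      proof -
        have "r (\<phi> p) \<le> r (\<phi> p')" using v(2) p unfolding mono by blast
        moreover have "cum r w p' n \<le> cum r w p n" using v(3) p unfolding admissible_def by blast
        ultimately show ?thesis by (simp add: v(1) cum_add cum_hom_exp)
      qed
      then show "v \<in> admissible r (Suc k)"
        using v(3) by (simp add: admissible_def v(1) row_add)
    qed
    show "admissible r (Suc k) \<subseteq> powsum (hom_exp ` {\<phi> :: 'p \<Rightarrow> 'q. mono \<phi>}) (Suc k)"
    proof
      fix v :: "('p \<times> 'q) monom" assume v: "v \<in> admissible r (Suc k)"
      have "\<exists>\<phi>. \<forall>p. lookup v (p, \<phi> p) > 0 \<and> (\<forall>q. lookup v (p, q) > 0 \<longrightarrow> r (\<phi> p) \<le> r q)"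
      proof (intro choice allI)
        fix p
        have "row v p \<noteq> 0" using v by (simp add: admissible_def)
        then obtain q where "lookup v (p, q) > 0"
          unfolding row_def by (metis gr0I sum.neutral)
        then show "\<exists>q. lookup v (p, q) > 0 \<and> (\<forall>q'. lookup v (p, q') > 0 \<longrightarrow> r q \<le> r q')"
          using ex_has_least_nat[of "\<lambda>q. lookup v (p, q) > 0" q r] by blast
      qed
      then obtain \<phi> where \<phi>: "\<And>p. lookup v (p, \<phi> p) > 0"
        "\<And>p q. lookup v (p, q) > 0 \<Longrightarrow> r (\<phi> p) \<le> r q" by blast
      have cum_pos: "cum r v p n > 0 \<longleftrightarrow> r (\<phi> p) \<le> n" for p n
      proof
        assume "cum r v p n > 0"
        then obtain q where "r q \<le> n" "lookup v (p, q) > 0"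
          unfolding cum_def by (metis (mono_tags, lifting) gr0I less_irrefl mem_Collect_eq sum.neutral)
        then show "r (\<phi> p) \<le> n" using \<phi>(2) le_trans by blast
      next
        assume "r (\<phi> p) \<le> n"
        then have "lookup v (p, \<phi> p) \<le> cum r v p n"
          unfolding cum_def by (intro member_le_sum) auto
        then show "cum r v p n > 0" using \<phi>(1)[of p] by linarith
      qed
      have anti: "cum r v p' n \<le> cum r v p n" if "p \<le> p'" for p p' n
        using v that unfolding admissible_def by blast
      have "mono \<phi>"
        unfolding mono
      proof (intro allI impI)
        fix p p' :: 'p assume "p \<le> p'"
        then have "cum r v p (r (\<phi> p')) > 0"
          using anti[of p p' "r (\<phi> p')"] cum_pos[of p' "r (\<phi> p')"] by simp
        then show "r (\<phi> p) \<le> r (\<phi> p')" by (simp add: cum_pos)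
      qed
      have "lookup (hom_exp \<phi>) (p, q) \<le> lookup v (p, q)" for p q
        using \<phi>(1)[of p] by (auto simp: lookup_hom_exp)
      then have "hom_exp \<phi> mdvd v" by (simp add: mdvd_def)
      then have w: "v = hom_exp \<phi> + (v - hom_exp \<phi>)" by (simp add: mdvd_diff_add)
      define w where "w = v - hom_exp \<phi>"
      have v_eq: "v = hom_exp \<phi> + w" using w by (simp add: w_def)
      \<comment> \<open>Truncated subtraction gives the right value 0 also where the partial sum has
        not yet reached \<open>\<phi> p\<close>.\<close>
      have cum_w: "cum r w p n = cum r v p n - 1" for p n
      proof -
        have "cum r v p n = (if r (\<phi> p) \<le> n then 1 else 0) + cum r w p n"
          by (subst v_eq) (simp add: cum_add cum_hom_exp)
        then show ?thesis using cum_pos[of p n] by (auto split: if_splits)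
      qed
      have "row w p = k" for p
      proof -
        have "row v p = Suc k" using v by (simp add: admissible_def)
        then show ?thesis by (subst (asm) v_eq) (simp add: row_add)
      qed
      then have "w \<in> admissible r k" using anti by (simp add: admissible_def cum_w diff_le_mono)
      then show "v \<in> powsum (hom_exp ` {\<phi> :: 'p \<Rightarrow> 'q. mono \<phi>}) (Suc k)"
        unfolding powsum.simps Suc using v_eq \<open>mono \<phi>\<close> by blast
    qed
  qed
qed

text \<open>Let u and v first differ at (p, q), where u is larger. In v, move one unit from the next
  nonzero entry (p, q') of the same row to (p, q). Only the partial sums of row p from
  \<open>r q\<close> up to just before \<open>r q'\<close> grow, by one; they stay below those of
  row p in u, hence below those of u at smaller elements of P, where u and v agree.\<close>

lemma weakly_polymatroidal_admissible:
  fixes r :: "'q::finite \<Rightarrow> nat"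
  assumes inj: "inj r"
  shows "weakly_polymatroidal
    (ideal_gen (mon ` admissible r k) :: ('p::{finite,order} \<times> 'q, 'k::comm_ring_1) mpoly set)"
proof -
  let ?M = "admissible r k :: ('p \<times> 'q) monom set"
  let ?I = "ideal_gen (mon ` ?M) :: ('p \<times> 'q, 'k) mpoly set"
  have "mdeg v = card (UNIV :: 'p set) * k" if "v \<in> ?M" for v
    using that by (simp add: admissible_def mdeg_eq_sum_row)
  then have gens: "mingens ?I = ?M" by (rule mingens_ideal_gen_mdeg)
  define N where "N = Suc (\<Sum>q\<in>UNIV. r q)"
  have N: "r q < N" for q unfolding N_def by (simp add: less_Suc_eq_le member_le_sum)
  \<comment> \<open>As N exceeds every \<open>r q\<close>, this ranks by number of predecessors,
    then by r. Incomparable elements of P with equal counts may interleave, which is harmless: only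
    strict inequalities of f are converted into positions.\<close>
  define f where "f = (\<lambda>(p :: 'p, q). card {p'. p' < p} * N + r q)"
  have f1: "f (p, q) < f (p', q')" if "p < p'" for p p' q q'
  proof -
    have "{x. x < p} \<subset> {x. x < p'}" using that by (auto dest: less_trans)
    then have "Suc (card {x. x < p}) \<le> card {x. x < p'}" by (simp add: psubset_card_mono Suc_leI)
    then have "Suc (card {x. x < p}) * N \<le> card {x. x < p'} * N" by (rule mult_le_mono1)
    then show ?thesis using N[of q] by (simp add: f_def)
  qed
  have f2: "f (p, q) < f (p, q') \<longleftrightarrow> r q < r q'" for p q q'
    by (simp add: f_def)
  obtain xs0 :: "('p \<times> 'q) list" where xs0: "set xs0 = UNIV" "distinct xs0"
    using finite_distinct_list[OF finite_UNIV] by blast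
  define xs where "xs = sort_key f xs0"
  have xs: "set xs = UNIV" "distinct xs" "sorted (map f xs)"
    using xs0 by (simp_all add: xs_def)
  have index: "s < t" if "f (xs ! s) < f (xs ! t)" "s < length xs" "t < length xs" for s t
  proof (rule ccontr)
    assume "\<not> s < t"
    then have "map f xs ! t \<le> map f xs ! s" using xs(3) that by (intro sorted_nth_mono) auto
    then show False using that by simp
  qed
  have "\<exists>l. t < l \<and> l < length xs \<and> lookup v (xs ! l) > 0 \<and> var (xs ! t) * mon (v - single (xs ! l) 1) \<in> ?I"
    if u: "u \<in> ?M" and v: "v \<in> ?M" and t: "t < length xs"
      and agree: "\<forall>s<t. lookup u (xs ! s) = lookup v (xs ! s)" and gt: "lookup u (xs ! t) > lookup v (xs ! t)"
    for u v t
  proof -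
    obtain p q where pq: "xs ! t = (p, q)" by fastforce
    have before: "lookup u z = lookup v z" if z: "f z < f (p, q)" for z
    proof -
      obtain s where "s < length xs" "xs ! s = z" using xs(1) by (metis UNIV_I in_set_conv_nth)
      then show ?thesis using agree index[of s t] t z pq by auto
    qed
    have rows: "row u x = k" "row v x = k" for x using u v by (simp_all add: admissible_def)
    have anti: "x \<le> y \<Longrightarrow> cum r u y n \<le> cum r u x n" "x \<le> y \<Longrightarrow> cum r v y n \<le> cum r v x n" for x y n
      using u v unfolding admissible_def by blast+
    have row_less: "cum r u x n = cum r v x n" if x: "x < p" for x n
      unfolding cum_def using before[OF f1[OF x]] by simp
    have cum_less: "cum r v p (r q) < cum r u p (r q)"
      unfolding cum_def
    proof (rule sum_strict_mono_ex1)
      show "\<forall>y\<in>{y. r y \<le> r q}. lookup v (p, y) \<le> lookup u (p, y)"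
      proof
        fix y assume y: "y \<in> {y. r y \<le> r q}"
        show "lookup v (p, y) \<le> lookup u (p, y)"
        proof (cases "y = q")
          case True
          then show ?thesis using gt pq by simp
        next
          case False
          then have "r y < r q" using y injD[OF inj, of y q] by force
          then show ?thesis using before[of "(p, y)"] by (simp add: f2)
        qed
      qed
      show "\<exists>y\<in>{y. r y \<le> r q}. lookup v (p, y) < lookup u (p, y)"
        using gt pq by (intro bexI[of _ q]) auto
    qed simp
    \<comment> \<open>Both rows sum to k, and up to q the sum of v is smaller, so v has something
      left after q.\<close>
    have "\<exists>y. r q < r y \<and> lookup v (p, y) > 0"
    proof (rule ccontr)
      assume no: "\<not> ?thesis"
      have "row v p = cum r v p (r q)"
        unfolding row_def cum_def
      proof (rule sum.mono_neutral_right)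
        show "\<forall>y\<in>UNIV - {y. r y \<le> r q}. lookup v (p, y) = 0"
          using no by (auto simp: not_le)
      qed auto
      moreover have "cum r u p (r q) \<le> row u p"
        unfolding row_def cum_def by (intro sum_mono2) auto
      ultimately show False using cum_less rows by simp
    qed
    then obtain y0 where y0: "r q < r y0 \<and> lookup v (p, y0) > 0" by blast
    obtain q' where q': "r q < r q'" "lookup v (p, q') > 0"
      "\<And>y. r q < r y \<Longrightarrow> lookup v (p, y) > 0 \<Longrightarrow> r q' \<le> r y"
      using ex_has_least_nat[of "\<lambda>y. r q < r y \<and> lookup v (p, y) > 0" y0 r] y0 by blast
    obtain l where l: "l < length xs" "xs ! l = (p, q')" using xs(1) by (metis UNIV_I in_set_conv_nth)
    have "t < l" using index[of t l] l t pq q'(1) by (simp add: f2)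
    define w where "w = single (p, q) 1 + (v - single (p, q') 1)"
    have "(v - single (p, q') 1) + single (p, q') 1 = v"
      using q'(2) by (intro mdvd_diff_add') (simp add: single_mdvd_iff)
    then have w: "w + single (p, q') 1 = v + single (p, q) 1"
      unfolding w_def by (metis add.assoc add.commute)
    have roww: "row w x = k" for x
      using arg_cong[OF w, of "\<lambda>m. row m x"] rows(2)[of x] by (auto simp only: row_add row_single split: if_splits)
    have cumw: "cum r w x n + (if x = p \<and> r q' \<le> n then 1 else 0) =
      cum r v x n + (if x = p \<and> r q \<le> n then 1 else 0)" for x n
      using arg_cong[OF w, of "\<lambda>m. cum r m x n"] by (simp only: cum_add cum_single)
    \<comment> \<open>The critical case compares row p with a smaller row x, in the range of n where
      row p grew. By the choice of q', v has no entries in row p strictly between q and q', so its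
      partial sum there is the one at q.\<close>
    have "cum r w y n \<le> cum r w x n" if xy: "x \<le> y" for x y n
    proof (cases "y = p \<and> x \<noteq> p \<and> r q \<le> n \<and> n < r q'")
      case True
      then have "x < p" using xy by (simp add: order.strict_iff_order)
      have same: "cum r v p n = cum r v p (r q)"
        unfolding cum_def
      proof (rule sum.mono_neutral_right)
        show "\<forall>i\<in>{y. r y \<le> n} - {y. r y \<le> r q}. lookup v (p, i) = 0"
        proof
          fix i assume "i \<in> {y. r y \<le> n} - {y. r y \<le> r q}"
          then show "lookup v (p, i) = 0" using q'(3)[of i] True by fastforce
        qed
      qed (use True in auto)
      have "cum r w p n = cum r v p (r q) + 1" using cumw[of p n] True same by simp
      also have "\<dots> \<le> cum r u p (r q)" using cum_less by simp
      also have "\<dots> \<le> cum r u p n" using True by (intro cum_mono) simp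
      also have "\<dots> \<le> cum r u x n" using xy True by (intro anti) simp
      also have "\<dots> = cum r w x n" using row_less[OF \<open>x < p\<close>] cumw[of x n] True by simp
      finally show ?thesis using True by simp
    next
      case False
      show ?thesis
        using cumw[of x n] cumw[of y n] anti(2)[OF xy, of n] False q'(1) xy
        by (auto split: if_splits)
    qed
    then have "w \<in> ?M" using roww by (simp add: admissible_def)
    then have "(mon w :: ('p \<times> 'q, 'k) mpoly) \<in> ?I" unfolding mon_in_ideal_gen by (intro bexI[of _ w]) simp_all
    then have "var (xs ! t) * mon (v - single (xs ! l) 1) \<in> ?I"
      by (simp add: var_def mon_mult pq l(2) w_def)
    then show ?thesis using \<open>t < l\<close> l q'(2) by (intro exI[of _ l]) simp
  qed
  then show ?thesis
    unfolding weakly_polymatroidal_def gens by (intro exI[of _ xs]) (simp add: xs(1,2))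
qed

text \<open>If P is an antichain, all maps are monotone and the condition on r is trivial, so any
  injection works. If Q is a chain, counting predecessors is an order embedding.\<close>

lemma hom_ideal_powers_weakly_polymatroidal:
  assumes "(\<forall>x y::'p::{finite,order}. x \<noteq> y \<longrightarrow> \<not> x \<le> y \<and> \<not> y \<le> x) \<or>
    (\<forall>x y::'q::{finite,order}. x \<le> y \<or> y \<le> x)"
  shows "weakly_polymatroidal (ideal_pow (hom_ideal :: ('p \<times> 'q, 'k::field) mpoly set) k)"
proof -
  have "\<exists>r :: 'q \<Rightarrow> nat. inj r \<and> (\<forall>\<phi> :: 'p \<Rightarrow> 'q. mono \<phi> \<longleftrightarrow> (\<forall>p p'. p \<le> p' \<longrightarrow> r (\<phi> p) \<le> r (\<phi> p')))"
    using assms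
  proof
    assume "\<forall>x y::'p. x \<noteq> y \<longrightarrow> \<not> x \<le> y \<and> \<not> y \<le> x"
    then have "p = p'" if "p \<le> p'" for p p' :: 'p using that by blast
    then have "(mono \<phi> \<longleftrightarrow> (\<forall>p p'. p \<le> p' \<longrightarrow> to_nat (\<phi> p) \<le> to_nat (\<phi> p')))"
      for \<phi> :: "'p \<Rightarrow> 'q"
      unfolding mono_def by (metis order_refl)
    then show ?thesis by (intro exI[of _ to_nat]) simp
  next
    assume chain: "\<forall>x y::'q. x \<le> y \<or> y \<le> x"
    define r where "r q = card {y. y < q}" for q :: 'q
    have less: "r x < r y" if "x < y" for x y
      unfolding r_def using that by (intro psubset_card_mono) (auto dest: less_trans)
    have le: "r x \<le> r y \<longleftrightarrow> x \<le> y" for x y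
      using less[of x y] less[of y x] chain by (metis leD le_less linorder_not_less)
    then have "inj r" by (intro injI) (metis order_antisym order_refl)
    moreover have "mono \<phi> \<longleftrightarrow> (\<forall>p p'. p \<le> p' \<longrightarrow> r (\<phi> p) \<le> r (\<phi> p'))" for \<phi> :: "'p \<Rightarrow> 'q"
      unfolding mono_def le ..
    ultimately show ?thesis by blast
  qed
  then obtain r :: "'q \<Rightarrow> nat" where r: "inj r"
    "\<forall>\<phi> :: 'p \<Rightarrow> 'q. mono \<phi> \<longleftrightarrow> (\<forall>p p'. p \<le> p' \<longrightarrow> r (\<phi> p) \<le> r (\<phi> p'))"
    by (elim exE conjE)
  show ?thesis
    unfolding hom_ideal_eq ideal_pow_mon powsum_hom_exp[OF spec[OF r(2)]]
    by (rule weakly_polymatroidal_admissible[OF r(1)])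
qed

section \<open>An obstruction to a linear first syzygy\<close>

text \<open>
  The constant map \<open>q\<close> and its modification to \<open>q'\<close> on a connected component \<open>C\<close> of \<open>P\<close> are
  the only two homomorphisms dividing their least common multiple \<open>a\<close>, so the upper Koszul complex
  of the ideal at \<open>a\<close> is a disjoint union of two simplices.
\<close>

lemma hom_ideal_not_kos_acyclic:
  fixes p1 p2 :: "'p::{finite,order}" and q q' :: "'q::{finite,order}"
  assumes p: "p1 < p2" and q: "\<not> q \<le> q'" "\<not> q' \<le> q"
  shows "\<exists>i>1. \<not> kos_acyclic (hom_ideal :: ('p \<times> 'q, 'k::field) mpoly set) 1 (card (UNIV :: 'p set) + i)"
proof -
  let ?I = "hom_ideal :: ('p \<times> 'q, 'k) mpoly set"
  \<comment> \<open>Comparability in P; its connected component of p1 is closed upwards and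
    downwards, so a map that is constant on it and on its complement is monotone.\<close>
  define R where "R = {(x :: 'p, y). x \<le> y \<or> y \<le> x}"
  define C where "C = R\<^sup>* `` {p1}"
  have C_le: "x \<in> C \<longleftrightarrow> y \<in> C" if "x \<le> y" for x y
  proof -
    have "(x, y) \<in> R" "(y, x) \<in> R" using that by (auto simp: R_def)
    then show ?thesis unfolding C_def by (meson Image_singleton_iff rtrancl.rtrancl_into_rtrancl)
  qed
  have C: "p1 \<in> C" "p2 \<in> C" using C_le[of p1 p2] p by (auto simp: C_def)
  have card_C: "card C > 1"
  proof -
    have "card {p1, p2} \<le> card C" using C by (intro card_mono) auto
    then show ?thesis using p by simp
  qed
  define \<psi> where "\<psi> x = (if x \<in> C then q' else q)" for x
  have mono: "mono (\<lambda>_ :: 'p. q)" "mono \<psi>"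
    using C_le by (auto simp: mono_def \<psi>_def)
  define a where "a = hom_exp (\<lambda>_ :: 'p. q) + (\<Sum>x\<in>C. single (x, q') 1)"
  have qq': "q \<noteq> q'" using q by auto
  have a: "lookup a (x, y) = (if y = q \<or> (x \<in> C \<and> y = q') then 1 else 0)" for x y
  proof -
    have "lookup (\<Sum>x\<in>C. single (x, q') (1::nat)) (x, y) = (\<Sum>z\<in>C. if z = x then (if y = q' then 1 else 0) else 0)"
      unfolding lookup_sum lookup_single when_def by (intro sum.cong refl) auto
    then show ?thesis using qq' by (auto simp: a_def lookup_add lookup_hom_exp)
  qed
  \<comment> \<open>The component contains p1 and p2, so this degree exceeds |P| + 1, the degree of
    linear first syzygies.\<close>
  have mdeg_a: "mdeg a = card (UNIV :: 'p set) + card C"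
    by (simp add: a_def mdeg_sum)
  \<comment> \<open>Such a map takes only the values q and q', the latter only on C. Comparable
    arguments have comparable values, and q and q' are incomparable, so the map is constant along
    paths in C.\<close>
  have gens: "\<chi> = (\<lambda>_. q) \<or> \<chi> = \<psi>" if \<chi>: "mono \<chi>" "hom_exp \<chi> mdvd a" for \<chi>
  proof -
    have val: "\<chi> x = q \<or> (x \<in> C \<and> \<chi> x = q')" for x
    proof -
      have "lookup (hom_exp \<chi>) (x, \<chi> x) \<le> lookup a (x, \<chi> x)" using \<chi>(2) unfolding mdvd_def by blast
      then show ?thesis by (auto simp: lookup_hom_exp a split: if_splits)
    qed
    have eq: "\<chi> x = \<chi> y" if "(x, y) \<in> R" for x y
    proof -
      have "\<chi> x \<le> \<chi> y \<or> \<chi> y \<le> \<chi> x" using that monoD[OF \<chi>(1)] unfolding R_def by blast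
      then show ?thesis using val[of x] val[of y] q by metis
    qed
    have "\<chi> x = \<chi> p1" if "x \<in> C" for x
    proof -
      have "(p1, x) \<in> R\<^sup>*" using that by (simp add: C_def)
      then show ?thesis by (induction rule: rtrancl_induct) (use eq in auto)
    qed
    then show ?thesis using val unfolding \<psi>_def by (cases "\<chi> p1 = q") (metis, metis)
  qed
  have memI: "k \<in> keys f \<Longrightarrow> f \<in> ?I \<Longrightarrow> \<exists>\<chi>. mono \<chi> \<and> hom_exp \<chi> mdvd k" for f k
    unfolding hom_ideal_eq ideal_gen_mon by blast
  \<comment> \<open>One vertex from each of the two simplices, with opposite signs: a divided by
    (p1, q) is a multiple of the generator of \<open>\<psi>\<close>, and a divided by (p1, q') is
    one of the generator of the constant map.\<close>
  define c :: "('p \<times> 'q) set \<Rightarrow> ('p \<times> 'q, 'k) mpoly" where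
    "c A = (if A = {(p1, q)} then mon (a - single (p1, q) 1)
      else if A = {(p1, q')} then - mon (a - single (p1, q') 1) else 0)" for A
  have apos: "single (p1, q) 1 mdvd a" "single (p1, q') 1 mdvd a"
    using C(1) by (simp_all add: single_mdvd_iff a)
  have "kchain 1 (mdeg a) c"
  proof -
    have "mdeg (a - single z 1) + 1 = mdeg a" if "single z 1 mdvd a" for z
      using mdvd_diff_add'[OF that] by (metis mdeg_add mdeg_single)
    then show ?thesis using apos by (auto simp: kchain_def c_def)
  qed
  moreover have "c A \<in> ?I" for A
  proof -
    have "hom_exp \<psi> mdvd a - single (p1, q) 1" "hom_exp (\<lambda>_. q) mdvd a - single (p1, q') 1"
      using C(1) qq' by (auto simp: mdvd_def lookup_hom_exp lookup_minus a \<psi>_def lookup_single when_def)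
    then show ?thesis
      using mono unfolding hom_ideal_eq ideal_gen_mon by (auto simp: c_def)
  qed
  moreover have "kos c B = 0" for B
  proof (cases "B = {}")
    case True
    have "kos c {} = (\<Sum>z\<in>UNIV. var z * c {z})"
      by (simp add: kos_def ksgn_def)
    also have "\<dots> = (\<Sum>z\<in>{(p1, q), (p1, q')}. var z * c {z})"
      by (intro sum.mono_neutral_right) (auto simp: c_def)
    also have "\<dots> = var (p1, q) * mon (a - single (p1, q) 1) - var (p1, q') * mon (a - single (p1, q') 1)"
      using qq' by (simp add: c_def)
    also have "\<dots> = 0"
      unfolding var_def mon_mult mdvd_diff_add[OF apos(1)] mdvd_diff_add[OF apos(2)] by simp
    finally show ?thesis using True by simp
  next
    case False
    then have ne: "insert z B \<noteq> {(p1, q)} \<and> insert z B \<noteq> {(p1, q')}" if "z \<notin> B" for z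
      using that by auto
    have "c (insert z B) = 0" if "z \<notin> B" for z
      using ne[OF that] unfolding c_def by (auto simp only: if_False)
    then show ?thesis by (simp add: kos_def)
  qed
  moreover have False if f: "\<forall>A. f A \<in> ?I" "kos f = c" for f
  proof -
    \<comment> \<open>The vertex set of the simplex belonging to \<open>\<psi>\<close>: the
      variables that divide a and do not occur in the generator of \<open>\<psi>\<close>. The
      assumed filling is cut down to the faces of this simplex.\<close>
    define T where "T = (\<lambda>x. (x, q)) ` C"
    define f' where "f' A = (if A \<subseteq> T then f A else 0)" for A
    have f'T: "lookup (kos f' {z}) (a - single z 1) = (if z \<in> T then lookup (c {z}) (a - single z 1) else 0)" for z
    proof (cases "z \<in> T")
      case False
      then have "kos f' {z} = 0" by (simp add: kos_def f'_def)
      then show ?thesis using False by simp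
    next
      case True
      then obtain x where z: "z = (x, q)" "x \<in> C" by (auto simp: T_def)
      \<comment> \<open>No edge leaves T. After division by z in T only the generator of
        \<open>\<psi>\<close> can still divide a, and every y outside T that divides a occurs in
        that generator.\<close>
      have "lookup (f (insert y {z})) (a - single z 1 - single y 1) = 0"
        if y: "y \<notin> T" "y \<noteq> z" "lookup (a - single z 1) y > 0" for y
      proof (rule ccontr)
        assume "lookup (f (insert y {z})) (a - single z 1 - single y 1) \<noteq> 0"
        then obtain \<chi> where \<chi>: "mono \<chi>" "hom_exp \<chi> mdvd a - single z 1 - single y 1"
          using memI[of "a - single z 1 - single y 1"] f(1) by (auto simp: in_keys_iff)
        have "hom_exp \<chi> mdvd a"
          using \<chi>(2) unfolding mdvd_def lookup_minus by (meson diff_le_self le_trans)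
        then have "\<chi> = (\<lambda>_. q) \<or> \<chi> = \<psi>" using gens \<chi>(1) by blast
        moreover have "lookup (hom_exp \<chi>) z = 0"
        proof -
          have "lookup (a - single z 1 - single y 1) z = 0"
            using y(2) by (simp add: lookup_minus z a)
          then show ?thesis using \<chi>(2) unfolding mdvd_def by (metis le_zero_eq)
        qed
        ultimately have \<chi>_eq: "\<chi> = \<psi>" using z by (auto simp: lookup_hom_exp split: if_splits)
        obtain y1 y2 where y12: "y = (y1, y2)" by fastforce
        have "lookup a y > 0" using y(3) by (simp add: lookup_minus)
        then have "y2 = \<psi> y1" using y(1) unfolding y12 T_def \<psi>_def by (auto simp: a split: if_splits)
        then have "lookup (hom_exp \<chi>) y = 1" by (simp add: \<chi>_eq y12 lookup_hom_exp)
        moreover have "lookup (a - single z 1 - single y 1) y = 0"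
          by (simp add: lookup_minus y12 a)
        ultimately show False using \<chi>(2) unfolding mdvd_def by (metis not_one_le_zero)
      qed
      then have "lookup (kos f' {z}) (a - single z 1) = lookup (kos f {z}) (a - single z 1)"
        unfolding lookup_kos using True by (intro sum.cong refl) (auto simp: f'_def)
      then show ?thesis using True f(2) by simp
    qed
    \<comment> \<open>In multidegree a the restricted filling bounds the part of c on T, whose
      augmentation is 1 instead of 0.\<close>
    have "0 = lookup (kos (kos f') {}) a" by (simp add: kos_kos)
    also have "\<dots> = (\<Sum>z\<in>UNIV. if lookup a z > 0 then lookup (kos f' {z}) (a - single z 1) else 0)"
      unfolding lookup_kos[of "kos f'"] by (intro sum.cong) (auto simp: ksgn_def)
    also have "\<dots> = (\<Sum>z\<in>UNIV. if z = (p1, q) then 1 else 0)"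
    proof (intro sum.cong refl)
      fix z
      have "(p1, q) \<in> T" "(p1, q') \<notin> T" using C(1) qq' by (auto simp: T_def)
      moreover have "lookup a (p1, q) > 0" by (simp add: a)
      ultimately show "(if lookup a z > 0 then lookup (kos f' {z}) (a - single z 1) else 0) =
        (if z = (p1, q) then 1 else 0)"
        unfolding f'T by (auto simp: c_def lookup_mon)
    qed
    finally show False by simp
  qed
  ultimately have "\<not> kos_acyclic ?I 1 (mdeg a)"
    unfolding kos_acyclic_def by blast
  then show ?thesis using card_C unfolding mdeg_a by blast
qed

theorem theorem5p1:
  "let L = (hom_ideal :: ('p::{finite,order} \<times> 'q::{finite,order}, 'k::field) mpoly set);
       a = (\<forall>k::nat. k > 0 \<longrightarrow> weakly_polymatroidal (ideal_pow L k));
       b = linear_quotients L;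
       c = linear_resolution L;
       d = (\<forall>i::int. i \<noteq> 1 \<longrightarrow> betti L 1 (int (card (UNIV :: 'p set)) + i) = 0);
       e = ((\<forall>x y::'p. x \<noteq> y \<longrightarrow> \<not> x \<le> y \<and> \<not> y \<le> x) \<or> (\<forall>x y::'q. x \<le> y \<or> y \<le> x))
   in (a \<longleftrightarrow> b) \<and> (b \<longleftrightarrow> c) \<and> (c \<longleftrightarrow> d) \<and> (d \<longleftrightarrow> e)"
proof -
  let ?L = "hom_ideal :: ('p \<times> 'q, 'k) mpoly set"
  let ?H = "hom_exp ` {\<phi> :: 'p \<Rightarrow> 'q. mono \<phi>}"
  let ?a = "\<forall>k::nat. k > 0 \<longrightarrow> weakly_polymatroidal (ideal_pow ?L k)"
  let ?d = "\<forall>i::int. i \<noteq> 1 \<longrightarrow> betti ?L 1 (int (card (UNIV :: 'p set)) + i) = 0"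
  let ?e = "(\<forall>x y::'p. x \<noteq> y \<longrightarrow> \<not> x \<le> y \<and> \<not> y \<le> x) \<or> (\<forall>x y::'q. x \<le> y \<or> y \<le> x)"
  have deg: "mdeg m = card (UNIV :: 'p set)" if "m \<in> ?H" for m using that by auto
  have ea: ?a if e: ?e
    by (intro allI impI hom_ideal_powers_weakly_polymatroidal e)
  have ab: "linear_quotients ?L" if a: ?a
  proof -
    have "weakly_polymatroidal (ideal_pow ?L 1)" by (rule a[rule_format]) simp
    moreover have "ideal_pow ?L 1 = ?L" unfolding hom_ideal_eq ideal_pow_mon by simp
    ultimately have "weakly_polymatroidal ?L" by (simp only:)
    then show ?thesis unfolding hom_ideal_eq
      by (rule weakly_polymatroidal_imp_linear_quotients) (rule deg)
  qed
  have bc: "linear_resolution ?L" if "linear_quotients ?L"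
    using that unfolding hom_ideal_eq by (rule linear_quotients_imp_linear_resolution) (rule deg)
  have cd: ?d if c: "linear_resolution ?L"
  proof -
    have gens: "mingens ?L = ?H" unfolding hom_ideal_eq by (rule mingens_ideal_gen_mdeg) (rule deg)
    obtain d where d: "\<forall>m\<in>?H. mdeg m = d" "\<forall>i j. j \<noteq> int i + int d \<longrightarrow> betti ?L i j = 0"
      using c unfolding linear_resolution_def gens by (elim exE conjE)
    \<comment> \<open>The existence of a generator, here from a constant map, identifies the degree
      d with |P|.\<close>
    have "hom_exp (\<lambda>_ :: 'p. undefined :: 'q) \<in> ?H" by (intro imageI) (simp add: mono_def)
    then have "d = card (UNIV :: 'p set)" using d(1) deg by metis
    then show ?thesis using d(2) by auto
  qed
  have de: ?e if d: ?d
  proof (rule ccontr)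
    assume "\<not> ?e"
    then obtain p1 p2 :: 'p and q q' :: 'q where p: "p1 < p2" and q: "\<not> q \<le> q'" "\<not> q' \<le> q"
      by (metis order_le_less)
    obtain i where i: "i > 1" "\<not> kos_acyclic ?L 1 (card (UNIV :: 'p set) + i)"
      using hom_ideal_not_kos_acyclic[OF p q, where 'k = 'k] by blast
    have "betti ?L 1 (int (card (UNIV :: 'p set) + i)) = 0" using d i(1) by simp
    then have "kos_acyclic ?L 1 (card (UNIV :: 'p set) + i)"
      unfolding hom_ideal_eq by (rule betti_1_eq_0_imp_kos_acyclic)
    with i(2) show False by blast
  qed
  \<comment> \<open>The five implications form a cycle; each converse goes round the rest of
    it.\<close>
  show ?thesis
    unfolding Let_def
    by (intro conjI iffI)
      (erule ab ea[OF de[OF cd[OF bc]]] bc ab[OF ea[OF de[OF cd]]] cd bc[OF ab[OF ea[OF de]]] de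
        cd[OF bc[OF ab[OF ea]]])+
qed

end
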